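(* Let $S$ be a compact metric space and let $\bm U^{(1)},\bm U^{(2)},\ldots$ be independent copies of a copula process $\bm U=(U_s)_{s\in S}$ satisfying $\bm U\in\mathcal D(\bm\eta)$, where $\bm\eta=(\eta_s)_{s\in S}$ is a standard max-stable process with corresponding $D$-norm $\|\cdot\|_D$. Then $$p_n(\bm U)=n\bar\pi_n(\bm U)\longrightarrow E\left(\wr\!\wr\bm\eta\wr\!\wr_D\right)\qquad (n\to\infty),$$ where $\wr\!\wr\cdot\wr\!\wr_D$ is the dual $D$-norm function corresponding to $\|\cdot\|_D$.
   Context: All operations and relations ($\max$, $>$, $\le$, ...) between functions are meant pointwise; $\bm X>\bm Y$ means $X_s>Y_s$ for all $s\in S$. $C(S)$ is the space of continuous real functions on $S$ with the sup-norm; $\bar C^+(S)=\{f\in C(S): f\ge 0\}$; $E(S)$ is the set of bounded functions $f:S\to\mathbb R$ with only finitely many discontinuities, and $\bar E^-(S)=\{f\in E(S): f\le 0\}$. A standard max-stable process (SMSP) is a process $\bm\eta=(\eta_s)_{s\in S}$ with sample paths in $C(S)$, margins $P(\eta_s\le x)=e^x$ for $x\le 0$, $s\in S$, and such that $n\max_{1\le i\le n}\bm\eta^{(i)}$ has the same distribution as $\bm\eta$ for every $n$, where $\bm\eta^{(i)}$ are iid copies of $\bm\eta$. For every SMSP there is a process $\bm Z=(Z_s)_{s\in S}$ with sample paths in $\bar C^+(S)$, $E(Z_s)=1$ for all $s$, $E(\sup_{s}Z_s)<\infty$, such that $P(\bm\eta\le f)=\exp(-\|f\|_D)$ for $f\in\bar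 E^-(S)$, where $\|f\|_D:=E(\sup_{s\in S}|f(s)|Z_s)$, $f\in E(S)$. The norm $\|\cdot\|_D$ on $E(S)$ is the $D$-norm corresponding to $\bm\eta$ and $\bm Z$ is called a generator of it. The dual $D$-norm function is $\wr\!\wr f\wr\!\wr_D:=E(\inf_{s\in S}|f(s)|Z_s)$, $f\in E(S)$; it does not depend on the choice of the generator. $E(\wr\!\wr\bm\eta\wr\!\wr_D)$ is the expectation of the function $\wr\!\wr\cdot\wr\!\wr_D$ evaluated at the random function $\bm\eta$. A copula process is a process $\bm U=(U_s)_{s\in S}$ with sample paths in $C(S)$ and each $U_s$ uniformly distributed on $(0,1)$. $\bm U\in\mathcal D(\bm\eta)$ means that $n(\max_{1\le i\le n}\bm U^{(i)}-1)\to\bm\eta$ in distribution in $(C(S),\|\cdot\|_\infty)$, for iid copies $\bm U^{(i)}$ of $\bm U$. For iid copies $\bm X^{(1)},\bm X^{(2)},\ldots$ of a process $\bm X$ in $C(S)$: $\bar\pi_n(\bm X):=P(\bm X^{(n)}>\max_{1\le i\le n-1}\bm X^{(i)})$ is the probability that $\bm X^{(n)}$ is a complete record ($\bar\pi_1(\bm X):=1$), and $p_n(\bm X):=P\big(\bigcup_{i=1}^n\{\bm X^{(i)}>\max_{1\le j\le n,\,j\ne i}\bm X^{(j)}\}\big)$ is the sample concurrence probability. *)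

theory Defs
  imports "HOL-Probability.Probability"
begin

text \<open>
  The compact metric space $S$ is a type \<open>'s\<close> of class \<^class>\<open>metric_space\<close> whose \<open>UNIV\<close> is
  compact, so that the type \<open>'s \<Rightarrow>\<^sub>C real\<close> of bounded continuous functions with the sup-norm
  is $C(S)$.
\<close>

text \<open>
  As $C(S)$ is separable, its Borel sets are generated by the point evaluations: Borel measurability
  of \<open>X\<close> says the same as measurability of every coordinate \<open>\<lambda>\<omega>. X \<omega> s\<close>.
\<close>

definition path_process :: "'w measure \<Rightarrow> ('w \<Rightarrow> 's::metric_space \<Rightarrow>\<^sub>C real) \<Rightarrow> bool" where
  "path_process M X \<longleftrightarrow> prob_space M \<and> X \<in> borel_measurable M"

lemma Max_bcontfun:
  fixes x :: "'i \<Rightarrow> 's::metric_space \<Rightarrow>\<^sub>C real"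
  assumes "finite J" "J \<noteq> {}"
  shows "(\<lambda>s. Max ((\<lambda>i. x i s) ` J)) \<in> bcontfun"
  using assms
proof (induction J rule: finite_ne_induct)
  case (singleton i)
  then show ?case by (simp add: bcontfun_def)
next
  case (insert i J)
  let ?g = "\<lambda>s. Max ((\<lambda>i. x i s) ` J)"
  have eq: "(\<lambda>s. Max ((\<lambda>i. x i s) ` insert i J)) = (\<lambda>s. max (x i s) (?g s))"
    using insert by simp
  from insert obtain B where B: "\<And>s. \<bar>?g s\<bar> \<le> B"
    unfolding bcontfun_def bounded_iff by auto
  obtain A where A: "\<And>s. \<bar>x i s\<bar> \<le> A"
    using bounded_apply_bcontfun[of "x i"] unfolding bounded_iff by auto
  have "\<bar>max (x i s) (?g s)\<bar> \<le> max A B" for s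
    using A[of s] B[of s] by linarith
  then have "bounded (range (\<lambda>s. max (x i s) (?g s)))"
    unfolding bounded_iff by auto
  moreover have "continuous_on UNIV (\<lambda>s. max (x i s) (?g s))"
    using insert by (intro continuous_on_max) (auto simp: bcontfun_def)
  ultimately show ?case unfolding eq by (simp add: bcontfun_def)
qed

definition path_max :: "'i set \<Rightarrow> ('i \<Rightarrow> 's::metric_space \<Rightarrow>\<^sub>C real) \<Rightarrow> 's \<Rightarrow>\<^sub>C real" where
  "path_max J x = Bcontfun (\<lambda>s. Max ((\<lambda>i. x i s) ` J))"

text \<open>For empty or infinite \<open>J\<close> the value of \<^const>\<open>path_max\<close> is unspecified and irrelevant below.\<close>

lemma path_max_apply:
  assumes "finite J" "J \<noteq> {}"
  shows "path_max J x s = Max ((\<lambda>i. x i s) ` J)"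
  using Max_bcontfun[OF assms, of x] by (simp add: path_max_def Bcontfun_inverse)

definition iid_copies ::
  "'w measure \<Rightarrow> (nat \<Rightarrow> 'w \<Rightarrow> 's::metric_space \<Rightarrow>\<^sub>C real) \<Rightarrow>
   'v measure \<Rightarrow> ('v \<Rightarrow> 's \<Rightarrow>\<^sub>C real) \<Rightarrow> bool" where
  "iid_copies M Xs N X \<longleftrightarrow> prob_space M \<and>
     prob_space.indep_vars M (\<lambda>_. borel) Xs {1..} \<and>
     (\<forall>i\<ge>1. distr M borel (Xs i) = distr N borel X)"

text \<open>
  Notions involving iid copies of a process only depend on its law. Where no sequence of copies is
  given, the coordinates on the following product space serve as the copies.
\<close>

definition copies_space ::
  "'w measure \<Rightarrow> ('w \<Rightarrow> 's::metric_space \<Rightarrow>\<^sub>C real) \<Rightarrow> (nat \<Rightarrow> 's \<Rightarrow>\<^sub>C real) measure" where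
  "copies_space M X = PiM {1..} (\<lambda>_. distr M borel X)"

definition standard_max_stable :: "'w measure \<Rightarrow> ('w \<Rightarrow> 's::metric_space \<Rightarrow>\<^sub>C real) \<Rightarrow> bool" where
  "standard_max_stable M \<eta> \<longleftrightarrow> path_process M \<eta> \<and>
     (\<forall>s. \<forall>x\<le>0. measure M {\<omega> \<in> space M. \<eta> \<omega> s \<le> x} = exp x) \<and>
     (\<forall>n\<ge>1. distr (copies_space M \<eta>) borel (\<lambda>x. real n *\<^sub>R path_max {1..n} x) = distr M borel \<eta>)"

definition fun_E :: "('s::metric_space \<Rightarrow> real) set" where
  "fun_E = {f. bounded (range f) \<and> finite {s. \<not> isCont f s}}"

definition fun_E_nonpos :: "('s::metric_space \<Rightarrow> real) set" where
  "fun_E_nonpos = {f \<in> fun_E. \<forall>s. f s \<le> 0}"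

definition D_norm ::
  "'z measure \<Rightarrow> ('z \<Rightarrow> 's::metric_space \<Rightarrow>\<^sub>C real) \<Rightarrow> ('s \<Rightarrow> real) \<Rightarrow> real" where
  "D_norm N Z f = (\<integral>\<zeta>. (SUP s. \<bar>f s\<bar> * Z \<zeta> s) \<partial>N)"

definition dual_D_norm ::
  "'z measure \<Rightarrow> ('z \<Rightarrow> 's::metric_space \<Rightarrow>\<^sub>C real) \<Rightarrow> ('s \<Rightarrow> real) \<Rightarrow> real" where
  "dual_D_norm N Z f = (\<integral>\<zeta>. (INF s. \<bar>f s\<bar> * Z \<zeta> s) \<partial>N)"

definition generator_of ::
  "'z measure \<Rightarrow> ('z \<Rightarrow> 's::metric_space \<Rightarrow>\<^sub>C real) \<Rightarrow>
   'w measure \<Rightarrow> ('w \<Rightarrow> 's \<Rightarrow>\<^sub>C real) \<Rightarrow> bool" where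
  "generator_of N Z M \<eta> \<longleftrightarrow> path_process N Z \<and>
     (\<forall>\<zeta>\<in>space N. \<forall>s. 0 \<le> Z \<zeta> s) \<and>
     (\<forall>s. integrable N (\<lambda>\<zeta>. Z \<zeta> s) \<and> (\<integral>\<zeta>. Z \<zeta> s \<partial>N) = 1) \<and>
     integrable N (\<lambda>\<zeta>. SUP s. Z \<zeta> s) \<and>
     (\<forall>f\<in>fun_E_nonpos. measure M {\<omega> \<in> space M. \<forall>s. \<eta> \<omega> s \<le> f s} = exp (- D_norm N Z f))"

definition copula_process :: "'w measure \<Rightarrow> ('w \<Rightarrow> 's::metric_space \<Rightarrow>\<^sub>C real) \<Rightarrow> bool" where
  "copula_process M U \<longleftrightarrow> path_process M U \<and>
     (\<forall>s. distr M borel (\<lambda>\<omega>. U \<omega> s) = uniform_measure lborel {0<..<1})"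

definition conv_in_law :: "(nat \<Rightarrow> 'b::metric_space measure) \<Rightarrow> 'b measure \<Rightarrow> bool" where
  "conv_in_law \<mu> \<nu> \<longleftrightarrow> (\<forall>\<phi> :: 'b \<Rightarrow>\<^sub>C real. (\<lambda>n. \<integral>x. \<phi> x \<partial>\<mu> n) \<longlonglongrightarrow> (\<integral>x. \<phi> x \<partial>\<nu>))"

definition in_domain_of_attraction ::
  "'v measure \<Rightarrow> ('v \<Rightarrow> 's::metric_space \<Rightarrow>\<^sub>C real) \<Rightarrow>
   'w measure \<Rightarrow> ('w \<Rightarrow> 's \<Rightarrow>\<^sub>C real) \<Rightarrow> bool" where
  "in_domain_of_attraction P U M \<eta> \<longleftrightarrow>
     conv_in_law
       (\<lambda>n. distr (copies_space P U) borel
              (\<lambda>x. real n *\<^sub>R (path_max {1..n} x - const_bcontfun 1)))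
       (distr M borel \<eta>)"

text \<open>
  \<open>f > max\<^sub>i\<^sub>\<in>\<^sub>J g\<^sub>i\<close> at every point, where the maximum over the empty set is $-\infty$; in particular
  both probabilities below are 1 for \<open>n = 1\<close>.
\<close>

definition exceeds_max :: "('s::metric_space \<Rightarrow>\<^sub>C real) \<Rightarrow> 'i set \<Rightarrow> ('i \<Rightarrow> 's \<Rightarrow>\<^sub>C real) \<Rightarrow> bool" where
  "exceeds_max f J g \<longleftrightarrow> J = {} \<or> (\<forall>s. f s > path_max J g s)"

definition complete_record_prob ::
  "'w measure \<Rightarrow> (nat \<Rightarrow> 'w \<Rightarrow> 's::metric_space \<Rightarrow>\<^sub>C real) \<Rightarrow> nat \<Rightarrow> real" where
  "complete_record_prob M Xs n =
     measure M {\<omega> \<in> space M. exceeds_max (Xs n \<omega>) {1..<n} (\<lambda>i. Xs i \<omega>)}"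

definition sample_concurrence_prob ::
  "'w measure \<Rightarrow> (nat \<Rightarrow> 'w \<Rightarrow> 's::metric_space \<Rightarrow>\<^sub>C real) \<Rightarrow> nat \<Rightarrow> real" where
  "sample_concurrence_prob M Xs n =
     measure M (\<Union>i\<in>{1..n}. {\<omega> \<in> space M. exceeds_max (Xs i \<omega>) ({1..n} - {i}) (\<lambda>j. Xs j \<omega>)})"

end

(*
With y = n (u - 1), the quantity n P(U > max of n independent copies) is the mean of
G_n(f) = n P(y > f everywhere) over f distributed as X_n = n (max of the copies - 1), and X_n
converges in law to eta. On a finite set T of points, P(X_n <= f on T) = P(y <= f on T)^n gives the
limit of n P(y exceeds f somewhere on T) as a D-norm, and inclusion-exclusion turns it into the
limit E(min_T |f| Z) of n P(y > f on T). Uniform margins make these functions of f equi-Lipschitz and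
their tails uniformly integrable, so the convergence survives averaging over X_n. Finite sets give
the upper bound at once. For the lower bound one must exclude that y exceeds f on a fine net
but not in between. This needs y to be rough above a level -c, and with probability bounded below
all other copies stay under -c, in which case X_n is rough itself; but X_n has a tight modulus of
continuity as it converges in C(S).
*)

theory Submission
  imports Defs
begin

section \<open>Measurability in the space of continuous functions\<close>

text \<open>The hypothesis controls only the law of the maximum. A single copy comes near 1 with
  probability of order 1/n, so every fact about it is a statement on
  \<open>real n * measure mu A\<close>, extracted from n-fold powers or from the law of
  \<open>norm_max\<close>. Exceedance at every point of an infinite S is out of reach of
  inclusion-exclusion; only the bound by a finite net is free. Far below the maximum a copy may
  oscillate without control, which is why its roughness is counted after truncation at - c. On the
  net, exceedance of f + 2e is demanded: one e pays for the oscillation of f, the other for that of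
  the copy, and in the limit the shift costs at most 2e E(sup Z), whatever the net. The constants
  must be chosen in the order e, K (tails), c (size of the paths), \<open>\<kappa>\<close>
  (probability of staying below - c), \<open>\<tau>\<close>, \<open>\<delta>\<close>, T. The maximum
  is over n copies while the record is that of copy n + 1, which leaves a factor 1 + 1/n at the
  end.\<close>

lemma finite_net:
  assumes "compact (UNIV :: 's::metric_space set)" "\<delta> > 0"
  obtains T :: "'s::metric_space set" where "finite T" "T \<noteq> {}" "\<And>s. \<exists>t\<in>T. dist s t < \<delta>"
proof -
  obtain T :: "'s set" where T: "finite T" "UNIV \<subseteq> (\<Union>x\<in>T. ball x \<delta>)"
    using seq_compact_imp_totally_bounded[of "UNIV :: 's set"] assms
    by (auto simp: compact_imp_seq_compact)
  then have "\<exists>t\<in>T. dist s t < \<delta>" for s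
    by (metis UNIV_I UN_E dist_commute mem_ball subsetD)
  then show thesis
    using T(1) that by blast
qed

lemma countable_dense_compact:
  assumes "compact (UNIV :: 's::metric_space set)"
  obtains E :: "'s::metric_space set" where "countable E" "\<And>s e. e > 0 \<Longrightarrow> \<exists>t\<in>E. dist s t < e"
proof -
  have "\<exists>T :: 's set. finite T \<and> (\<forall>s. \<exists>t\<in>T. dist s t < 1 / real (Suc k))" for k
    using finite_net[OF assms, of "1 / real (Suc k)"] by (metis of_nat_0_less_iff zero_less_Suc zero_less_divide_1_iff)
  then obtain T :: "nat \<Rightarrow> 's set"
    where T: "\<And>k. finite (T k)" "\<And>k s. \<exists>t\<in>T k. dist s t < 1 / real (Suc k)"
    by metis
  show thesis
  proof
    show "countable (\<Union>k. T k)"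
      using T(1) by (simp add: countable_finite)
    fix s :: 's and e :: real
    assume "e > 0"
    then obtain k where "1 / real (Suc k) < e"
      using nat_approx_posE by blast
    moreover obtain t where "t \<in> T k" "dist s t < 1 / real (Suc k)"
      using T(2) by blast
    ultimately show "\<exists>t\<in>(\<Union>k. T k). dist s t < e"
      by (intro bexI[of _ t]) auto
  qed
qed

lemma bcontfun_le_of_dense:
  fixes f g :: "'s::metric_space \<Rightarrow>\<^sub>C real"
  assumes E: "\<And>s e. e > 0 \<Longrightarrow> \<exists>t\<in>E. dist s t < e" and le: "\<And>t. t \<in> E \<Longrightarrow> f t \<le> g t"
  shows "f s \<le> g s"
proof (rule ccontr)
  assume "\<not> ?thesis"
  then have pos: "0 < f s - g s" by simp
  have "isCont (\<lambda>s. f s - g s) s"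
    using continuous_on_apply_bcontfun[of UNIV f] continuous_on_apply_bcontfun[of UNIV g]
      continuous_on_eq_continuous_at[OF open_UNIV] by (metis UNIV_I continuous_diff)
  from this[unfolded continuous_at_eps_delta, rule_format, OF pos]
  obtain d where "d > 0" "\<And>t. dist t s < d \<Longrightarrow> dist (f t - g t) (f s - g s) < f s - g s"
    by blast
  moreover obtain t where "t \<in> E" "dist s t < d"
    using E \<open>d > 0\<close> by blast
  ultimately have "dist (f t - g t) (f s - g s) < f s - g s"
    by (metis dist_commute)
  then show False
    using le[OF \<open>t \<in> E\<close>] by (auto simp: dist_real_def)
qed

lemma bcontfun_uniformly_continuous:
  fixes f :: "'s::metric_space \<Rightarrow>\<^sub>C real"
  assumes "compact (UNIV :: 's set)" "e > 0"
  obtains d where "d > 0" "\<And>s t. dist s t < d \<Longrightarrow> \<bar>f s - f t\<bar> < e"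
proof -
  have "uniformly_continuous_on UNIV f"
    using assms(1) by (intro compact_uniformly_continuous) auto
  then obtain d where "d > 0" "\<And>s t. dist t s < d \<Longrightarrow> dist (f t) (f s) < e"
    using assms(2) unfolding uniformly_continuous_on_def by (metis UNIV_I)
  then show thesis
    using that[of d] by (auto simp: dist_real_def)
qed

text \<open>
  For a mesh \<open>1 / Suc k\<close>, a net \<open>T k\<close> and rational values \<open>q\<close> on it, one function close to \<open>q\<close> is
  chosen whenever there is one.
\<close>

lemma bcontfun_separable:
  assumes cpt: "compact (UNIV :: 's::metric_space set)"
  obtains D :: "('s::metric_space \<Rightarrow>\<^sub>C real) set" where "countable D" "\<And>f e. e > 0 \<Longrightarrow> \<exists>g\<in>D. dist f g < e"
proof -
  have "\<exists>T :: 's set. finite T \<and> (\<forall>s. \<exists>t\<in>T. dist s t < 1 / real (Suc k))" for k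
    using finite_net[OF cpt, of "1 / real (Suc k)"] by (metis of_nat_0_less_iff zero_less_Suc zero_less_divide_1_iff)
  then obtain T :: "nat \<Rightarrow> 's set"
    where T: "\<And>k. finite (T k)" "\<And>k s. \<exists>t\<in>T k. dist s t < 1 / real (Suc k)"
    by metis
  define near where "near k m q f \<longleftrightarrow>
    (\<forall>s. \<forall>t\<in>T k. dist s t < 1 / real (Suc k) \<longrightarrow> \<bar>f s - q t\<bar> \<le> 1 / real (Suc m))"
    for k m and q :: "'s \<Rightarrow> real" and f :: "'s \<Rightarrow>\<^sub>C real"
  define I where "I = (SIGMA k:UNIV. SIGMA m:(UNIV::nat set). Pi\<^sub>E (T k) (\<lambda>_. \<rat>::real set))"
  \<comment> \<open>Where no function is near q the choice is arbitrary; it is evaluated below only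
    at a q near which f itself lies.\<close>
  define c where "c = (\<lambda>(k, m, q). SOME f. near k m q f)"
  show thesis
  proof
    show "countable (c ` I)"
      unfolding I_def using T(1) by (intro countable_image countable_SIGMA countable_PiE) (auto simp: countable_rat)
    fix f :: "'s \<Rightarrow>\<^sub>C real" and e :: real
    assume "e > 0"
    \<comment> \<open>Near the net, f and the chosen function both lie within r = 1 / Suc m of the
      rational values, so their distance is at most 2r < e.\<close>
    obtain m where m: "1 / real (Suc m) < e / 4"
      using nat_approx_posE[of "e / 4"] \<open>e > 0\<close> by auto
    define r where "r = 1 / real (Suc m)"
    have "r > 0" by (simp add: r_def)
    obtain d where d: "d > 0" "\<And>s t. dist s t < d \<Longrightarrow> \<bar>f s - f t\<bar> < r / 2"
      using bcontfun_uniformly_continuous[OF cpt, of "r / 2" f] \<open>r > 0\<close> by auto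
    obtain k where k: "1 / real (Suc k) < d"
      using nat_approx_posE[OF d(1)] by blast
    have "\<exists>q\<in>\<rat>. \<bar>f t - q\<bar> < r / 2" for t
    proof -
      obtain q where "q \<in> \<rat>" "f t - r / 2 < q" "q < f t"
        using Rats_dense_in_real[of "f t - r / 2" "f t"] \<open>r > 0\<close> by auto
      then show ?thesis
        by (intro bexI[of _ q]) auto
    qed
    then obtain q where q: "\<And>t. q t \<in> \<rat>" "\<And>t. \<bar>f t - q t\<bar> < r / 2"
      by metis
    define q' where "q' = restrict q (T k)"
    have "near k m q' f"
      unfolding near_def
    proof (intro allI ballI impI)
      fix s t assume "t \<in> T k" "dist s t < 1 / real (Suc k)"
      then have "\<bar>f s - f t\<bar> < r / 2" "\<bar>f t - q' t\<bar> < r / 2"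
        using d(2)[of s t] k q(2) by (auto simp: q'_def)
      then show "\<bar>f s - q' t\<bar> \<le> 1 / real (Suc m)"
        unfolding r_def[symmetric] by linarith
    qed
    then have near: "near k m q' (c (k, m, q'))" and nearf: "near k m q' f"
      unfolding c_def by (auto intro: someI)
    have "dist (f s) (c (k, m, q') s) \<le> 2 * r" for s
    proof -
      obtain t where "t \<in> T k" "dist s t < 1 / real (Suc k)"
        using T(2) by blast
      then have "\<bar>f s - q' t\<bar> \<le> r" "\<bar>c (k, m, q') s - q' t\<bar> \<le> r"
        using near nearf unfolding near_def r_def by blast+
      then show ?thesis
        by (simp add: dist_real_def)
    qed
    then have "dist f (c (k, m, q')) \<le> 2 * r"
      by (rule dist_bound)
    also have "\<dots> < e"
      using m \<open>e > 0\<close> unfolding r_def by linarith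
    finally show "\<exists>g\<in>c ` I. dist f g < e"
      using q(1) by (intro bexI[of _ "c (k, m, q')"]) (auto simp: I_def q'_def)
  qed
qed

lemma continuous_on_eval_bcontfun [continuous_intros]:
  "continuous_on A (\<lambda>f :: 's::metric_space \<Rightarrow>\<^sub>C real. f s)"
  unfolding continuous_on_iff by (metis dist_bounded le_less_trans)

lemma borel_measurable_eval_bcontfun [measurable]:
  "(\<lambda>f :: 's::metric_space \<Rightarrow>\<^sub>C real. f s) \<in> borel_measurable borel"
  by (intro borel_measurable_continuous_onI continuous_on_eval_bcontfun)

text \<open>Separability turns an open set into a countable union of closed balls, and membership in
  a closed ball is tested on a countable dense set of points. Measurability of differences and
  maxima of paths is reduced to real-valued functions this way.\<close>

lemma borel_measurable_bcontfunI:
  fixes X :: "'w \<Rightarrow> 's::metric_space \<Rightarrow>\<^sub>C real"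
  assumes cpt: "compact (UNIV :: 's set)" and X[measurable]: "\<And>s. (\<lambda>\<omega>. X \<omega> s) \<in> borel_measurable M"
  shows "X \<in> borel_measurable M"
proof (rule borel_measurableI)
  fix O' :: "('s \<Rightarrow>\<^sub>C real) set"
  assume "open O'"
  obtain D :: "('s \<Rightarrow>\<^sub>C real) set" where D: "countable D" "\<And>f e. e > 0 \<Longrightarrow> \<exists>g\<in>D. dist f g < e"
    using bcontfun_separable[OF cpt] by blast
  obtain E :: "'s set" where E: "countable E" "\<And>s e. e > 0 \<Longrightarrow> \<exists>t\<in>E. dist s t < e"
    using countable_dense_compact[OF cpt] by blast
  define I where "I = {(g, k). g \<in> D \<and> cball g (1 / real (Suc k)) \<subseteq> O'}"
  have cballs: "X -` cball g r \<inter> space M \<in> sets M" for g :: "'s \<Rightarrow>\<^sub>C real" and r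
  proof -
    have "(dist g (X \<omega>) \<le> r) = (\<forall>s\<in>E. \<bar>g s - X \<omega> s\<bar> \<le> r)" for \<omega>
    proof
      assume "\<forall>s\<in>E. \<bar>g s - X \<omega> s\<bar> \<le> r"
      then have "\<And>s. s \<in> E \<Longrightarrow> (g - X \<omega>) s \<le> const_bcontfun r s"
        and "\<And>s. s \<in> E \<Longrightarrow> (X \<omega> - g) s \<le> const_bcontfun r s"
        by (auto simp: abs_le_iff)
      then have "(g - X \<omega>) s \<le> const_bcontfun r s" "(X \<omega> - g) s \<le> const_bcontfun r s" for s
        using bcontfun_le_of_dense[OF E(2)] by blast+
      then have "dist (g s) (X \<omega> s) \<le> r" for s
        by (simp add: dist_real_def abs_le_iff)
      then show "dist g (X \<omega>) \<le> r"
        by (rule dist_bound)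
    next
      assume "dist g (X \<omega>) \<le> r"
      then show "\<forall>s\<in>E. \<bar>g s - X \<omega> s\<bar> \<le> r"
        using dist_bounded[of g _ "X \<omega>"] by (auto simp: dist_real_def intro: order_trans)
    qed
    then have "X -` cball g r \<inter> space M = {\<omega> \<in> space M. \<forall>s\<in>E. \<bar>g s - X \<omega> s\<bar> \<le> r}"
      by auto
    also have "\<dots> \<in> sets M"
      using E(1) by measurable
    finally show ?thesis .
  qed
  have "O' = (\<Union>(g, k)\<in>I. cball g (1 / real (Suc k)))"
  proof (intro set_eqI iffI)
    fix f assume "f \<in> O'"
    then obtain e where e: "e > 0" "ball f e \<subseteq> O'"
      using \<open>open O'\<close> open_contains_ball by blast
    obtain k where k: "1 / real (Suc k) < e / 2"
      using nat_approx_posE[of "e / 2"] e(1) by auto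
    obtain g where g: "g \<in> D" "dist f g < 1 / real (Suc k)"
      using D(2)[of "1 / real (Suc k)" f] by auto
    have "cball g (1 / real (Suc k)) \<subseteq> ball f e"
    proof
      fix h assume "h \<in> cball g (1 / real (Suc k))"
      then have "dist g h \<le> 1 / real (Suc k)" by simp
      then have "dist f h < e"
        using dist_triangle[of f h g] g(2) k by linarith
      then show "h \<in> ball f e" by simp
    qed
    then have "(g, k) \<in> I" "f \<in> cball g (1 / real (Suc k))"
      using e(2) g unfolding I_def by (auto simp: dist_commute)
    then show "f \<in> (\<Union>(g, k)\<in>I. cball g (1 / real (Suc k)))" by blast
  qed (auto simp: I_def)
  then have "X -` O' \<inter> space M = (\<Union>(g, k)\<in>I. X -` cball g (1 / real (Suc k)) \<inter> space M)"
    by auto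
  also have "\<dots> \<in> sets M"
  proof (rule sets.countable_UN')
    show "countable I"
      by (rule countable_subset[of _ "D \<times> UNIV"]) (auto simp: I_def D(1))
  qed (use cballs in auto)
  finally show "X -` O' \<inter> space M \<in> sets M" .
qed

section \<open>Records of independent copies\<close>

text \<open>The quantifier over J absorbs the convention for the empty maximum, so n = 1 needs no
  separate treatment.\<close>

lemma exceeds_max_iff:
  assumes "finite J"
  shows "exceeds_max f J g \<longleftrightarrow> (\<forall>j\<in>J. \<forall>s. g j s < f s)"
  using assms by (cases "J = {}") (auto simp: exceeds_max_def path_max_apply)

lemma path_max_cong:
  assumes "\<And>i. i \<in> J \<Longrightarrow> x i = y i"
  shows "path_max J x = path_max J y"
  using assms by (simp add: path_max_def cong: image_cong)

lemma borel_measurable_path_max: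
  fixes x :: "'i \<Rightarrow> 'w \<Rightarrow> 's::metric_space \<Rightarrow>\<^sub>C real"
  assumes cpt: "compact (UNIV :: 's set)" and J: "finite J" "J \<noteq> {}"
    and [measurable]: "\<And>i. i \<in> J \<Longrightarrow> x i \<in> borel_measurable M"
  shows "(\<lambda>\<omega>. path_max J (\<lambda>i. x i \<omega>)) \<in> borel_measurable M"
proof (rule borel_measurable_bcontfunI[OF cpt])
  fix s
  have "(\<lambda>\<omega>. Max ((\<lambda>i. x i \<omega> s) ` J)) \<in> borel_measurable M"
    using J(1) by (intro borel_measurable_Max) measurable
  then show "(\<lambda>\<omega>. path_max J (\<lambda>i. x i \<omega>) s) \<in> borel_measurable M"
    by (simp add: path_max_apply J)
qed

lemma closed_bcontfun_ge: "closed {f :: 's::metric_space \<Rightarrow>\<^sub>C real. \<forall>s. c s \<le> f s}"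
  unfolding Collect_all_eq
  by (intro closed_INT ballI closed_Collect_le continuous_intros)

lemma closed_bcontfun_le: "closed {f :: 's::metric_space \<Rightarrow>\<^sub>C real. \<forall>s\<in>T. f s \<le> c s}"
  unfolding Collect_ball_eq
  by (intro closed_INT ballI closed_Collect_le continuous_intros)

text \<open>A continuous function on a compact space attains its infimum, so strict positivity
  everywhere is a lower bound 1 / Suc k for some k. An uncountable intersection of open sets thus
  becomes a countable union of closed ones.\<close>

lemma borel_bcontfun_pos:
  assumes cpt: "compact (UNIV :: 's::metric_space set)"
  shows "{f :: 's \<Rightarrow>\<^sub>C real. \<forall>s. 0 < f s} \<in> sets borel"
proof -
  have "(\<forall>s. 0 < f s) \<longleftrightarrow> (\<exists>k. \<forall>s. 1 / real (Suc k) \<le> f s)" for f :: "'s \<Rightarrow>\<^sub>C real"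
  proof
    assume pos: "\<forall>s. 0 < f s"
    obtain s0 where "\<And>s. f s0 \<le> f s"
      using continuous_attains_inf[OF cpt, of f] by auto
    moreover obtain k where "1 / real (Suc k) < f s0"
      using nat_approx_posE pos by blast
    ultimately show "\<exists>k. \<forall>s. 1 / real (Suc k) \<le> f s"
      by (meson less_imp_le order_trans)
  next
    assume "\<exists>k. \<forall>s. 1 / real (Suc k) \<le> f s"
    then obtain k where "\<And>s. 1 / real (Suc k) \<le> f s" by blast
    moreover have "0 < 1 / real (Suc k)" by simp
    ultimately show "\<forall>s. 0 < f s"
      using less_le_trans by blast
  qed
  then have "{f :: 's \<Rightarrow>\<^sub>C real. \<forall>s. 0 < f s} = (\<Union>k. {f :: 's \<Rightarrow>\<^sub>C real. \<forall>s. 1 / real (Suc k) \<le> f s})"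
    by auto
  also have "\<dots> \<in> sets borel"
    by (intro sets.countable_UN) (auto intro!: borel_closed closed_bcontfun_ge simp del: of_nat_Suc)
  finally show ?thesis .
qed

lemma pred_bcontfun_less:
  fixes X Y :: "'w \<Rightarrow> 's::metric_space \<Rightarrow>\<^sub>C real"
  assumes cpt: "compact (UNIV :: 's set)"
    and [measurable]: "X \<in> borel_measurable M" "Y \<in> borel_measurable M"
  shows "Measurable.pred M (\<lambda>\<omega>. \<forall>s. X \<omega> s < Y \<omega> s)"
proof -
  have [measurable]: "(\<lambda>\<omega>. Y \<omega> - X \<omega>) \<in> borel_measurable M"
    by (rule borel_measurable_bcontfunI[OF cpt]) simp
  have "(\<lambda>\<omega>. Y \<omega> - X \<omega>) -` {f :: 's \<Rightarrow>\<^sub>C real. \<forall>s. 0 < f s} \<inter> space M \<in> sets M"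
    by (rule measurable_sets[OF _ borel_bcontfun_pos[OF cpt]]) simp
  also have "(\<lambda>\<omega>. Y \<omega> - X \<omega>) -` {f :: 's \<Rightarrow>\<^sub>C real. \<forall>s. 0 < f s} \<inter> space M = {\<omega> \<in> space M. \<forall>s. X \<omega> s < Y \<omega> s}"
    by auto
  finally show ?thesis
    by (simp add: pred_def)
qed

section \<open>Standing hypotheses, and the laws of one copy and of the normalized maximum\<close>

locale copula_attraction =
  fixes M :: "'w measure" and Us :: "nat \<Rightarrow> 'w \<Rightarrow> 's::metric_space \<Rightarrow>\<^sub>C real"
    and P :: "'u measure" and U :: "'u \<Rightarrow> 's \<Rightarrow>\<^sub>C real"
    and Q :: "'v measure" and \<eta> :: "'v \<Rightarrow> 's \<Rightarrow>\<^sub>C real"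
    and N :: "'z measure" and Z :: "'z \<Rightarrow> 's \<Rightarrow>\<^sub>C real"
  assumes cpt: "compact (UNIV :: 's set)"
    and copula: "copula_process P U"
    and iid: "iid_copies M Us P U"
    and smsp: "standard_max_stable Q \<eta>"
    and gen: "generator_of N Z Q \<eta>"
    and attraction: "in_domain_of_attraction P U Q \<eta>"

sublocale copula_attraction \<subseteq> M: prob_space M
  using iid by (simp add: iid_copies_def)

sublocale copula_attraction \<subseteq> P: prob_space P
  using copula by (simp add: copula_process_def path_process_def)

sublocale copula_attraction \<subseteq> Q: prob_space Q
  using smsp by (simp add: standard_max_stable_def path_process_def)

sublocale copula_attraction \<subseteq> N: prob_space N
  using gen by (simp add: generator_of_def path_process_def)

context copula_attraction
begin

lemma U_measurable [measurable]: "U \<in> borel_measurable P"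
  using copula by (simp add: copula_process_def path_process_def)

lemma eta_measurable [measurable]: "\<eta> \<in> borel_measurable Q"
  using smsp by (simp add: standard_max_stable_def path_process_def)

lemma Z_measurable [measurable]: "Z \<in> borel_measurable N"
  using gen by (simp add: generator_of_def path_process_def)

lemma indep: "M.indep_vars (\<lambda>_. borel) Us {1..}"
  using iid by (simp add: iid_copies_def)

lemma Us_measurable [measurable]: "1 \<le> i \<Longrightarrow> Us i \<in> borel_measurable M"
  using indep by (simp add: M.indep_vars_def)

definition mu :: "('s \<Rightarrow>\<^sub>C real) measure" where
  "mu = distr P borel U"

definition norm_max :: "nat \<Rightarrow> (nat \<Rightarrow> 's \<Rightarrow>\<^sub>C real) \<Rightarrow> 's \<Rightarrow>\<^sub>C real" where
  "norm_max n x = real n *\<^sub>R (path_max {1..n} x - const_bcontfun 1)"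

definition nu :: "nat \<Rightarrow> ('s \<Rightarrow>\<^sub>C real) measure" where
  "nu n = distr M borel (\<lambda>\<omega>. norm_max n (\<lambda>i. Us i \<omega>))"

definition nu_lim :: "('s \<Rightarrow>\<^sub>C real) measure" where
  "nu_lim = distr Q borel \<eta>"

lemma sets_mu [measurable_cong, simp]: "sets mu = sets borel" and space_mu [simp]: "space mu = UNIV"
  and sets_nu [measurable_cong, simp]: "sets (nu n) = sets borel" and space_nu [simp]: "space (nu n) = UNIV"
  and sets_nu_lim [measurable_cong, simp]: "sets nu_lim = sets borel"
  and space_nu_lim [simp]: "space nu_lim = UNIV"
  by (simp_all add: mu_def nu_def nu_lim_def)

sublocale mu: prob_space mu
  unfolding mu_def by (rule P.prob_space_distr) simp

sublocale nu_lim: prob_space nu_lim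
  unfolding nu_lim_def by (rule Q.prob_space_distr) simp

lemma distr_Us: "1 \<le> i \<Longrightarrow> distr M borel (Us i) = mu"
  using iid by (simp add: iid_copies_def mu_def)

lemma measurable_norm_max:
  assumes "n \<ge> 1" and x: "\<And>i. 1 \<le> i \<Longrightarrow> i \<le> n \<Longrightarrow> x i \<in> borel_measurable L"
  shows "(\<lambda>\<omega>. norm_max n (\<lambda>i. x i \<omega>)) \<in> borel_measurable L"
proof (rule borel_measurable_bcontfunI[OF cpt])
  fix s
  have [measurable]: "(\<lambda>\<omega>. path_max {1..n} (\<lambda>i. x i \<omega>)) \<in> borel_measurable L"
    using assms by (intro borel_measurable_path_max[OF cpt]) auto
  show "(\<lambda>\<omega>. norm_max n (\<lambda>i. x i \<omega>) s) \<in> borel_measurable L"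
    by (simp add: norm_max_def del: One_nat_def)
qed

lemma norm_max_Us_measurable [measurable]:
  "n \<ge> 1 \<Longrightarrow> (\<lambda>\<omega>. norm_max n (\<lambda>i. Us i \<omega>)) \<in> borel_measurable M"
  by (intro measurable_norm_max) auto

lemma norm_max_le_iff:
  assumes "n \<ge> 1"
  shows "norm_max n x s \<le> c \<longleftrightarrow> (\<forall>i\<in>{1..n}. real n * (x i s - 1) \<le> c)"
proof -
  have "norm_max n x s \<le> c \<longleftrightarrow> Max ((\<lambda>i. x i s) ` {1..n}) \<le> c / real n + 1"
    using assms by (simp add: norm_max_def path_max_apply field_simps)
  also have "\<dots> \<longleftrightarrow> (\<forall>i\<in>{1..n}. x i s \<le> c / real n + 1)"
    using assms by (subst Max_le_iff) auto
  also have "\<dots> \<longleftrightarrow> (\<forall>i\<in>{1..n}. real n * (x i s - 1) \<le> c)"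
    using assms by (intro ball_cong) (auto simp: field_simps)
  finally show ?thesis .
qed

lemma norm_max_less_iff:
  assumes "n \<ge> 1"
  shows "norm_max n x s < real n * (y - 1) \<longleftrightarrow> (\<forall>i\<in>{1..n}. x i s < y)"
proof -
  have "norm_max n x s < real n * (y - 1) \<longleftrightarrow> Max ((\<lambda>i. x i s) ` {1..n}) < y"
    using assms by (simp add: norm_max_def path_max_apply)
  then show ?thesis
    using assms by (subst (asm) Max_less_iff) auto
qed

lemma PiM_Us: "distr M (PiM {1..} (\<lambda>_. borel)) (\<lambda>\<omega>. \<lambda>i\<in>{1..}. Us i \<omega>) = PiM {1..} (\<lambda>_. mu)"
proof -
  have "distr M (PiM {1..} (\<lambda>_. borel)) (\<lambda>\<omega>. \<lambda>i\<in>{1..}. Us i \<omega>) = PiM {1..} (\<lambda>i. distr M borel (Us i))"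
    using indep by (subst (asm) M.indep_vars_iff_distr_eq_PiM') auto
  also have "\<dots> = PiM {1..} (\<lambda>_. mu)"
    using distr_Us by (intro PiM_cong) auto
  finally show ?thesis .
qed

lemma restrict_Us_measurable:
  "(\<lambda>\<omega>. \<lambda>i\<in>{1..}. Us i \<omega>) \<in> measurable M (PiM {1..} (\<lambda>_. borel))"
  by (intro measurable_restrict) simp

text \<open>Attraction is stated for the coordinates of a product space, the record probabilities
  for the given copies. Independence makes the joint law of the copies that same product measure,
  and \<open>norm_max n\<close> reads only the indices from 1 to n.\<close>

lemma nu_eq_copies:
  assumes "n \<ge> 1"
  shows "nu n = distr (copies_space P U) borel (norm_max n)"
proof -
  have [measurable]: "norm_max n \<in> borel_measurable (PiM {1..} (\<lambda>_. borel))"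
    using assms by (intro measurable_norm_max[where x = "\<lambda>i x. x i"]) auto
  have "distr (copies_space P U) borel (norm_max n)
      = distr (distr M (PiM {1..} (\<lambda>_. borel)) (\<lambda>\<omega>. \<lambda>i\<in>{1..}. Us i \<omega>)) borel (norm_max n)"
    by (simp only: PiM_Us) (simp add: copies_space_def mu_def)
  also have "\<dots> = distr M borel (norm_max n \<circ> (\<lambda>\<omega>. \<lambda>i\<in>{1..}. Us i \<omega>))"
    by (intro distr_distr restrict_Us_measurable) (simp del: One_nat_def)
  also have "norm_max n \<circ> (\<lambda>\<omega>. \<lambda>i\<in>{1..}. Us i \<omega>) = (\<lambda>\<omega>. norm_max n (\<lambda>i. Us i \<omega>))"
    by (auto simp: norm_max_def fun_eq_iff intro!: bcontfun_eqI arg_cong[of _ _ "\<lambda>f. _ *\<^sub>R (f - _)"] path_max_cong)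
  finally show ?thesis
    by (simp add: nu_def)
qed

lemma nu_tendsto:
  fixes \<phi> :: "('s \<Rightarrow>\<^sub>C real) \<Rightarrow> real"
  assumes "continuous_on UNIV \<phi>" "\<And>f. \<bar>\<phi> f\<bar> \<le> B"
  shows "(\<lambda>n. \<integral>f. \<phi> f \<partial>nu n) \<longlonglongrightarrow> (\<integral>f. \<phi> f \<partial>nu_lim)"
proof -
  have "\<phi> \<in> bcontfun"
    using assms by (intro bcontfun_normI[of _ B]) auto
  then obtain \<psi> where \<psi>: "\<phi> = apply_bcontfun \<psi>"
    by (rule bcontfunE)
  have "(\<lambda>n. \<integral>f. \<phi> f \<partial>distr (copies_space P U) borel (norm_max n)) \<longlonglongrightarrow> (\<integral>f. \<phi> f \<partial>nu_lim)"
    using attraction unfolding in_domain_of_attraction_def conv_in_law_def \<psi> nu_lim_def norm_max_def[abs_def]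
    by blast
  then show ?thesis
    by (rule Lim_transform_eventually) (auto simp: eventually_sequentially nu_eq_copies intro!: exI[of _ 1])
qed

section \<open>Events about several independent copies\<close>

lemma measure_Us_vimage: "1 \<le> i \<Longrightarrow> A \<in> sets borel \<Longrightarrow> measure M (Us i -` A \<inter> space M) = measure mu A"
  by (metis Us_measurable distr_Us measure_distr)

lemma prob_all_in:
  assumes "n \<ge> 1" and A: "\<And>i. i \<in> {1..n} \<Longrightarrow> A i \<in> sets borel"
  shows "measure M {\<omega> \<in> space M. \<forall>i\<in>{1..n}. Us i \<omega> \<in> A i} = (\<Prod>i\<in>{1..n}. measure mu (A i))"
proof -
  have "{\<omega> \<in> space M. \<forall>i\<in>{1..n}. Us i \<omega> \<in> A i} = (\<Inter>i\<in>{1..n}. Us i -` A i \<inter> space M)"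
    using assms(1) by auto
  then have "measure M {\<omega> \<in> space M. \<forall>i\<in>{1..n}. Us i \<omega> \<in> A i}
      = (\<Prod>i\<in>{1..n}. measure M (Us i -` A i \<inter> space M))"
    using assms by (simp only:, intro M.indep_varsD[OF indep]) auto
  also have "\<dots> = (\<Prod>i\<in>{1..n}. measure mu (A i))"
    using A by (intro prod.cong) (auto simp: measure_Us_vimage)
  finally show ?thesis .
qed

text \<open>The maximum stays below c exactly if every copy does. T may be infinite, since a
  pointwise upper bound cuts out a closed set of paths; T = UNIV is used for the event that the
  maximum stays below a level.\<close>

lemma nu_le:
  assumes "n \<ge> 1"
  shows "measure (nu n) {f :: 's \<Rightarrow>\<^sub>C real. \<forall>s\<in>T. f s \<le> c s} = measure mu {u :: 's \<Rightarrow>\<^sub>C real. \<forall>s\<in>T. real n * (u s - 1) \<le> c s} ^ n"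
proof -
  have *: "{u :: 's \<Rightarrow>\<^sub>C real. \<forall>s\<in>T. real n * (u s - 1) \<le> c s} = {u :: 's \<Rightarrow>\<^sub>C real. \<forall>s\<in>T. u s \<le> c s / real n + 1}"
    using assms by (auto simp: field_simps)
  have "measure (nu n) {f :: 's \<Rightarrow>\<^sub>C real. \<forall>s\<in>T. f s \<le> c s}
      = measure M {\<omega> \<in> space M. \<forall>s\<in>T. norm_max n (\<lambda>i. Us i \<omega>) s \<le> c s}"
    using assms unfolding nu_def
    by (subst measure_distr) (auto intro!: borel_closed closed_bcontfun_le arg_cong[of _ _ "measure M"])
  also have "{\<omega> \<in> space M. \<forall>s\<in>T. norm_max n (\<lambda>i. Us i \<omega>) s \<le> c s}
      = {\<omega> \<in> space M. \<forall>i\<in>{1..n}. Us i \<omega> \<in> {u :: 's \<Rightarrow>\<^sub>C real. \<forall>s\<in>T. real n * (u s - 1) \<le> c s}}"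
    using assms by (auto simp: norm_max_le_iff)
  also have "measure M \<dots> = measure mu {u :: 's \<Rightarrow>\<^sub>C real. \<forall>s\<in>T. real n * (u s - 1) \<le> c s} ^ n"
    using assms by (subst prob_all_in) (auto simp: * intro!: borel_closed closed_bcontfun_le)
  finally show ?thesis .
qed

text \<open>Disjointness of A and B makes the n events mutually exclusive, so their probabilities
  add up and the factor n is exact. This is what turns a statement about the maximum into one about
  n times the mass of A under a single copy.\<close>

lemma prob_one_exceeds:
  assumes n: "n \<ge> 1" and [measurable]: "A \<in> sets borel" "B \<in> sets borel" and disj: "A \<inter> B = {}"
  shows "measure M (\<Union>i\<in>{1..n}. {\<omega> \<in> space M. Us i \<omega> \<in> A \<and> (\<forall>j\<in>{1..n}-{i}. Us j \<omega> \<in> B)})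
    = real n * measure mu A * measure mu B ^ (n - 1)"
proof -
  define C where "C i j = (if j = i then A else B)" for i j :: nat
  have C[measurable]: "C i j \<in> sets borel" for i j
    by (simp add: C_def)
  have eq: "{\<omega> \<in> space M. Us i \<omega> \<in> A \<and> (\<forall>j\<in>{1..n}-{i}. Us j \<omega> \<in> B)}
      = {\<omega> \<in> space M. \<forall>j\<in>{1..n}. Us j \<omega> \<in> C i j}" if "i \<in> {1..n}" for i
    using that by (auto simp: C_def)
  have pr: "measure M {\<omega> \<in> space M. \<forall>j\<in>{1..n}. Us j \<omega> \<in> C i j} = measure mu A * measure mu B ^ (n - 1)"
    if i: "i \<in> {1..n}" for i
  proof -
    have "(\<Prod>j\<in>{1..n}. measure mu (C i j)) = measure mu A * (\<Prod>j\<in>{1..n}-{i}. measure mu B)"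
      using i by (subst prod.remove[of _ i]) (auto simp: C_def)
    then show ?thesis
      using i n by (subst prob_all_in) auto
  qed
  have "measure M (\<Union>i\<in>{1..n}. {\<omega> \<in> space M. \<forall>j\<in>{1..n}. Us j \<omega> \<in> C i j})
      = (\<Sum>i\<in>{1..n}. measure M {\<omega> \<in> space M. \<forall>j\<in>{1..n}. Us j \<omega> \<in> C i j})"
  proof (rule M.finite_measure_finite_Union)
    show "(\<lambda>i. {\<omega> \<in> space M. \<forall>j\<in>{1..n}. Us j \<omega> \<in> C i j}) ` {1..n} \<subseteq> sets M"
      by auto
    show "disjoint_family_on (\<lambda>i. {\<omega> \<in> space M. \<forall>j\<in>{1..n}. Us j \<omega> \<in> C i j}) {1..n}"
      unfolding disjoint_family_on_def
    proof (intro ballI impI)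
      fix i k assume ik: "i \<in> {1..n}" "k \<in> {1..n}" "i \<noteq> k"
      show "{\<omega> \<in> space M. \<forall>j\<in>{1..n}. Us j \<omega> \<in> C i j} \<inter> {\<omega> \<in> space M. \<forall>j\<in>{1..n}. Us j \<omega> \<in> C k j} = {}"
      proof safe
        fix \<omega> assume "\<forall>j\<in>{1..n}. Us j \<omega> \<in> C i j" "\<forall>j\<in>{1..n}. Us j \<omega> \<in> C k j"
        then have "Us i \<omega> \<in> A" "Us i \<omega> \<in> B"
          using ik by (force simp: C_def)+
        then show "\<omega> \<in> {}"
          using disj by blast
      qed
    qed
  qed simp
  also have "\<dots> = real n * measure mu A * measure mu B ^ (n - 1)"
    by (simp add: pr del: One_nat_def)
  also have "(\<Union>i\<in>{1..n}. {\<omega> \<in> space M. \<forall>j\<in>{1..n}. Us j \<omega> \<in> C i j})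
      = (\<Union>i\<in>{1..n}. {\<omega> \<in> space M. Us i \<omega> \<in> A \<and> (\<forall>j\<in>{1..n}-{i}. Us j \<omega> \<in> B)})"
    by (intro SUP_cong refl eq[symmetric])
  finally show ?thesis .
qed

text \<open>Fubini for the maximum of the first n copies and the independent copy n + 1. The second
  part, needed for the integral to make sense, is the measurability of the slices of a product
  set.\<close>

lemma complete_record_prob_Suc:
  assumes n: "n \<ge> 1"
  shows "complete_record_prob M Us (Suc n) = (\<integral>f. measure mu {u :: 's \<Rightarrow>\<^sub>C real. \<forall>s. f s < real n * (u s - 1)} \<partial>nu n)"
    and "(\<lambda>f :: 's \<Rightarrow>\<^sub>C real. measure mu {u :: 's \<Rightarrow>\<^sub>C real. \<forall>s. f s < real n * (u s - 1)}) \<in> borel_measurable borel"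
proof -
  let ?X = "\<lambda>\<omega>. norm_max n (\<lambda>i. Us i \<omega>)"
  define E where "E = {p. \<forall>s. apply_bcontfun (fst p :: 's \<Rightarrow>\<^sub>C real) s < real n * (apply_bcontfun (snd p :: 's \<Rightarrow>\<^sub>C real) s - 1)}"
  have [measurable]: "(\<lambda>u :: 's \<Rightarrow>\<^sub>C real. real n *\<^sub>R (u - const_bcontfun 1)) \<in> borel_measurable borel"
    by (intro borel_measurable_bcontfunI[OF cpt]) simp
  have "Measurable.pred (borel \<Otimes>\<^sub>M borel)
      (\<lambda>p. \<forall>s. apply_bcontfun (fst p :: 's \<Rightarrow>\<^sub>C real) s < apply_bcontfun (real n *\<^sub>R (snd p - const_bcontfun 1)) s)"
    by (rule pred_bcontfun_less[OF cpt]) measurable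
  then have E: "E \<in> sets (borel \<Otimes>\<^sub>M borel)"
    by (simp add: E_def pred_def space_pair_measure)
  have E': "E \<in> sets (borel \<Otimes>\<^sub>M mu)"
    using E by (simp cong: sets_pair_measure_cong)
  have slice: "Pair f -` E = {u :: 's \<Rightarrow>\<^sub>C real. \<forall>s. f s < real n * (u s - 1)}" for f
    by (auto simp: E_def)
  have "(\<lambda>f :: 's \<Rightarrow>\<^sub>C real. emeasure mu {u :: 's \<Rightarrow>\<^sub>C real. \<forall>s. f s < real n * (u s - 1)}) \<in> borel_measurable borel"
    using mu.measurable_emeasure_Pair[OF E'] by (simp only: slice)
  then show meas: "(\<lambda>f :: 's \<Rightarrow>\<^sub>C real. measure mu {u :: 's \<Rightarrow>\<^sub>C real. \<forall>s. f s < real n * (u s - 1)}) \<in> borel_measurable borel"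
    unfolding measure_def by (rule borel_measurable_enn2real)
  have "M.indep_var (PiM {1..n} (\<lambda>_. borel)) (\<lambda>\<omega>. restrict (\<lambda>i. Us i \<omega>) {1..n})
      (PiM {Suc n} (\<lambda>_. borel)) (\<lambda>\<omega>. restrict (\<lambda>i. Us i \<omega>) {Suc n})"
    by (rule M.indep_var_restrict[OF indep]) auto
  then have "M.indep_var borel (norm_max n \<circ> (\<lambda>\<omega>. restrict (\<lambda>i. Us i \<omega>) {1..n}))
      borel ((\<lambda>x. x (Suc n)) \<circ> (\<lambda>\<omega>. restrict (\<lambda>i. Us i \<omega>) {Suc n}))"
    using n by (elim M.indep_var_compose) (auto intro!: measurable_norm_max[where x = "\<lambda>i x. x i"])
  also have "norm_max n \<circ> (\<lambda>\<omega>. restrict (\<lambda>i. Us i \<omega>) {1..n}) = ?X"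
    by (auto simp: norm_max_def fun_eq_iff intro!: bcontfun_eqI arg_cong[of _ _ "\<lambda>f. _ *\<^sub>R (f - _)"] path_max_cong)
  also have "(\<lambda>x. x (Suc n)) \<circ> (\<lambda>\<omega>. restrict (\<lambda>i. Us i \<omega>) {Suc n}) = Us (Suc n)"
    by (simp add: fun_eq_iff)
  finally have "nu n \<Otimes>\<^sub>M mu = distr M (borel \<Otimes>\<^sub>M borel) (\<lambda>\<omega>. (?X \<omega>, Us (Suc n) \<omega>))"
    by (simp add: M.indep_var_distribution_eq nu_def distr_Us)
  then have "emeasure (nu n \<Otimes>\<^sub>M mu) E = emeasure M ((\<lambda>\<omega>. (?X \<omega>, Us (Suc n) \<omega>)) -` E \<inter> space M)"
    using n E by (simp add: emeasure_distr)
  also have "(\<lambda>\<omega>. (?X \<omega>, Us (Suc n) \<omega>)) -` E \<inter> space M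
      = {\<omega> \<in> space M. exceeds_max (Us (Suc n) \<omega>) {1..<Suc n} (\<lambda>i. Us i \<omega>)}"
    using n by (auto simp: E_def norm_max_less_iff exceeds_max_iff)
  finally have "complete_record_prob M Us (Suc n) = enn2real (emeasure (nu n \<Otimes>\<^sub>M mu) E)"
    by (simp add: complete_record_prob_def measure_def)
  also have "emeasure (nu n \<Otimes>\<^sub>M mu) E = (\<integral>\<^sup>+f. emeasure mu (Pair f -` E) \<partial>nu n)"
    using E by (intro mu.emeasure_pair_measure_alt) (simp cong: sets_pair_measure_cong)
  also have "\<dots> = (\<integral>\<^sup>+f. ennreal (measure mu {u :: 's \<Rightarrow>\<^sub>C real. \<forall>s. f s < real n * (u s - 1)}) \<partial>nu n)"
    by (simp add: slice mu.emeasure_eq_measure)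
  also have "enn2real \<dots> = (\<integral>f. measure mu {u :: 's \<Rightarrow>\<^sub>C real. \<forall>s. f s < real n * (u s - 1)} \<partial>nu n)"
    using meas by (intro integral_eq_nn_integral[symmetric]) auto
  finally show "complete_record_prob M Us (Suc n) = (\<integral>f. measure mu {u :: 's \<Rightarrow>\<^sub>C real. \<forall>s. f s < real n * (u s - 1)} \<partial>nu n)" .
qed

text \<open>Exchangeability: after passing to the coordinates of a product of equal factors,
  swapping i and n preserves the measure and carries one event to the other.\<close>

lemma exceeds_prob_eq:
  assumes i: "i \<in> {1..n}"
  shows "measure M {\<omega> \<in> space M. exceeds_max (Us i \<omega>) ({1..n} - {i}) (\<lambda>j. Us j \<omega>)} = complete_record_prob M Us n"
proof -
  define L where "L = PiM {1..} (\<lambda>_::nat. mu)"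
  define C where "C k = {x \<in> space L. exceeds_max (x k) ({1..n} - {k}) x}" for k
  have n: "n \<in> {1..n}" using i by simp
  have C: "C k \<in> sets L" if "k \<in> {1..n}" for k
  proof -
    have [measurable]: "(\<lambda>x. x j) \<in> borel_measurable L" if "j \<in> {1..n}" for j
      using that measurable_component_singleton[of j "{1..}" "\<lambda>_. mu"] unfolding L_def by simp
    have "Measurable.pred L (\<lambda>x. \<forall>j\<in>{1..n} - {k}. \<forall>s. x j s < x k s)"
      using that by (intro pred_intros_finite pred_bcontfun_less[OF cpt]) auto
    then show ?thesis
      by (simp add: C_def exceeds_max_iff pred_def)
  qed
  have setsL: "sets L = sets (PiM {1..} (\<lambda>_::nat. borel))"
    unfolding L_def by (intro sets_PiM_cong) auto
  have to_L: "measure M {\<omega> \<in> space M. exceeds_max (Us k \<omega>) ({1..n} - {k}) (\<lambda>j. Us j \<omega>)} = measure L (C k)"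
    if k: "k \<in> {1..n}" for k
  proof -
    have "measure L (C k) = measure M ((\<lambda>\<omega>. \<lambda>i\<in>{1..}. Us i \<omega>) -` C k \<inter> space M)"
      using C[OF k] setsL unfolding L_def PiM_Us[symmetric]
      by (intro measure_distr restrict_Us_measurable) simp
    also have "(\<lambda>\<omega>. \<lambda>i\<in>{1..}. Us i \<omega>) -` C k \<inter> space M
        = {\<omega> \<in> space M. exceeds_max (Us k \<omega>) ({1..n} - {k}) (\<lambda>j. Us j \<omega>)}"
      using k by (auto simp: C_def L_def space_PiM exceeds_max_iff)
    finally show ?thesis by simp
  qed
  define f where "f = Transposition.transpose i n"
  have f1: "f k \<in> {1..}" if "k \<in> {1..}" for k
    using i that by (auto simp: f_def Transposition.transpose_def)
  have L: "L = distr L L (\<lambda>x. \<lambda>k\<in>{1..}. x (f k))"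
    unfolding L_def using f1
    by (intro distr_PiM_reindex[symmetric, where K = "{1..}" and I = "{1..}"] mu.prob_space_axioms)
       (auto simp: f_def intro: inj_on_subset[OF inj_transpose])
  have meas: "(\<lambda>x. \<lambda>k\<in>{1..}. x (f k)) \<in> measurable L L"
    unfolding L_def using f1 by (intro measurable_restrict measurable_component_singleton) auto
  have f_im: "f ` ({1..n} - {n}) = {1..n} - {i}"
    using i by (auto simp: f_def Transposition.transpose_def image_iff)
  have "measure L (C n) = measure L ((\<lambda>x. \<lambda>k\<in>{1..}. x (f k)) -` C n \<inter> space L)"
    using C[OF n] by (subst L) (rule measure_distr[OF meas])
  also have "(\<lambda>x. \<lambda>k\<in>{1..}. x (f k)) -` C n \<inter> space L = C i"
  proof -
    have "exceeds_max ((\<lambda>k\<in>{1..}. x (f k)) n) ({1..n} - {n}) (\<lambda>k\<in>{1..}. x (f k))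
        \<longleftrightarrow> exceeds_max (x i) ({1..n} - {i}) x" for x :: "nat \<Rightarrow> 's \<Rightarrow>\<^sub>C real"
    proof -
      have "(\<forall>j\<in>{1..n} - {n}. \<forall>s. x (f j) s < x i s) \<longleftrightarrow> (\<forall>j\<in>f ` ({1..n} - {n}). \<forall>s. x j s < x i s)"
        by blast
      then show ?thesis
        using n unfolding f_im by (auto simp: exceeds_max_iff f_def)
    qed
    then show ?thesis
      using f1 by (auto simp: C_def L_def space_PiM)
  qed
  finally have "measure L (C i) = measure L (C n)" ..
  moreover have "{1..<n} = {1..n} - {n}" by auto
  ultimately show ?thesis
    using to_L[OF i] to_L[OF n] by (simp add: complete_record_prob_def)
qed

text \<open>Two copies cannot exceed each other at the same point, so the n events are disjoint, and
  by exchangeability they are equally likely.\<close>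

lemma sample_concurrence_eq:
  assumes "n \<ge> 1"
  shows "sample_concurrence_prob M Us n = real n * complete_record_prob M Us n"
proof -
  let ?E = "\<lambda>i. {\<omega> \<in> space M. exceeds_max (Us i \<omega>) ({1..n} - {i}) (\<lambda>j. Us j \<omega>)}"
  have "measure M (\<Union>i\<in>{1..n}. ?E i) = (\<Sum>i\<in>{1..n}. measure M (?E i))"
  proof (rule M.finite_measure_finite_Union)
    have "?E i \<in> sets M" if "i \<in> {1..n}" for i
    proof -
      have "Measurable.pred M (\<lambda>\<omega>. \<forall>j\<in>{1..n} - {i}. \<forall>s. Us j \<omega> s < Us i \<omega> s)"
        using that by (intro pred_intros_finite pred_bcontfun_less[OF cpt]) auto
      then show ?thesis
        by (simp add: exceeds_max_iff pred_def)
    qed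
    then show "?E ` {1..n} \<subseteq> sets M" by blast
    show "disjoint_family_on ?E {1..n}"
      unfolding disjoint_family_on_def
    proof (intro ballI impI)
      fix i j assume ij: "i \<in> {1..n}" "j \<in> {1..n}" "i \<noteq> j"
      show "?E i \<inter> ?E j = {}"
      proof safe
        fix \<omega> assume "exceeds_max (Us i \<omega>) ({1..n} - {i}) (\<lambda>j. Us j \<omega>)"
          "exceeds_max (Us j \<omega>) ({1..n} - {j}) (\<lambda>j. Us j \<omega>)"
        then have "Us j \<omega> s < Us i \<omega> s" "Us i \<omega> s < Us j \<omega> s" for s
          using ij by (auto simp: exceeds_max_iff)
        then show "\<omega> \<in> {}"
          using less_asym by blast
      qed
    qed
  qed simp
  also have "\<dots> = (\<Sum>i\<in>{1..n}. complete_record_prob M Us n)"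
    by (intro sum.cong refl exceeds_prob_eq)
  finally show ?thesis
    by (simp add: sample_concurrence_prob_def)
qed

end

section \<open>Two limit lemmas and inclusion-exclusion\<close>

text \<open>Taking logarithms gives n (- ln (a n)) close to L, which forces a n to tend to 1. Then a
  (- ln a) \<le> 1 - a \<le> - ln a squeezes the claim.\<close>

lemma tendsto_of_power_tendsto_exp:
  fixes a :: "nat \<Rightarrow> real"
  assumes a01: "\<And>n. 0 \<le> a n" "\<And>n. a n \<le> 1" and lim: "(\<lambda>n. a n ^ n) \<longlonglongrightarrow> exp (- L)"
  shows "(\<lambda>n. real n * (1 - a n)) \<longlonglongrightarrow> L"
proof -
  have "eventually (\<lambda>n. 0 < a n ^ n) sequentially"
    using order_tendstoD(1)[OF lim, of 0] by simp
  then have pos: "eventually (\<lambda>n. 0 < a n) sequentially"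
    using eventually_gt_at_top[of 0]
    by eventually_elim (use a01(1) in \<open>metis less_eq_real_def power_eq_0_iff less_irrefl\<close>)
  have "(\<lambda>n. - ln (a n ^ n)) \<longlonglongrightarrow> L"
    using tendsto_minus[OF tendsto_ln[OF lim]] by simp
  then have l: "(\<lambda>n. real n * (- ln (a n))) \<longlonglongrightarrow> L"
    by (rule Lim_transform_eventually)
       (use pos in eventually_elim, simp_all add: ln_realpow)
  have "(\<lambda>n. (real n * (- ln (a n))) * inverse (real n)) \<longlonglongrightarrow> L * 0"
    by (intro tendsto_mult l lim_inverse_n)
  then have "(\<lambda>n. (real n * (- ln (a n))) * inverse (real n)) \<longlonglongrightarrow> 0"
    by simp
  then have "(\<lambda>n. - ln (a n)) \<longlonglongrightarrow> 0"
    by (rule Lim_transform_eventually)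
       (use eventually_gt_at_top[of 0] in eventually_elim, simp_all add: field_simps)
  then have "(\<lambda>n. exp (ln (a n))) \<longlonglongrightarrow> 1"
    using tendsto_exp[OF tendsto_minus] by fastforce
  then have a1: "a \<longlonglongrightarrow> 1"
    by (rule Lim_transform_eventually) (use pos in eventually_elim, simp_all)
  show ?thesis
  proof (rule tendsto_sandwich)
    show "(\<lambda>n. a n * (real n * (- ln (a n)))) \<longlonglongrightarrow> L"
      using tendsto_mult[OF a1 l] by simp
    show "(\<lambda>n. real n * (- ln (a n))) \<longlonglongrightarrow> L" by (rule l)
    show "eventually (\<lambda>n. real n * (1 - a n) \<le> real n * (- ln (a n))) sequentially"
      using pos
    proof eventually_elim
      case (elim n)
      then show ?case
        using ln_le_minus_one[of "a n"] by (intro mult_left_mono) auto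
    qed
    show "eventually (\<lambda>n. a n * (real n * (- ln (a n))) \<le> real n * (1 - a n)) sequentially"
      using pos
    proof eventually_elim
      case (elim n)
      have "ln (inverse (a n)) \<le> inverse (a n) - 1"
        using elim by (intro ln_le_minus_one) simp
      then have "a n * (- ln (a n)) \<le> a n * (inverse (a n) - 1)"
        using elim by (intro mult_left_mono) (auto simp: ln_inverse)
      also have "\<dots> = 1 - a n"
        using elim by (simp add: field_simps)
      finally have "real n * (a n * (- ln (a n))) \<le> real n * (1 - a n)"
        by (intro mult_left_mono) auto
      then show ?case
        by (simp add: algebra_simps)
    qed
  qed
qed

text \<open>The positive part of Y - K is at most the number of naturals j with K + j < Y. Summing
  the tails gives a geometric series, and exp (- 1) \<le> 1 / 2 accounts for the factor 2.\<close>

lemma (in prob_space) nn_integral_exponential_tail: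
  assumes [measurable]: "Y \<in> borel_measurable M" and K: "0 \<le> K"
    and tail: "\<And>x. 0 \<le> x \<Longrightarrow> prob {\<omega> \<in> space M. x < Y \<omega>} \<le> exp (- x)"
  shows "(\<integral>\<^sup>+\<omega>. ennreal (max 0 (Y \<omega> - K)) \<partial>M) \<le> ennreal (2 * exp (- K))"
proof -
  let ?A = "\<lambda>j. {\<omega> \<in> space M. K + real j < Y \<omega>}"
  have le: "ennreal (max 0 (Y \<omega> - K)) \<le> (\<Sum>j. indicator (?A j) \<omega>)" if "\<omega> \<in> space M" for \<omega>
  proof -
    define m where "m = nat \<lceil>Y \<omega> - K\<rceil>"
    have "ennreal (max 0 (Y \<omega> - K)) \<le> ennreal (real m)"
      unfolding m_def by (intro ennreal_leI) linarith
    also have "\<dots> = (\<Sum>j<m. 1)"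
      by (simp add: ennreal_of_nat_eq_real_of_nat)
    also have "\<dots> = (\<Sum>j<m. indicator (?A j) \<omega>)"
    proof (rule sum.cong)
      fix j assume "j \<in> {..<m}"
      then have "real j < Y \<omega> - K"
        unfolding m_def by (simp add: zless_nat_eq_int_zless less_ceiling_iff)
      then show "1 = indicator (?A j) \<omega>"
        using that by simp
    qed simp
    also have "\<dots> \<le> (\<Sum>j. indicator (?A j) \<omega>)"
      by (intro sum_le_suminf) auto
    finally show ?thesis .
  qed
  have e: "exp (- 1) \<le> (1 / 2 :: real)"
    using exp_ge_add_one_self[of "1::real"] by (simp add: exp_minus field_simps)
  have sums: "(\<lambda>j. exp (- (K + real j))) sums (exp (- K) * (1 / (1 - exp (- 1))))"
  proof -
    have "exp (- (K + real j)) = exp (- K) * exp (- 1) ^ j" for j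
      by (simp add: exp_of_nat_mult[symmetric] exp_add[symmetric])
    then show ?thesis
      using e by (simp only:) (intro sums_mult geometric_sums, simp)
  qed
  have "(\<integral>\<^sup>+\<omega>. ennreal (max 0 (Y \<omega> - K)) \<partial>M) \<le> (\<integral>\<^sup>+\<omega>. (\<Sum>j. indicator (?A j) \<omega>) \<partial>M)"
    by (intro nn_integral_mono le)
  also have "\<dots> = (\<Sum>j. emeasure M (?A j))"
    by (subst nn_integral_suminf) auto
  also have "\<dots> \<le> (\<Sum>j. ennreal (exp (- (K + real j))))"
    using K tail by (intro suminf_le) (auto simp: emeasure_eq_measure simp del: minus_add_distrib intro!: ennreal_leI)
  also have "\<dots> = ennreal (exp (- K) * (1 / (1 - exp (- 1))))"
    using sums by (intro suminf_ennreal_eq) auto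
  also have "\<dots> \<le> ennreal (2 * exp (- K))"
    using e by (intro ennreal_leI) (simp add: field_simps)
  finally show ?thesis .
qed

lemma (in prob_space) exponential_tail:
  assumes [measurable]: "Y \<in> borel_measurable M" and K: "0 \<le> K"
    and tail: "\<And>x. 0 \<le> x \<Longrightarrow> prob {\<omega> \<in> space M. x < Y \<omega>} \<le> exp (- x)"
  shows "integrable M (\<lambda>\<omega>. max 0 (Y \<omega> - K))" "(\<integral>\<omega>. max 0 (Y \<omega> - K) \<partial>M) \<le> 2 * exp (- K)"
proof -
  have nn: "(\<integral>\<^sup>+\<omega>. ennreal (max 0 (Y \<omega> - K)) \<partial>M) \<le> ennreal (2 * exp (- K))"
    using K tail by (intro nn_integral_exponential_tail) auto
  show int: "integrable M (\<lambda>\<omega>. max 0 (Y \<omega> - K))"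
  proof (rule integrableI_nonneg)
    show "(\<integral>\<^sup>+\<omega>. ennreal (max 0 (Y \<omega> - K)) \<partial>M) < \<infinity>"
      using nn by (rule le_less_trans) simp
  qed auto
  have "ennreal (\<integral>\<omega>. max 0 (Y \<omega> - K) \<partial>M) \<le> ennreal (2 * exp (- K))"
    using nn int by (subst nn_integral_eq_integral[symmetric]) auto
  then show "(\<integral>\<omega>. max 0 (Y \<omega> - K) \<partial>M) \<le> 2 * exp (- K)"
    by simp
qed

text \<open>Inclusion-exclusion as an induction: requiring one more set t is the difference of two
  cases with the same T, one with W and one with t added to W. Carrying W along is what closes the
  induction. The integrand on the right is the length of the intersection over T of the intervals
  (0, b t) minus their union over W, so both sides obey the same recursion.\<close>

lemma exceed_union_diff_limit:
  fixes \<mu> :: "'a measure" and b :: "'i \<Rightarrow> 'z \<Rightarrow> real"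
  assumes fin: "finite_measure \<mu>" and A: "\<And>n t. A n t \<in> sets \<mu>"
    and int: "\<And>t. integrable N (b t)"
    and lim: "\<And>W. finite W \<Longrightarrow> W \<subseteq> I \<Longrightarrow>
      (\<lambda>n. real n * measure \<mu> (\<Union>t\<in>W. A n t)) \<longlonglongrightarrow> (\<integral>\<zeta>. Max (insert 0 ((\<lambda>t. b t \<zeta>) ` W)) \<partial>N)"
    and T: "finite T" "T \<noteq> {}" "T \<subseteq> I" and W: "finite W" "W \<subseteq> I"
  shows "(\<lambda>n. real n * measure \<mu> ((\<Inter>t\<in>T. A n t) - (\<Union>t\<in>W. A n t)))
    \<longlonglongrightarrow> (\<integral>\<zeta>. max 0 (Min ((\<lambda>t. b t \<zeta>) ` T) - Max (insert 0 ((\<lambda>t. b t \<zeta>) ` W))) \<partial>N)"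
  using T W
proof (induction T arbitrary: W rule: finite_ne_induct)
  interpret finite_measure \<mu> by (rule fin)
  have intMax: "integrable N (\<lambda>\<zeta>. Max (insert 0 ((\<lambda>t. b t \<zeta>) ` W)))" if "finite W" for W
    using that
  proof induction
    case (insert t W)
    have "Max (insert 0 ((\<lambda>t. b t \<zeta>) ` insert t W)) = max (b t \<zeta>) (Max (insert 0 ((\<lambda>t. b t \<zeta>) ` W)))" for \<zeta>
      using Max_insert[of "insert 0 ((\<lambda>t. b t \<zeta>) ` W)" "b t \<zeta>"] insert(1) by (simp add: insert_commute)
    then show ?case
      using insert int by simp
  qed simp
  {
    case (singleton t)
    have eq: "measure \<mu> ((\<Inter>t\<in>{t}. A n t) - (\<Union>t\<in>W. A n t))
        = measure \<mu> (\<Union>t\<in>insert t W. A n t) - measure \<mu> (\<Union>t\<in>W. A n t)" for n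
    proof -
      have "(\<Inter>t\<in>{t}. A n t) - (\<Union>t\<in>W. A n t) = (\<Union>t\<in>insert t W. A n t) - (\<Union>t\<in>W. A n t)"
        by auto
      moreover have "(\<Union>t\<in>W. A n t) \<in> sets \<mu>" "(\<Union>t\<in>insert t W. A n t) \<in> sets \<mu>"
        using singleton A by (auto intro!: sets.finite_UN)
      ultimately show ?thesis
        by (simp only:) (intro finite_measure_Diff, auto)
    qed
    have eq2: "(\<integral>\<zeta>. max 0 (Min ((\<lambda>t. b t \<zeta>) ` {t}) - Max (insert 0 ((\<lambda>t. b t \<zeta>) ` W))) \<partial>N)
        = (\<integral>\<zeta>. Max (insert 0 ((\<lambda>t. b t \<zeta>) ` insert t W)) \<partial>N) - (\<integral>\<zeta>. Max (insert 0 ((\<lambda>t. b t \<zeta>) ` W)) \<partial>N)"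
    proof -
      have "max 0 (Min ((\<lambda>t. b t \<zeta>) ` {t}) - Max (insert 0 ((\<lambda>t. b t \<zeta>) ` W)))
          = Max (insert 0 ((\<lambda>t. b t \<zeta>) ` insert t W)) - Max (insert 0 ((\<lambda>t. b t \<zeta>) ` W))" for \<zeta>
      proof -
        have "insert 0 ((\<lambda>t. b t \<zeta>) ` insert t W) = insert (b t \<zeta>) (insert 0 ((\<lambda>t. b t \<zeta>) ` W))"
          by auto
        then have "Max (insert 0 ((\<lambda>t. b t \<zeta>) ` insert t W)) = max (b t \<zeta>) (Max (insert 0 ((\<lambda>t. b t \<zeta>) ` W)))"
          using singleton by (simp only:) (intro Max_insert, auto)
        then show ?thesis
          by (simp add: max_def)
      qed
      then show ?thesis
        using singleton by (simp only:) (intro Bochner_Integration.integral_diff intMax, auto)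
    qed
    show ?case
      unfolding eq eq2 right_diff_distrib using singleton by (intro tendsto_diff lim) auto
  next
    case (insert t T)
    have eq: "measure \<mu> ((\<Inter>t\<in>insert t T. A n t) - (\<Union>t\<in>W. A n t))
        = measure \<mu> ((\<Inter>t\<in>T. A n t) - (\<Union>t\<in>W. A n t)) - measure \<mu> ((\<Inter>t\<in>T. A n t) - (\<Union>t\<in>insert t W. A n t))" for n
    proof -
      have "(\<Inter>t\<in>insert t T. A n t) - (\<Union>t\<in>W. A n t)
          = ((\<Inter>t\<in>T. A n t) - (\<Union>t\<in>W. A n t)) - ((\<Inter>t\<in>T. A n t) - (\<Union>t\<in>insert t W. A n t))"
        by auto
      moreover have "(\<Inter>t\<in>T. A n t) \<in> sets \<mu>" "(\<Union>t\<in>W. A n t) \<in> sets \<mu>" "(\<Union>t\<in>insert t W. A n t) \<in> sets \<mu>"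
        using insert A by (auto intro!: sets.finite_INT sets.finite_UN)
      ultimately show ?thesis
        by (simp only:) (intro finite_measure_Diff, auto)
    qed
    have intMM: "integrable N (\<lambda>\<zeta>. max 0 (Min ((\<lambda>t. b t \<zeta>) ` T) - Max (insert 0 ((\<lambda>t. b t \<zeta>) ` W))))"
      if "finite W" for W
    proof -
      have "integrable N (\<lambda>\<zeta>. Min ((\<lambda>t. b t \<zeta>) ` T))"
        using insert(1,2) by (induction rule: finite_ne_induct) (auto simp: int)
      then show ?thesis
        by (intro integrable_max Bochner_Integration.integrable_diff intMax that) auto
    qed
    have eq2: "(\<integral>\<zeta>. max 0 (Min ((\<lambda>t. b t \<zeta>) ` insert t T) - Max (insert 0 ((\<lambda>t. b t \<zeta>) ` W))) \<partial>N)
        = (\<integral>\<zeta>. max 0 (Min ((\<lambda>t. b t \<zeta>) ` T) - Max (insert 0 ((\<lambda>t. b t \<zeta>) ` W))) \<partial>N)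
        - (\<integral>\<zeta>. max 0 (Min ((\<lambda>t. b t \<zeta>) ` T) - Max (insert 0 ((\<lambda>t. b t \<zeta>) ` insert t W))) \<partial>N)"
    proof -
      have "max 0 (Min ((\<lambda>t. b t \<zeta>) ` insert t T) - Max (insert 0 ((\<lambda>t. b t \<zeta>) ` W)))
        = max 0 (Min ((\<lambda>t. b t \<zeta>) ` T) - Max (insert 0 ((\<lambda>t. b t \<zeta>) ` W)))
        - max 0 (Min ((\<lambda>t. b t \<zeta>) ` T) - Max (insert 0 ((\<lambda>t. b t \<zeta>) ` insert t W)))" for \<zeta>
      proof -
        have "insert 0 ((\<lambda>t. b t \<zeta>) ` insert t W) = insert (b t \<zeta>) (insert 0 ((\<lambda>t. b t \<zeta>) ` W))"
          by auto
        then have "Max (insert 0 ((\<lambda>t. b t \<zeta>) ` insert t W)) = max (b t \<zeta>) (Max (insert 0 ((\<lambda>t. b t \<zeta>) ` W)))"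
          using insert by (simp only:) (intro Max_insert, auto)
        moreover have "Min ((\<lambda>t. b t \<zeta>) ` insert t T) = min (b t \<zeta>) (Min ((\<lambda>t. b t \<zeta>) ` T))"
          using insert by simp
        ultimately show ?thesis
          by (auto simp: max_def min_def)
      qed
      then show ?thesis
        using insert by (simp only:) (intro Bochner_Integration.integral_diff intMM, auto)
    qed
    show ?case
      unfolding eq eq2 right_diff_distrib using insert by (intro tendsto_diff insert.IH) auto
  }
qed

section \<open>Exceedances on finite sets\<close>

lemma continuous_on_Max_image:
  fixes f :: "'i \<Rightarrow> 'a::topological_space \<Rightarrow> real"
  assumes "finite W" "W \<noteq> {}" "\<And>i. i \<in> W \<Longrightarrow> continuous_on A (f i)"
  shows "continuous_on A (\<lambda>x. Max ((\<lambda>i. f i x) ` W))"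
  using assms by (induction rule: finite_ne_induct) (auto intro!: continuous_on_max)

text \<open>Finitely many discontinuities are just enough to prescribe values on a finite set and 0
  elsewhere. Through such functions the generator determines the finite-dimensional distributions of
  \<open>\<eta>\<close>.\<close>

lemma mem_fun_E_finite_support:
  fixes c :: "'s::metric_space \<Rightarrow> real"
  assumes W: "finite W" and c: "\<And>s. s \<in> W \<Longrightarrow> c s \<le> 0"
  shows "(\<lambda>s. if s \<in> W then c s else 0) \<in> fun_E_nonpos"
proof -
  let ?g = "\<lambda>s. if s \<in> W then c s else 0"
  have "finite (range ?g)"
    by (rule finite_subset[of _ "insert 0 (c ` W)"]) (auto simp: W)
  then have "bounded (range ?g)"
    by (rule finite_imp_bounded)
  moreover have "isCont ?g s" if "s \<notin> W" for s
  proof -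
    have "eventually (\<lambda>t. t \<in> - W) (nhds s)"
      using W that by (intro eventually_nhds_in_open) (auto simp: finite_imp_closed open_Compl)
    then have "eventually (\<lambda>t. ?g t = 0) (nhds s)"
      by eventually_elim simp
    then show ?thesis
      using isCont_cong[of ?g "\<lambda>_. 0" s] by simp
  qed
  then have "finite {s. \<not> isCont ?g s}"
    by (intro finite_subset[OF _ W]) auto
  ultimately show ?thesis
    using c by (simp add: fun_E_nonpos_def fun_E_def)
qed

lemma D_norm_finite_support:
  fixes c :: "'s::metric_space \<Rightarrow> real" and Z :: "'z \<Rightarrow> 's \<Rightarrow>\<^sub>C real"
  assumes W: "finite W" and Z: "\<And>\<zeta> s. \<zeta> \<in> space N \<Longrightarrow> 0 \<le> Z \<zeta> s"
  shows "D_norm N Z (\<lambda>s. if s \<in> W then c s else 0)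
    = (\<integral>\<zeta>. Max (insert 0 ((\<lambda>t. \<bar>c t\<bar> * Z \<zeta> t) ` W)) \<partial>N)"
  unfolding D_norm_def
proof (rule Bochner_Integration.integral_cong)
  fix \<zeta> assume \<zeta>: "\<zeta> \<in> space N"
  let ?g = "\<lambda>s. \<bar>if s \<in> W then c s else 0\<bar> * Z \<zeta> s"
  let ?m = "Max (insert 0 ((\<lambda>t. \<bar>c t\<bar> * Z \<zeta> t) ` W))"
  have le: "?g s \<le> ?m" for s
    using W by (auto intro!: Max_ge)
  show "(SUP s. ?g s) = ?m"
  proof (rule cSup_eq_maximum)
    have "?m \<in> insert 0 ((\<lambda>t. \<bar>c t\<bar> * Z \<zeta> t) ` W)"
      using W by (intro Max_in) auto
    then consider "?m = 0" | t where "t \<in> W" "?m = \<bar>c t\<bar> * Z \<zeta> t" by auto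
    then show "?m \<in> range ?g"
    proof cases
      \<comment> \<open>If W is the whole space, no point has the value 0 by default. But when the
        maximum is 0, nonnegativity of Z squeezes all values to 0, so any point serves.\<close>
      case 1
      have "?g undefined \<le> 0" using le[of undefined] 1 by simp
      moreover have "0 \<le> ?g undefined" using Z[OF \<zeta>] by simp
      ultimately have "?m = ?g undefined" using 1 by linarith
      then show ?thesis by (rule range_eqI)
    next
      case 2
      then have "?m = ?g t" by simp
      then show ?thesis by (rule range_eqI)
    qed
  qed (use le in auto)
qed simp

lemma borel_bcontfun_le: "{f :: 's::metric_space \<Rightarrow>\<^sub>C real. \<forall>s. f s \<le> c s} \<in> sets borel"
  using closed_bcontfun_le[of UNIV c] by (intro borel_closed) simp

lemma borel_bcontfun_ball_le: "{f :: 's::metric_space \<Rightarrow>\<^sub>C real. \<forall>s\<in>T. f s \<le> c s} \<in> sets borel"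
  by (intro borel_closed closed_bcontfun_le)

context copula_attraction
begin

lemma Z_nonneg: "\<zeta> \<in> space N \<Longrightarrow> 0 \<le> Z \<zeta> s"
  and Z_integrable: "integrable N (\<lambda>\<zeta>. Z \<zeta> s)"
  and Z_expectation: "(\<integral>\<zeta>. Z \<zeta> s \<partial>N) = 1"
  and Z_sup_integrable: "integrable N (\<lambda>\<zeta>. SUP s. Z \<zeta> s)"
  and eta_le_prob: "f \<in> fun_E_nonpos \<Longrightarrow> measure Q {\<omega> \<in> space Q. \<forall>s. \<eta> \<omega> s \<le> f s} = exp (- D_norm N Z f)"
  using gen by (auto simp: generator_of_def)

section \<open>What weak convergence says about events, and the finite-dimensional limit law\<close>

lemma prob_space_nu: "prob_space (nu n)"
proof (cases "n = 0")
  case True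
  then show ?thesis
    unfolding nu_def by (intro M.prob_space_distr) (simp add: norm_max_def)
next
  case False
  then show ?thesis
    unfolding nu_def by (intro M.prob_space_distr) simp
qed

lemma nu_portmanteau:
  fixes \<phi> :: "('s \<Rightarrow>\<^sub>C real) \<Rightarrow> real"
  assumes \<phi>: "continuous_on UNIV \<phi>" and "\<alpha> < \<beta>" "\<theta> > 0"
  shows "eventually (\<lambda>n. measure (nu n) {f :: 's \<Rightarrow>\<^sub>C real. \<beta> \<le> \<phi> f} \<le> measure nu_lim {f :: 's \<Rightarrow>\<^sub>C real. \<alpha> < \<phi> f} + \<theta>) sequentially"
proof -
  define r where "r f = max 0 (min 1 ((\<phi> f - \<alpha>) / (\<beta> - \<alpha>)))" for f
  have r_cont: "continuous_on UNIV r"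
    unfolding r_def using \<open>\<alpha> < \<beta>\<close> by (intro continuous_intros \<phi>) auto
  note [measurable] = borel_measurable_continuous_onI[OF \<phi>] borel_measurable_continuous_onI[OF r_cont]
  have r01: "0 \<le> r f" "r f \<le> 1" for f
    by (auto simp: r_def)
  have "(\<lambda>n. \<integral>f. r f \<partial>nu n) \<longlonglongrightarrow> (\<integral>f. r f \<partial>nu_lim)"
    using r01 by (intro nu_tendsto[of _ 1] r_cont) auto
  then have "eventually (\<lambda>n. (\<integral>f. r f \<partial>nu n) < (\<integral>f. r f \<partial>nu_lim) + \<theta>) sequentially"
    using \<open>\<theta> > 0\<close> by (intro order_tendstoD(2)) auto
  moreover have "measure (nu n) {f :: 's \<Rightarrow>\<^sub>C real. \<beta> \<le> \<phi> f} \<le> (\<integral>f. r f \<partial>nu n)" for n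
  proof -
    interpret nu: prob_space "nu n" by (rule prob_space_nu)
    have "measure (nu n) {f :: 's \<Rightarrow>\<^sub>C real. \<beta> \<le> \<phi> f} = (\<integral>f. indicator {f :: 's \<Rightarrow>\<^sub>C real. \<beta> \<le> \<phi> f} f \<partial>nu n)"
      by simp
    also have "\<dots> \<le> (\<integral>f. r f \<partial>nu n)"
    proof (rule integral_mono)
      show "integrable (nu n) r"
        using r01 by (intro nu.integrable_const_bound[of _ 1]) auto
      show "indicator {f :: 's \<Rightarrow>\<^sub>C real. \<beta> \<le> \<phi> f} f \<le> r f" for f
        using \<open>\<alpha> < \<beta>\<close> r01(1) by (auto simp: indicator_def r_def field_simps)
      show "integrable (nu n) (indicator {f :: 's \<Rightarrow>\<^sub>C real. \<beta> \<le> \<phi> f} :: _ \<Rightarrow> real)"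
        by (intro nu.integrable_const_bound[of _ 1]) auto
    qed
    finally show ?thesis .
  qed
  moreover have "(\<integral>f. r f \<partial>nu_lim) \<le> measure nu_lim {f :: 's \<Rightarrow>\<^sub>C real. \<alpha> < \<phi> f}"
  proof -
    have "(\<integral>f. r f \<partial>nu_lim) \<le> (\<integral>f. indicator {f :: 's \<Rightarrow>\<^sub>C real. \<alpha> < \<phi> f} f \<partial>nu_lim)"
    proof (rule integral_mono)
      show "integrable nu_lim r"
        using r01 by (intro nu_lim.integrable_const_bound[of _ 1]) auto
      show "r f \<le> indicator {f :: 's \<Rightarrow>\<^sub>C real. \<alpha> < \<phi> f} f" for f
        using \<open>\<alpha> < \<beta>\<close> r01(2) by (auto simp: indicator_def r_def field_simps)
      show "integrable nu_lim (indicator {f :: 's \<Rightarrow>\<^sub>C real. \<alpha> < \<phi> f} :: _ \<Rightarrow> real)"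
        by (intro nu_lim.integrable_const_bound[of _ 1]) auto
    qed
    then show ?thesis by simp
  qed
  ultimately show ?thesis
    by (elim eventually_mono) (meson add_right_mono less_imp_le order_trans)
qed

text \<open>Pushing forward along the continuous \<open>\<phi>\<close> leads to weak convergence on
  the real line, where the half-line up to 0 is a continuity set by the assumption on the level
  0.\<close>

lemma nu_atMost_tendsto:
  fixes \<phi> :: "('s \<Rightarrow>\<^sub>C real) \<Rightarrow> real"
  assumes \<phi>: "continuous_on UNIV \<phi>" and null: "measure nu_lim {f :: 's \<Rightarrow>\<^sub>C real. \<phi> f = 0} = 0"
  shows "(\<lambda>n. measure (nu n) {f :: 's \<Rightarrow>\<^sub>C real. \<phi> f \<le> 0}) \<longlonglongrightarrow> measure nu_lim {f :: 's \<Rightarrow>\<^sub>C real. \<phi> f \<le> 0}"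
proof -
  note [measurable] = borel_measurable_continuous_onI[OF \<phi>]
  let ?D = "\<lambda>n. distr (nu n) borel \<phi>" and ?L = "distr nu_lim borel \<phi>"
  have rd: "real_distribution (?D n)" "real_distribution ?L" for n
    unfolding real_distribution_def real_distribution_axioms_def
    by (auto intro!: prob_space.prob_space_distr prob_space_nu nu_lim.prob_space_axioms)
  have "weak_conv_m ?D ?L"
  proof (rule integral_bdd_continuous_conv_imp_weak_conv[OF rd])
    fix h :: "real \<Rightarrow> real"
    assume h: "\<And>x. isCont h x" "\<And>x. \<bar>h x\<bar> \<le> 1"
    have hc: "continuous_on UNIV h"
      using h(1) by (simp add: continuous_at_imp_continuous_on)
    note [measurable] = borel_measurable_continuous_onI[OF hc]
    have "(\<lambda>n. \<integral>f. h (\<phi> f) \<partial>nu n) \<longlonglongrightarrow> (\<integral>f. h (\<phi> f) \<partial>nu_lim)"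
      using h(2) continuous_on_subset[OF hc] by (intro nu_tendsto[of _ 1] continuous_on_compose2[OF hc \<phi>]) auto
    then show "(\<lambda>n. \<integral>x. h x \<partial>?D n) \<longlonglongrightarrow> (\<integral>x. h x \<partial>?L)"
      by (simp add: integral_distr)
  qed
  then have "(\<lambda>n. measure (?D n) {..0}) \<longlonglongrightarrow> measure ?L {..0}"
  proof (rule weak_conv_imp_continuity_set_conv[OF rd])
    have "emeasure ?L {0} = emeasure nu_lim {f :: 's \<Rightarrow>\<^sub>C real. \<phi> f = 0}"
      by (subst emeasure_distr) (auto simp: vimage_def)
    also have "\<dots> = 0"
      using null by (simp add: nu_lim.emeasure_eq_measure)
    finally show "emeasure ?L (frontier {..0}) = 0" by simp
  qed simp
  then show ?thesis
    by (simp add: measure_distr vimage_def)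
qed

lemma nu_lim_eq_Q:
  assumes "A \<in> sets borel"
  shows "measure nu_lim A = measure Q {\<omega> \<in> space Q. \<eta> \<omega> \<in> A}"
  using assms unfolding nu_lim_def by (subst measure_distr) (auto intro!: arg_cong[of _ _ "measure Q"])

lemma nu_lim_le_point: "x \<le> 0 \<Longrightarrow> measure nu_lim {f :: 's \<Rightarrow>\<^sub>C real. f s \<le> x} = exp x"
  using smsp by (subst nu_lim_eq_Q) (auto simp: standard_max_stable_def)

text \<open>The marginal distribution function exp is continuous: the mass at x is at most exp x -
  exp (x - e) for every e > 0.\<close>

lemma nu_lim_eq_point:
  assumes "x \<le> 0"
  shows "measure nu_lim {f :: 's \<Rightarrow>\<^sub>C real. f s = x} = 0"
proof -
  have "measure nu_lim {f :: 's \<Rightarrow>\<^sub>C real. f s = x} \<le> exp x - exp (x - e)" if "e > 0" for e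
  proof -
    have "measure nu_lim {f :: 's \<Rightarrow>\<^sub>C real. f s = x} + measure nu_lim {f :: 's \<Rightarrow>\<^sub>C real. f s \<le> x - e}
        = measure nu_lim ({f :: 's \<Rightarrow>\<^sub>C real. f s = x} \<union> {f :: 's \<Rightarrow>\<^sub>C real. f s \<le> x - e})"
      using that by (intro nu_lim.finite_measure_Union[symmetric]) auto
    also have "\<dots> \<le> measure nu_lim {f :: 's \<Rightarrow>\<^sub>C real. f s \<le> x}"
      using that by (intro nu_lim.finite_measure_mono) auto
    finally show ?thesis
      using assms that by (simp add: nu_lim_le_point)
  qed
  then have "eventually (\<lambda>e. measure nu_lim {f :: 's \<Rightarrow>\<^sub>C real. f s = x} \<le> exp x - exp (x - e)) (at_right 0)"
    by (auto simp: eventually_at_right_less eventually_at_filter)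
  moreover have "((\<lambda>e. exp x - exp (x - e)) \<longlongrightarrow> exp x - exp (x - 0)) (at_right 0)"
    by (intro tendsto_intros)
  ultimately have "measure nu_lim {f :: 's \<Rightarrow>\<^sub>C real. f s = x} \<le> exp x - exp (x - 0)"
    by (intro tendsto_lowerbound) auto
  then show ?thesis
    using measure_nonneg[of nu_lim "{f :: 's \<Rightarrow>\<^sub>C real. f s = x}"] by simp
qed

text \<open>The generator identity for the zero function, whose D-norm is 0, gives probability exp
  0.\<close>

lemma AE_nu_lim_nonpos: "AE f in nu_lim. \<forall>s. f s \<le> 0"
proof -
  have "(\<lambda>_. 0) \<in> (fun_E_nonpos :: ('s \<Rightarrow> real) set)"
    using mem_fun_E_finite_support[of "{}"] by simp
  then have "measure Q {\<omega> \<in> space Q. \<forall>s. \<eta> \<omega> s \<le> 0} = 1"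
    by (subst eta_le_prob) (auto simp: D_norm_def)
  then have "measure nu_lim {f :: 's \<Rightarrow>\<^sub>C real. \<forall>s. f s \<le> 0} = 1"
    by (subst nu_lim_eq_Q) (auto intro!: borel_bcontfun_le)
  then have "AE f in nu_lim. f \<in> {f :: 's \<Rightarrow>\<^sub>C real. \<forall>s. f s \<le> 0}"
    by (subst (asm) nu_lim.prob_eq_1) (auto intro!: borel_bcontfun_le)
  then show ?thesis by simp
qed

text \<open>Extending c by 0 outside W adds only the constraint of being nonpositive, which holds
  almost surely, and makes the generator identity applicable.\<close>

lemma nu_lim_le:
  assumes W: "finite W" and c: "\<And>s. s \<in> W \<Longrightarrow> c s \<le> 0"
  shows "measure nu_lim {f :: 's \<Rightarrow>\<^sub>C real. \<forall>s\<in>W. f s \<le> c s}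
    = exp (- (\<integral>\<zeta>. Max (insert 0 ((\<lambda>t. \<bar>c t\<bar> * Z \<zeta> t) ` W)) \<partial>N))"
proof -
  let ?g = "\<lambda>s. if s \<in> W then c s else 0"
  have "measure nu_lim {f :: 's \<Rightarrow>\<^sub>C real. \<forall>s\<in>W. f s \<le> c s} = measure nu_lim {f :: 's \<Rightarrow>\<^sub>C real. \<forall>s. f s \<le> ?g s}"
  proof (rule nu_lim.finite_measure_eq_AE)
    show "AE f in nu_lim. f \<in> {f :: 's \<Rightarrow>\<^sub>C real. \<forall>s\<in>W. f s \<le> c s} \<longleftrightarrow> f \<in> {f :: 's \<Rightarrow>\<^sub>C real. \<forall>s. f s \<le> ?g s}"
      using AE_nu_lim_nonpos by eventually_elim auto
  qed (use borel_bcontfun_le[of ?g] borel_bcontfun_ball_le[of W c] in simp_all)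
  also have "\<dots> = measure Q {\<omega> \<in> space Q. \<forall>s. \<eta> \<omega> s \<le> ?g s}"
    using borel_bcontfun_le[of ?g] by (subst nu_lim_eq_Q) auto
  also have "\<dots> = exp (- D_norm N Z ?g)"
    using W c by (intro eta_le_prob mem_fun_E_finite_support)
  finally show ?thesis
    by (simp add: D_norm_finite_support W Z_nonneg)
qed

section \<open>Uniform margins of one copy and exponential tails of the maximum\<close>

lemma mu_le: "measure mu {u :: 's \<Rightarrow>\<^sub>C real. u s \<le> x} = max 0 (min 1 x)"
proof -
  have "measure mu {u :: 's \<Rightarrow>\<^sub>C real. u s \<le> x} = measure (distr P borel (\<lambda>\<omega>. U \<omega> s)) {..x}"
    unfolding mu_def by (simp add: measure_distr vimage_def)
  also have "distr P borel (\<lambda>\<omega>. U \<omega> s) = uniform_measure lborel {0<..<1}"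
    using copula by (simp add: copula_process_def)
  also have "measure (uniform_measure lborel {0<..<1}) {..x} = measure lborel ({0<..<1} \<inter> {..x})"
    by (subst measure_uniform_measure) auto
  also have "\<dots> = max 0 (min 1 x)"
  proof -
    consider "x \<le> 0" | "0 < x" "x < 1" | "1 \<le> x" by linarith
    then show ?thesis
    proof cases
      case 1
      then have "{0<..<1} \<inter> {..x} = {}" by auto
      then show ?thesis using 1 by simp
    next
      case 2
      then have "{0<..<1} \<inter> {..x} = {0<..x}" by auto
      then show ?thesis using 2 by simp
    next
      case 3
      then have "{0<..<1} \<inter> {..x} = {0<..<1}" by auto
      then show ?thesis using 3 by simp
    qed
  qed
  finally show ?thesis .
qed

lemma mu_le': "n \<ge> 1 \<Longrightarrow> measure mu {u :: 's \<Rightarrow>\<^sub>C real. real n * (u s - 1) \<le> x} = max 0 (min 1 (1 + x / real n))"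
proof -
  assume "n \<ge> 1"
  then have "{u :: 's \<Rightarrow>\<^sub>C real. real n * (apply_bcontfun u s - 1) \<le> x} = {u :: 's \<Rightarrow>\<^sub>C real. u s \<le> 1 + x / real n}"
    by (auto simp: field_simps)
  then show ?thesis by (simp add: mu_le)
qed

text \<open>At a fixed point, n (u - 1) has density 1 / n on (- n, 0). This bound is the source of
  all Lipschitz estimates below, with constants that do not depend on n.\<close>

lemma mu_between:
  assumes n: "n \<ge> 1" and "a \<le> b"
  shows "real n * measure mu {u :: 's \<Rightarrow>\<^sub>C real. a < real n * (u s - 1) \<and> real n * (u s - 1) \<le> b} \<le> b - a"
proof -
  have eq: "{u :: 's \<Rightarrow>\<^sub>C real. a < real n * (apply_bcontfun u s - 1) \<and> real n * (u s - 1) \<le> b}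
      = {u :: 's \<Rightarrow>\<^sub>C real. real n * (u s - 1) \<le> b} - {u :: 's \<Rightarrow>\<^sub>C real. real n * (u s - 1) \<le> a}"
    by auto
  have "measure mu {u :: 's \<Rightarrow>\<^sub>C real. a < real n * (u s - 1) \<and> real n * (u s - 1) \<le> b}
      = max 0 (min 1 (1 + b / real n)) - max 0 (min 1 (1 + a / real n))"
    unfolding eq using \<open>a \<le> b\<close> n by (subst mu.finite_measure_Diff) (auto simp: mu_le')
  also have "\<dots> \<le> (b - a) / real n"
  proof -
    have "max 0 (min 1 (1 + y)) - max 0 (min 1 (1 + x)) \<le> y - x" if "x \<le> y" for x y :: real
      using that by linarith
    from this[of "a / real n" "b / real n"] show ?thesis
      using \<open>a \<le> b\<close> by (simp add: divide_right_mono diff_divide_distrib)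
  qed
  finally have "real n * measure mu {u :: 's \<Rightarrow>\<^sub>C real. a < real n * (u s - 1) \<and> real n * (u s - 1) \<le> b} \<le> real n * ((b - a) / real n)"
    by (intro mult_left_mono) auto
  then show ?thesis using n by simp
qed

text \<open>A bound from a single point. With a = 0 it shows that a copy does not exceed 1 there;
  for general a it controls exceedances over atypical paths.\<close>

lemma mu_greater:
  assumes n: "n \<ge> 1"
  shows "real n * measure mu {u :: 's \<Rightarrow>\<^sub>C real. a < real n * (u s - 1)} \<le> max 0 (- a)"
proof -
  have eq: "{u :: 's \<Rightarrow>\<^sub>C real. a < real n * (apply_bcontfun u s - 1)} = space mu - {u :: 's \<Rightarrow>\<^sub>C real. real n * (u s - 1) \<le> a}"
    by auto
  have "measure mu {u :: 's \<Rightarrow>\<^sub>C real. a < real n * (u s - 1)} = 1 - max 0 (min 1 (1 + a / real n))"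
    unfolding eq using n by (subst mu.prob_compl) (simp_all add: mu_le')
  also have "\<dots> \<le> max 0 (- a / real n)"
  proof -
    have "1 - max 0 (min 1 (1 + y)) \<le> max 0 (- y)" for y :: real
      by linarith
    from this[of "a / real n"] show ?thesis by simp
  qed
  finally have "real n * measure mu {u :: 's \<Rightarrow>\<^sub>C real. a < real n * (u s - 1)} \<le> real n * max 0 (- a / real n)"
    by (intro mult_left_mono) auto
  also have "\<dots> = max 0 (- a)"
    using n by (simp add: max_def field_simps)
  finally show ?thesis .
qed

text \<open>The margin is (1 - x / n) ^ n, cut off at 0, and 1 + z \<le> exp z bounds it
  independently of n. This is the uniform integrability behind the passage to the limit.\<close>

lemma nu_tail:
  assumes n: "n \<ge> 1" and x: "0 \<le> x"
  shows "measure (nu n) {f :: 's \<Rightarrow>\<^sub>C real. x < - f s} \<le> exp (- x)"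
proof -
  interpret nu: prob_space "nu n" by (rule prob_space_nu)
  have "measure (nu n) {f :: 's \<Rightarrow>\<^sub>C real. x < - f s} \<le> measure (nu n) {f :: 's \<Rightarrow>\<^sub>C real. \<forall>t\<in>{s}. f t \<le> - x}"
    by (intro nu.finite_measure_mono) auto
  also have "\<dots> = max 0 (min 1 (1 - x / real n)) ^ n"
    using n by (subst nu_le) (simp_all add: mu_le')
  also have "\<dots> \<le> exp (- x / real n) ^ n"
  proof (rule power_mono)
    show "max 0 (min 1 (1 - x / real n)) \<le> exp (- x / real n)"
      using exp_ge_add_one_self[of "- x / real n"] by (simp add: min_def max_def)
  qed simp
  also have "\<dots> = exp (- x)"
    using n by (simp add: exp_of_nat_mult[symmetric])
  finally show ?thesis .
qed

lemma nu_lim_tail: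
  assumes x: "0 \<le> x"
  shows "measure nu_lim {f :: 's \<Rightarrow>\<^sub>C real. x < - f s} \<le> exp (- x)"
proof -
  have "measure nu_lim {f :: 's \<Rightarrow>\<^sub>C real. x < - f s} \<le> measure nu_lim {f :: 's \<Rightarrow>\<^sub>C real. f s \<le> - x}"
    by (intro nu_lim.finite_measure_mono) auto
  then show ?thesis using x by (simp add: nu_lim_le_point)
qed

text \<open>The maximum of f - c over W is a continuous functional whose zero set lies in finitely
  many null sets f s = c s. Hence the n-th powers of the non-exceedance probabilities converge, and
  \<open>tendsto_of_power_tendsto_exp\<close> extracts the limit.\<close>

lemma exceed_union_tendsto:
  assumes W: "finite W" and c: "\<And>s. s \<in> W \<Longrightarrow> c s \<le> 0"
  shows "(\<lambda>n. real n * measure mu (\<Union>t\<in>W. {u :: 's \<Rightarrow>\<^sub>C real. c t < real n * (u t - 1)}))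
    \<longlonglongrightarrow> (\<integral>\<zeta>. Max (insert 0 ((\<lambda>t. \<bar>c t\<bar> * Z \<zeta> t) ` W)) \<partial>N)" (is "_ \<longlonglongrightarrow> ?L")
proof (cases "W = {}")
  case False
  define \<phi> where "\<phi> = (\<lambda>f :: 's \<Rightarrow>\<^sub>C real. Max ((\<lambda>s. f s - c s) ` W))"
  define a where "a n = measure mu {u :: 's \<Rightarrow>\<^sub>C real. \<forall>s\<in>W. real n * (u s - 1) \<le> c s}" for n
  have meas: "{u :: 's \<Rightarrow>\<^sub>C real. \<forall>s\<in>W. real n * (apply_bcontfun u s - 1) \<le> c s} \<in> sets borel" for n
    using W by measurable
  have cont: "continuous_on UNIV \<phi>"
    unfolding \<phi>_def using W False by (intro continuous_on_Max_image continuous_intros)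
  have \<phi>_le: "\<phi> f \<le> 0 \<longleftrightarrow> (\<forall>s\<in>W. f s \<le> c s)" for f
    unfolding \<phi>_def using W False by (subst Max_le_iff) auto
  have "measure nu_lim {f :: 's \<Rightarrow>\<^sub>C real. \<phi> f = 0} \<le> measure nu_lim (\<Union>s\<in>W. {f :: 's \<Rightarrow>\<^sub>C real. f s = c s})"
  proof (rule nu_lim.finite_measure_mono)
    show "{f :: 's \<Rightarrow>\<^sub>C real. \<phi> f = 0} \<subseteq> (\<Union>s\<in>W. {f :: 's \<Rightarrow>\<^sub>C real. f s = c s})"
    proof safe
      fix f :: "'s \<Rightarrow>\<^sub>C real" assume "\<phi> f = 0"
      moreover have "\<phi> f \<in> (\<lambda>s. f s - c s) ` W"
        unfolding \<phi>_def using W False by (intro Max_in) auto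
      ultimately show "f \<in> (\<Union>s\<in>W. {f :: 's \<Rightarrow>\<^sub>C real. f s = c s})" by auto
    qed
  qed (use W in auto)
  also have "\<dots> \<le> (\<Sum>s\<in>W. measure nu_lim {f :: 's \<Rightarrow>\<^sub>C real. f s = c s})"
    using W by (intro nu_lim.finite_measure_subadditive_finite) auto
  also have "\<dots> = 0"
    using c by (intro sum.neutral) (auto simp: nu_lim_eq_point)
  finally have "measure nu_lim {f :: 's \<Rightarrow>\<^sub>C real. \<phi> f = 0} = 0"
    using measure_nonneg by (simp add: measure_le_0_iff)
  then have "(\<lambda>n. measure (nu n) {f :: 's \<Rightarrow>\<^sub>C real. \<forall>s\<in>W. f s \<le> c s}) \<longlonglongrightarrow> measure nu_lim {f :: 's \<Rightarrow>\<^sub>C real. \<forall>s\<in>W. f s \<le> c s}"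
    using nu_atMost_tendsto[OF cont] by (simp add: \<phi>_le)
  then have "(\<lambda>n. measure (nu n) {f :: 's \<Rightarrow>\<^sub>C real. \<forall>s\<in>W. f s \<le> c s}) \<longlonglongrightarrow> exp (- ?L)"
    using W c by (simp add: nu_lim_le)
  then have "(\<lambda>n. a n ^ n) \<longlonglongrightarrow> exp (- ?L)"
    by (rule Lim_transform_eventually)
       (use eventually_ge_at_top[of 1] in eventually_elim, simp add: a_def nu_le)
  then have "(\<lambda>n. real n * (1 - a n)) \<longlonglongrightarrow> ?L"
    by (rule tendsto_of_power_tendsto_exp[rotated 2]) (auto simp: a_def)
  moreover have "1 - a n = measure mu (\<Union>t\<in>W. {u :: 's \<Rightarrow>\<^sub>C real. c t < real n * (u t - 1)})" for n
  proof -
    have "(\<Union>t\<in>W. {u :: 's \<Rightarrow>\<^sub>C real. c t < real n * (apply_bcontfun u t - 1)}) = space mu - {u :: 's \<Rightarrow>\<^sub>C real. \<forall>s\<in>W. real n * (u s - 1) \<le> c s}"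
      by (auto simp: not_le)
    then show ?thesis
      unfolding a_def using meas by (simp only:) (intro mu.prob_compl[symmetric], simp)
  qed
  ultimately show ?thesis by simp
qed simp

text \<open>G_n of the overview with exceedance demanded on T only; T = UNIV gives the record
  functional itself.\<close>

definition exceed :: "nat \<Rightarrow> 's set \<Rightarrow> ('s \<Rightarrow> real) \<Rightarrow> real" where
  "exceed n T c = real n * measure mu {u :: 's \<Rightarrow>\<^sub>C real. \<forall>t\<in>T. c t < real n * (u t - 1)}"

text \<open>Because of the absolute value this is the limit of \<open>exceed n T c\<close> where c
  \<le> 0 on T; hence the clipping by \<open>min 0\<close> whenever a path is inserted.\<close>

definition exceed_lim :: "'s set \<Rightarrow> ('s \<Rightarrow> real) \<Rightarrow> real" where
  "exceed_lim T c = (\<integral>\<zeta>. Min ((\<lambda>t. \<bar>c t\<bar> * Z \<zeta> t) ` T) \<partial>N)"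

lemma exceed_tendsto:
  assumes T: "finite T" "T \<noteq> {}" and c: "\<And>s. s \<in> T \<Longrightarrow> c s \<le> 0"
  shows "(\<lambda>n. exceed n T c) \<longlonglongrightarrow> exceed_lim T c"
proof -
  have "(\<lambda>n. real n * measure mu ((\<Inter>t\<in>T. {u :: 's \<Rightarrow>\<^sub>C real. c t < real n * (u t - 1)}) - (\<Union>t\<in>{}. {u :: 's \<Rightarrow>\<^sub>C real. c t < real n * (u t - 1)})))
    \<longlonglongrightarrow> (\<integral>\<zeta>. max 0 (Min ((\<lambda>t. \<bar>c t\<bar> * Z \<zeta> t) ` T) - Max (insert 0 ((\<lambda>t. \<bar>c t\<bar> * Z \<zeta> t) ` {}))) \<partial>N)"
    using T c by (intro exceed_union_diff_limit[where I = T] exceed_union_tendsto)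
      (auto simp: Z_integrable mu.finite_measure_axioms)
  also have "(\<integral>\<zeta>. max 0 (Min ((\<lambda>t. \<bar>c t\<bar> * Z \<zeta> t) ` T) - Max (insert 0 ((\<lambda>t. \<bar>c t\<bar> * Z \<zeta> t) ` {}))) \<partial>N)
      = exceed_lim T c"
    unfolding exceed_lim_def using T Z_nonneg by (intro Bochner_Integration.integral_cong) (auto simp: max_absorb2)
  finally have "(\<lambda>n. real n * measure mu ((\<Inter>t\<in>T. {u :: 's \<Rightarrow>\<^sub>C real. c t < real n * (u t - 1)}) - (\<Union>t\<in>{}. {u :: 's \<Rightarrow>\<^sub>C real. c t < real n * (u t - 1)})))
    \<longlonglongrightarrow> exceed_lim T c" .
  moreover have "(\<Inter>t\<in>T. {u :: 's \<Rightarrow>\<^sub>C real. c t < real n * (apply_bcontfun u t - 1)}) - (\<Union>t\<in>{}. {u :: 's \<Rightarrow>\<^sub>C real. c t < real n * (u t - 1)})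
      = {u :: 's \<Rightarrow>\<^sub>C real. \<forall>t\<in>T. c t < real n * (u t - 1)}" for n
    by auto
  ultimately show ?thesis
    by (simp only: exceed_def)
qed

end

section \<open>Averaging exceedances over the normalized maximum\<close>

lemma continuous_on_bcontfun_of_lipschitz:
  fixes F :: "('s::metric_space \<Rightarrow>\<^sub>C real) \<Rightarrow> real"
  assumes T: "finite T" and F: "\<And>f g. F f \<le> F g + (\<Sum>t\<in>T. \<bar>f t - g t\<bar>)"
  shows "continuous_on UNIV F"
proof (rule lipschitz_on_continuous_on)
  have le: "(\<Sum>t\<in>T. \<bar>f t - g t\<bar>) \<le> real (card T) * dist f g" for f g :: "'s \<Rightarrow>\<^sub>C real"
    using sum_mono[of T "\<lambda>t. \<bar>f t - g t\<bar>" "\<lambda>_. dist f g"] dist_bounded[of f _ g]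
    by (simp add: dist_real_def)
  show "lipschitz_on (real (card T)) UNIV F"
  proof (rule lipschitz_onI)
    fix f g
    show "dist (F f) (F g) \<le> real (card T) * dist f g"
      using F[of f g] F[of g f] le[of f g] le[of g f] by (simp add: dist_real_def dist_commute)
  qed simp
qed

context copula_attraction
begin

lemma exceed_set_borel: "finite T \<Longrightarrow> {u :: 's \<Rightarrow>\<^sub>C real. \<forall>t\<in>T. c t < real n * (u t - 1)} \<in> sets borel"
  by measurable

lemma exceed_nonneg: "0 \<le> exceed n T c"
  and exceed_le_n: "exceed n T c \<le> real n"
  by (simp_all add: exceed_def mult_left_le)

text \<open>A copy above c but not above d on T lies between the two at some t in T, which
  \<open>mu_between\<close> makes unlikely. The one-sided form contains monotonicity as well: the
  sum vanishes where d \<le> c on T.\<close>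

lemma exceed_le:
  assumes T: "finite T" and n: "n \<ge> 1"
  shows "exceed n T c \<le> exceed n T d + (\<Sum>t\<in>T. max 0 (d t - c t))"
proof -
  let ?B = "\<lambda>t. {u :: 's \<Rightarrow>\<^sub>C real. c t < real n * (u t - 1) \<and> real n * (u t - 1) \<le> d t}"
  have "measure mu {u :: 's \<Rightarrow>\<^sub>C real. \<forall>t\<in>T. c t < real n * (u t - 1)}
      \<le> measure mu ({u :: 's \<Rightarrow>\<^sub>C real. \<forall>t\<in>T. d t < real n * (u t - 1)} \<union> (\<Union>t\<in>T. ?B t))"
    using T exceed_set_borel[OF T] by (intro mu.finite_measure_mono sets.Un) (auto simp: not_less)
  also have "\<dots> \<le> measure mu {u :: 's \<Rightarrow>\<^sub>C real. \<forall>t\<in>T. d t < real n * (u t - 1)} + measure mu (\<Union>t\<in>T. ?B t)"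
    using T exceed_set_borel[OF T] by (intro measure_Un_le) auto
  also have "measure mu (\<Union>t\<in>T. ?B t) \<le> (\<Sum>t\<in>T. measure mu (?B t))"
    using T by (intro mu.finite_measure_subadditive_finite) auto
  finally have "exceed n T c \<le> real n * (measure mu {u :: 's \<Rightarrow>\<^sub>C real. \<forall>t\<in>T. d t < real n * (u t - 1)}
      + (\<Sum>t\<in>T. measure mu (?B t)))"
    unfolding exceed_def by (intro mult_left_mono) auto
  also have "\<dots> = exceed n T d + (\<Sum>t\<in>T. real n * measure mu (?B t))"
    by (simp add: exceed_def distrib_left sum_distrib_left)
  also have "(\<Sum>t\<in>T. real n * measure mu (?B t)) \<le> (\<Sum>t\<in>T. max 0 (d t - c t))"
  proof (rule sum_mono)
    fix t
    show "real n * measure mu (?B t) \<le> max 0 (d t - c t)"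
    proof (cases "c t \<le> d t")
      case True
      then show ?thesis using mu_between[OF n True] by simp
    next
      case False
      then have empty: "?B t = {}" by auto
      show ?thesis unfolding empty by simp
    qed
  qed
  finally show ?thesis by simp
qed

text \<open>Copies are almost surely at most 1 on T, so positive thresholds act like 0. This brings
  shifted paths f + a, which may be positive, into the range where the limit is known.\<close>

lemma exceed_min_zero:
  assumes T: "finite T" and n: "n \<ge> 1"
  shows "exceed n T (\<lambda>t. min 0 (c t)) = exceed n T c"
proof -
  have "AE u in mu. \<forall>t\<in>T. \<not> 0 < real n * (apply_bcontfun u t - 1)"
    unfolding AE_finite_all[OF T]
  proof
    fix t
    have "real n * measure mu {u :: 's \<Rightarrow>\<^sub>C real. 0 < real n * (u t - 1)} \<le> 0"
      using mu_greater[OF n, of 0 t] by simp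
    then have "measure mu {u :: 's \<Rightarrow>\<^sub>C real. 0 < real n * (u t - 1)} = 0"
      using n measure_nonneg[of mu] by (simp add: mult_le_0_iff measure_le_0_iff)
    then have "AE u in mu. u \<notin> {u :: 's \<Rightarrow>\<^sub>C real. 0 < real n * (u t - 1)}"
      by (subst (asm) mu.prob_eq_0) auto
    then show "AE u in mu. \<not> 0 < real n * (apply_bcontfun u t - 1)"
      by eventually_elim blast
  qed
  then have "AE u in mu. u \<in> {u. \<forall>t\<in>T. min 0 (c t) < real n * (apply_bcontfun u t - 1)}
      \<longleftrightarrow> u \<in> {u. \<forall>t\<in>T. c t < real n * (apply_bcontfun u t - 1)}"
    by eventually_elim (auto simp: min_less_iff_disj)
  then show ?thesis
    unfolding exceed_def using exceed_set_borel[OF T]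
    by (intro arg_cong[of _ _ "\<lambda>x. real n * x"] mu.finite_measure_eq_AE) auto
qed

text \<open>Inherited from \<open>exceed_le\<close> in the limit, which spares a separate argument
  about the generator.\<close>

lemma exceed_lim_le:
  assumes T: "finite T" "T \<noteq> {}" and "\<And>t. t \<in> T \<Longrightarrow> c t \<le> 0" "\<And>t. t \<in> T \<Longrightarrow> d t \<le> 0"
  shows "exceed_lim T c \<le> exceed_lim T d + (\<Sum>t\<in>T. max 0 (d t - c t))"
proof (rule tendsto_le[OF sequentially_bot])
  show "(\<lambda>n. exceed n T d + (\<Sum>t\<in>T. max 0 (d t - c t))) \<longlonglongrightarrow> exceed_lim T d + (\<Sum>t\<in>T. max 0 (d t - c t))"
    using assms by (intro tendsto_intros exceed_tendsto)
  show "(\<lambda>n. exceed n T c) \<longlonglongrightarrow> exceed_lim T c"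
    using assms by (intro exceed_tendsto)
  show "\<forall>\<^sub>F n in sequentially. exceed n T c \<le> exceed n T d + (\<Sum>t\<in>T. max 0 (d t - c t))"
    using eventually_ge_at_top[of 1] by eventually_elim (rule exceed_le[OF T(1)])
qed

lemma exceed_lim_nonneg:
  assumes T: "finite T" "T \<noteq> {}"
  shows "0 \<le> exceed_lim T c"
  unfolding exceed_lim_def using T Z_nonneg by (intro Bochner_Integration.integral_nonneg_AE AE_I2) auto

lemma exceed_lim_le_sum:
  assumes T: "finite T" "T \<noteq> {}" and c: "\<And>t. t \<in> T \<Longrightarrow> c t \<le> 0"
  shows "exceed_lim T c \<le> (\<Sum>t\<in>T. - c t)"
proof -
  have "exceed_lim T c \<le> exceed_lim T (\<lambda>_. 0) + (\<Sum>t\<in>T. max 0 (0 - c t))"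
    using c by (intro exceed_lim_le[OF T]) auto
  also have "exceed_lim T (\<lambda>_. 0) = 0"
    using T by (simp add: exceed_lim_def image_constant_conv)
  also have "(\<Sum>t\<in>T. max 0 (0 - c t)) = (\<Sum>t\<in>T. - c t)"
    using c by (intro sum.cong) auto
  finally show ?thesis by simp
qed

text \<open>
  All \<open>exceed n T\<close> share one Lipschitz constant, so pointwise convergence is uniform on boxes.
\<close>

lemma exceed_uniform:
  assumes T: "finite T" "T \<noteq> {}" and e: "e > 0"
  shows "eventually (\<lambda>n. \<forall>c. (\<forall>t\<in>T. - K \<le> c t \<and> c t \<le> 0) \<longrightarrow> \<bar>exceed n T c - exceed_lim T c\<bar> \<le> e) sequentially"
proof -
  \<comment> \<open>Moving c to a grid function costs \<open>card T * \<delta>\<close> for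
    \<open>exceed\<close> and again for \<open>exceed_lim\<close>, and the grid itself contributes
    \<open>\<delta>\<close>; these add up to e.\<close>
  define \<delta> where "\<delta> = e / (2 * real (card T) + 1)"
  have \<delta>: "\<delta> > 0" "2 * (real (card T) * \<delta>) + \<delta> = e"
  proof -
    have m: "0 < 2 * real (card T) + 1"
      by (rule add_nonneg_pos) auto
    then show "\<delta> > 0"
      using e by (simp add: \<delta>_def)
    have "(2 * real (card T) + 1) * \<delta> = e"
      using m unfolding \<delta>_def by (simp del: of_nat_Suc)
    then show "2 * (real (card T) * \<delta>) + \<delta> = e"
      by (simp add: distrib_right)
  qed
  \<comment> \<open>Functions from T into a finite net of [- K, 0] form a finite set, on which
    pointwise convergence is uniform.\<close>
  obtain R where R: "finite R" "R \<subseteq> {- K..0}" "{- K..0} \<subseteq> (\<Union>r\<in>R. ball r \<delta>)"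
    using seq_compact_imp_totally_bounded[of "{- K..0}"] \<delta>(1) by (auto simp: compact_imp_seq_compact)
  have "eventually (\<lambda>n. \<bar>exceed n T q - exceed_lim T q\<bar> < \<delta>) sequentially" if "q \<in> Pi\<^sub>E T (\<lambda>_. R)" for q
  proof -
    have "q t \<le> 0" if "t \<in> T" for t
      using R(2) that \<open>q \<in> _\<close> by (auto simp: PiE_iff subset_iff)
    then show ?thesis
      using tendstoD[OF exceed_tendsto[OF T, of q] \<delta>(1)] by (simp add: dist_real_def)
  qed
  then have "eventually (\<lambda>n. \<forall>q\<in>Pi\<^sub>E T (\<lambda>_. R). \<bar>exceed n T q - exceed_lim T q\<bar> < \<delta>) sequentially"
    using T(1) R(1) by (intro eventually_ball_finite finite_PiE) auto
  then show ?thesis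
    using eventually_ge_at_top[of 1]
  proof eventually_elim
    case (elim n)
    show ?case
    proof (intro allI impI)
      fix c assume c: "\<forall>t\<in>T. - K \<le> c t \<and> c t \<le> 0"
      then have "\<forall>t\<in>T. \<exists>r\<in>R. \<bar>c t - r\<bar> < \<delta>"
        using R(3) by (fastforce simp: dist_real_def abs_minus_commute)
      then obtain q where q: "\<forall>t\<in>T. q t \<in> R \<and> \<bar>c t - q t\<bar> < \<delta>"
        by metis
      define q' where "q' = restrict q T"
      have q': "q' \<in> Pi\<^sub>E T (\<lambda>_. R)" and q'_close: "\<And>t. t \<in> T \<Longrightarrow> \<bar>c t - q' t\<bar> < \<delta>"
        using q by (auto simp: q'_def)
      have q'_le: "q' t \<le> 0" if "t \<in> T" for t
        using q' R(2) that by (auto simp: PiE_iff subset_iff)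
      have s: "(\<Sum>t\<in>T. max 0 (c t - q' t)) \<le> real (card T) * \<delta>"
        "(\<Sum>t\<in>T. max 0 (q' t - c t)) \<le> real (card T) * \<delta>"
        using \<delta>(1) q'_close by (intro sum_bounded_above; force simp: abs_less_iff)+
      have "\<bar>exceed n T q' - exceed_lim T q'\<bar> < \<delta>"
        using elim(1) q' by blast
      moreover have "exceed n T c \<le> exceed n T q' + real (card T) * \<delta>"
        "exceed n T q' \<le> exceed n T c + real (card T) * \<delta>"
        using exceed_le[OF T(1) elim(2), of c q'] exceed_le[OF T(1) elim(2), of q' c] s by linarith+
      moreover have "exceed_lim T c \<le> exceed_lim T q' + real (card T) * \<delta>"
        "exceed_lim T q' \<le> exceed_lim T c + real (card T) * \<delta>"
        using exceed_lim_le[OF T, of c q'] exceed_lim_le[OF T, of q' c] s c q'_le by fastforce+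
      ultimately show "\<bar>exceed n T c - exceed_lim T c\<bar> \<le> e"
        using \<delta>(2) by linarith
    qed
  qed
qed

lemma nu_tail_integral:
  assumes "n \<ge> 1" "0 \<le> K"
  shows "integrable (nu n) (\<lambda>f. max 0 (- f s - K))" "(\<integral>f. max 0 (- f s - K) \<partial>nu n) \<le> 2 * exp (- K)"
  using prob_space.exponential_tail[OF prob_space_nu, of "\<lambda>f. - f s" n K] nu_tail assms by auto

lemma nu_lim_tail_integral:
  assumes "0 \<le> K"
  shows "integrable nu_lim (\<lambda>f. max 0 (- f s - K))" "(\<integral>f. max 0 (- f s - K) \<partial>nu_lim) \<le> 2 * exp (- K)"
  using nu_lim.exponential_tail[of "\<lambda>f. - f s" K] nu_lim_tail assms by auto

lemma exceed_continuous:
  assumes T: "finite T" and n: "n \<ge> 1"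
  shows "continuous_on UNIV (\<lambda>f :: 's \<Rightarrow>\<^sub>C real. exceed n T (\<lambda>t. f t + a))"
proof (rule continuous_on_bcontfun_of_lipschitz[OF T])
  fix f g :: "'s \<Rightarrow>\<^sub>C real"
  have "(\<Sum>t\<in>T. max 0 (g t + a - (f t + a))) \<le> (\<Sum>t\<in>T. \<bar>f t - g t\<bar>)"
    by (intro sum_mono) auto
  then show "exceed n T (\<lambda>t. f t + a) \<le> exceed n T (\<lambda>t. g t + a) + (\<Sum>t\<in>T. \<bar>f t - g t\<bar>)"
    using exceed_le[OF T n, of "\<lambda>t. f t + a" "\<lambda>t. g t + a"] by simp
qed

lemma exceed_lim_continuous:
  assumes T: "finite T" "T \<noteq> {}"
  shows "continuous_on UNIV (\<lambda>f :: 's \<Rightarrow>\<^sub>C real. exceed_lim T (\<lambda>t. min 0 (f t + a)))"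
proof (rule continuous_on_bcontfun_of_lipschitz[OF T(1)])
  fix f g :: "'s \<Rightarrow>\<^sub>C real"
  have "(\<Sum>t\<in>T. max 0 (min 0 (g t + a) - min 0 (f t + a))) \<le> (\<Sum>t\<in>T. \<bar>f t - g t\<bar>)"
    by (intro sum_mono) auto
  then show "exceed_lim T (\<lambda>t. min 0 (f t + a)) \<le> exceed_lim T (\<lambda>t. min 0 (g t + a)) + (\<Sum>t\<in>T. \<bar>f t - g t\<bar>)"
    using exceed_lim_le[OF T, of "\<lambda>t. min 0 (f t + a)" "\<lambda>t. min 0 (g t + a)"] by simp
qed

text \<open>Clipping at - K makes the functional bounded as well, which convergence in law requires
  of its test functions.\<close>

lemma exceed_lim_clip_continuous:
  assumes T: "finite T" "T \<noteq> {}" and K: "0 \<le> K"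
  shows "continuous_on UNIV (\<lambda>f :: 's \<Rightarrow>\<^sub>C real. exceed_lim T (\<lambda>t. max (- K) (min 0 (f t + a))))"
proof (rule continuous_on_bcontfun_of_lipschitz[OF T(1)])
  fix f g :: "'s \<Rightarrow>\<^sub>C real"
  have "(\<Sum>t\<in>T. max 0 (max (- K) (min 0 (g t + a)) - max (- K) (min 0 (f t + a)))) \<le> (\<Sum>t\<in>T. \<bar>f t - g t\<bar>)"
    by (intro sum_mono) auto
  then show "exceed_lim T (\<lambda>t. max (- K) (min 0 (f t + a)))
      \<le> exceed_lim T (\<lambda>t. max (- K) (min 0 (g t + a))) + (\<Sum>t\<in>T. \<bar>f t - g t\<bar>)"
    using exceed_lim_le[OF T, of "\<lambda>t. max (- K) (min 0 (f t + a))" "\<lambda>t. max (- K) (min 0 (g t + a))"] K by simp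
qed

lemma exceed_lim_integrable:
  assumes T: "finite T" "T \<noteq> {}" and a: "0 \<le> a"
  shows "integrable nu_lim (\<lambda>f. exceed_lim T (\<lambda>t. min 0 (f t + a)))"
proof (rule Bochner_Integration.integrable_bound)
  show "integrable nu_lim (\<lambda>f. \<Sum>t\<in>T. max 0 (- f t - 0))"
    by (intro Bochner_Integration.integrable_sum nu_lim_tail_integral) simp
  show "(\<lambda>f. exceed_lim T (\<lambda>t. min 0 (apply_bcontfun f t + a))) \<in> borel_measurable nu_lim"
    using borel_measurable_continuous_onI[OF exceed_lim_continuous[OF T]] by simp
  show "AE f in nu_lim. norm (exceed_lim T (\<lambda>t. min 0 (apply_bcontfun f t + a))) \<le> norm (\<Sum>t\<in>T. max 0 (- f t - 0))"
  proof (rule AE_I2)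
    fix f :: "'s \<Rightarrow>\<^sub>C real"
    have "exceed_lim T (\<lambda>t. min 0 (f t + a)) \<le> (\<Sum>t\<in>T. - min 0 (f t + a))"
      by (intro exceed_lim_le_sum[OF T]) simp
    also have "\<dots> \<le> (\<Sum>t\<in>T. max 0 (- f t - 0))"
      using a by (intro sum_mono) auto
    finally show "norm (exceed_lim T (\<lambda>t. min 0 (f t + a))) \<le> norm (\<Sum>t\<in>T. max 0 (- f t - 0))"
      using exceed_lim_nonneg[OF T, of "\<lambda>t. min 0 (f t + a)"] by simp
  qed
qed

text \<open>Integrand and measure vary together. The limit functional clipped at - K serves as
  intermediary: clipped thresholds lie in a box, where \<open>exceed_uniform\<close> applies; its
  own integrals converge by \<open>nu_tendsto\<close>; and clipping costs at most the sum over T of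
  (- f t - K) cut off at 0, small on average uniformly in n.\<close>

lemma exceed_integral_tendsto:
  assumes T: "finite T" "T \<noteq> {}" and a: "0 \<le> a"
  shows "(\<lambda>n. \<integral>f. exceed n T (\<lambda>t. f t + a) \<partial>nu n) \<longlonglongrightarrow> (\<integral>f. exceed_lim T (\<lambda>t. min 0 (f t + a)) \<partial>nu_lim)"
proof (rule tendstoI)
  fix e :: real assume e: "e > 0"
  \<comment> \<open>Four of the five parts are spent: the uniform error and the tail under
    \<open>nu n\<close>, the weak convergence of the clipped functional, and the tail under
    \<open>nu_lim\<close>.\<close>
  define e' where "e' = e / 5"
  have e': "e' > 0" using e by (simp add: e'_def)
  have "((\<lambda>K. real (card T) * (2 * exp (- K))) \<longlongrightarrow> real (card T) * (2 * 0)) at_top"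
    by (intro tendsto_intros filterlim_compose[OF exp_at_bot] filterlim_uminus_at_bot_at_top)
  then have "eventually (\<lambda>K. real (card T) * (2 * exp (- K)) < e') at_top"
    using e' by (intro order_tendstoD(2)) auto
  then obtain K where K: "0 \<le> K" "real (card T) * (2 * exp (- K)) < e'"
    using eventually_happens[OF eventually_conj[OF _ eventually_ge_at_top[of 0]]] by (metis trivial_limit_at_top_linorder)
  let ?c = "\<lambda>(f :: 's \<Rightarrow>\<^sub>C real) t. max (- K) (min 0 (f t + a))"
  let ?R = "\<lambda>f :: 's \<Rightarrow>\<^sub>C real. \<Sum>t\<in>T. max 0 (- f t - K)"
  have sum_clip: "(\<Sum>t\<in>T. max 0 (?c f t - min 0 (f t + a))) \<le> ?R f" for f :: "'s \<Rightarrow>\<^sub>C real"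
    using a K(1) by (intro sum_mono) auto
  have sum_clip0: "(\<Sum>t\<in>T. max 0 (min 0 (f t + a) - ?c f t)) = 0" for f :: "'s \<Rightarrow>\<^sub>C real"
    by (intro sum.neutral) auto
  have Lc_bounds: "0 \<le> exceed_lim T (?c f)" "exceed_lim T (?c f) \<le> real (card T) * K" for f :: "'s \<Rightarrow>\<^sub>C real"
  proof -
    show "0 \<le> exceed_lim T (?c f)" by (rule exceed_lim_nonneg[OF T])
    have "exceed_lim T (?c f) \<le> (\<Sum>t\<in>T. - ?c f t)"
      using K(1) by (intro exceed_lim_le_sum[OF T]) auto
    also have "\<dots> \<le> real (card T) * K"
      using K(1) by (intro sum_bounded_above) auto
    finally show "exceed_lim T (?c f) \<le> real (card T) * K" .
  qed
  note [measurable] = borel_measurable_continuous_onI[OF exceed_lim_clip_continuous[OF T K(1)]]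
  have L: "\<bar>exceed_lim T (\<lambda>t. min 0 (f t + a)) - exceed_lim T (?c f)\<bar> \<le> ?R f" for f :: "'s \<Rightarrow>\<^sub>C real"
    using exceed_lim_le[OF T, of "\<lambda>t. min 0 (f t + a)" "?c f"] exceed_lim_le[OF T, of "?c f" "\<lambda>t. min 0 (f t + a)"]
      sum_clip[of f] sum_clip0[of f] K(1) by (simp add: abs_le_iff)
  have intLc: "integrable nu_lim (\<lambda>f. exceed_lim T (?c f))"
    using Lc_bounds by (intro nu_lim.integrable_const_bound[of _ "real (card T) * K"]) auto
  have lim_part: "\<bar>(\<integral>f. exceed_lim T (\<lambda>t. min 0 (f t + a)) \<partial>nu_lim) - (\<integral>f. exceed_lim T (?c f) \<partial>nu_lim)\<bar> < e'"
  proof -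
    have "\<bar>(\<integral>f. exceed_lim T (\<lambda>t. min 0 (f t + a)) \<partial>nu_lim) - (\<integral>f. exceed_lim T (?c f) \<partial>nu_lim)\<bar>
        = \<bar>\<integral>f. exceed_lim T (\<lambda>t. min 0 (apply_bcontfun f t + a)) - exceed_lim T (?c f) \<partial>nu_lim\<bar>"
      using intLc exceed_lim_integrable[OF T a] by simp
    also have "\<dots> \<le> (\<integral>f. ?R f \<partial>nu_lim)"
      using L intLc exceed_lim_integrable[OF T a] K(1)
      by (intro order_trans[OF integral_abs_bound] integral_mono Bochner_Integration.integrable_sum
          integrable_abs Bochner_Integration.integrable_diff nu_lim_tail_integral(1))
    also have "\<dots> = (\<Sum>t\<in>T. \<integral>f. max 0 (- f t - K) \<partial>nu_lim)"
      using K(1) by (intro Bochner_Integration.integral_sum nu_lim_tail_integral(1))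
    also have "\<dots> \<le> real (card T) * (2 * exp (- K))"
      using K(1) by (intro sum_bounded_above nu_lim_tail_integral(2))
    finally show ?thesis using K(2) by linarith
  qed
  have "(\<lambda>n. \<integral>f. exceed_lim T (?c f) \<partial>nu n) \<longlonglongrightarrow> (\<integral>f. exceed_lim T (?c f) \<partial>nu_lim)"
    using Lc_bounds by (intro nu_tendsto[of _ "real (card T) * K"] exceed_lim_clip_continuous[OF T K(1)]) auto
  from tendstoD[OF this e']
  have "eventually (\<lambda>n. \<bar>(\<integral>f. exceed_lim T (?c f) \<partial>nu n) - (\<integral>f. exceed_lim T (?c f) \<partial>nu_lim)\<bar> < e') sequentially"
    by (simp add: dist_real_def)
  moreover note exceed_uniform[OF T e', of K] eventually_ge_at_top[of "1::nat"]
  ultimately show "eventually (\<lambda>n. dist (\<integral>f. exceed n T (\<lambda>t. f t + a) \<partial>nu n)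
      (\<integral>f. exceed_lim T (\<lambda>t. min 0 (f t + a)) \<partial>nu_lim) < e) sequentially"
  proof eventually_elim
    case (elim n)
    interpret nu: prob_space "nu n" by (rule prob_space_nu)
    have diff: "\<bar>exceed n T (\<lambda>t. f t + a) - exceed_lim T (?c f)\<bar> \<le> ?R f + e'" for f :: "'s \<Rightarrow>\<^sub>C real"
    proof -
      have "\<bar>exceed n T (?c f) - exceed_lim T (?c f)\<bar> \<le> e'"
        using elim(2) K(1) by auto
      moreover have "exceed n T (\<lambda>t. min 0 (f t + a)) \<le> exceed n T (?c f) + ?R f"
        "exceed n T (?c f) \<le> exceed n T (\<lambda>t. min 0 (f t + a))"
        using exceed_le[OF T(1) elim(3), of "\<lambda>t. min 0 (f t + a)" "?c f"]
          exceed_le[OF T(1) elim(3), of "?c f" "\<lambda>t. min 0 (f t + a)"] sum_clip[of f] sum_clip0[of f] by linarith+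
      moreover have "0 \<le> ?R f"
        by (intro sum_nonneg) auto
      ultimately show ?thesis
        using exceed_min_zero[OF T(1) elim(3), of "\<lambda>t. f t + a"] by linarith
    qed
    have int1: "integrable (nu n) (\<lambda>f. exceed n T (\<lambda>t. f t + a))"
      using borel_measurable_continuous_onI[OF exceed_continuous[OF T(1) elim(3), of a]]
      by (intro nu.integrable_const_bound[of _ "real n"]) (auto simp: exceed_nonneg exceed_le_n)
    have int2: "integrable (nu n) (\<lambda>f. exceed_lim T (?c f))"
      using Lc_bounds by (intro nu.integrable_const_bound[of _ "real (card T) * K"]) auto
    have int3: "integrable (nu n) ?R"
      using K(1) elim(3) by (intro Bochner_Integration.integrable_sum nu_tail_integral(1))
    have "\<bar>(\<integral>f. exceed n T (\<lambda>t. f t + a) \<partial>nu n) - (\<integral>f. exceed_lim T (?c f) \<partial>nu n)\<bar>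
        = \<bar>\<integral>f. exceed n T (\<lambda>t. apply_bcontfun f t + a) - exceed_lim T (?c f) \<partial>nu n\<bar>"
      using int1 int2 by simp
    also have "\<dots> \<le> (\<integral>f. ?R f + e' \<partial>nu n)"
      using int1 int2 int3 diff
      by (intro order_trans[OF integral_abs_bound] integral_mono integrable_abs
          Bochner_Integration.integrable_diff Bochner_Integration.integrable_add) auto
    also have "\<dots> = (\<Sum>t\<in>T. \<integral>f. max 0 (- f t - K) \<partial>nu n) + e'"
      using int3 nu_tail_integral(1)[OF elim(3) K(1)]
      by (subst Bochner_Integration.integral_add) (auto simp: nu.prob_space[unfolded space_nu])
    also have "(\<Sum>t\<in>T. \<integral>f. max 0 (- f t - K) \<partial>nu n) \<le> real (card T) * (2 * exp (- K))"
      using K(1) elim(3) by (intro sum_bounded_above nu_tail_integral(2))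
    finally have "\<bar>(\<integral>f. exceed n T (\<lambda>t. f t + a) \<partial>nu n) - (\<integral>f. exceed_lim T (?c f) \<partial>nu n)\<bar> < 2 * e'"
      using K(2) by linarith
    then show ?case
      using lim_part elim(1) e unfolding dist_real_def e'_def by linarith
  qed
qed

end

section \<open>The dual norm as a limit over nets\<close>

lemma continuous_on_bcontfun_of_le_dist:
  fixes F :: "('s::metric_space \<Rightarrow>\<^sub>C real) \<Rightarrow> real"
  assumes "0 \<le> C" and F: "\<And>f g. F f \<le> F g + C * dist f g"
  shows "continuous_on UNIV F"
proof (rule lipschitz_on_continuous_on)
  show "lipschitz_on C UNIV F"
  proof (rule lipschitz_onI)
    fix f g
    show "dist (F f) (F g) \<le> C * dist f g"
      using F[of f g] F[of g f] by (simp add: dist_real_def dist_commute)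
  qed fact
qed

lemma bdd_bcontfun [simp]:
  fixes f :: "'s::metric_space \<Rightarrow>\<^sub>C real"
  shows "bdd_above (range f)" "bdd_below (range f)"
  by (simp_all add: bounded_imp_bdd_above bounded_imp_bdd_below)

lemma bcontfun_le_add_dist:
  fixes f g :: "'s::metric_space \<Rightarrow>\<^sub>C real"
  shows "f s \<le> g s + dist f g"
  using dist_bounded[of f s g] by (simp add: dist_real_def)

lemma continuous_on_SUP_bcontfun:
  "continuous_on UNIV (\<lambda>f :: 's::metric_space \<Rightarrow>\<^sub>C real. SUP s. f s)"
proof (rule continuous_on_bcontfun_of_le_dist[of 1])
  fix f g :: "'s \<Rightarrow>\<^sub>C real"
  have "f s \<le> (SUP s. g s) + 1 * dist f g" for s
    using bcontfun_le_add_dist[of f s g] cSUP_upper[of s UNIV g] by auto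
  then show "(SUP s. f s) \<le> (SUP s. g s) + 1 * dist f g"
    by (intro cSUP_least) auto
qed simp

text \<open>The modulus of continuity of a path. The supremum runs over pairs in one index set; for
  \<open>\<delta>\<close> > 0 this set contains the diagonal and so is nonempty.\<close>

definition osc :: "real \<Rightarrow> ('s::metric_space \<Rightarrow>\<^sub>C real) \<Rightarrow> real" where
  "osc \<delta> f = (SUP p\<in>{p. dist (fst p) (snd p) < \<delta>}. \<bar>f (fst p) - f (snd p)\<bar>)"

lemma osc_upper:
  fixes f :: "'s::metric_space \<Rightarrow>\<^sub>C real"
  assumes "dist s t < \<delta>"
  shows "\<bar>f s - f t\<bar> \<le> osc \<delta> f"
proof -
  have b: "\<bar>f s - f t\<bar> \<le> 2 * norm f" for s t
    using norm_bounded[of f s] norm_bounded[of f t] by auto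
  have "\<bar>f (fst (s, t)) - f (snd (s, t))\<bar> \<le> osc \<delta> f"
    unfolding osc_def using assms b
    by (intro cSUP_upper) (auto intro!: bdd_aboveI[of _ "2 * norm f"])
  then show ?thesis by simp
qed

lemma osc_least:
  fixes f :: "'s::metric_space \<Rightarrow>\<^sub>C real"
  assumes "\<delta> > 0" "\<And>s t. dist s t < \<delta> \<Longrightarrow> \<bar>f s - f t\<bar> \<le> b"
  shows "osc \<delta> f \<le> b"
proof -
  have "(undefined, undefined) \<in> {p :: 's \<times> 's. dist (fst p) (snd p) < \<delta>}"
    using assms(1) by simp
  then have "{p :: 's \<times> 's. dist (fst p) (snd p) < \<delta>} \<noteq> {}" by blast
  then show ?thesis
    unfolding osc_def using assms(2) by (intro cSUP_least) auto
qed

lemma continuous_on_osc: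
  assumes "\<delta> > 0"
  shows "continuous_on UNIV (osc \<delta> :: ('s::metric_space \<Rightarrow>\<^sub>C real) \<Rightarrow> real)"
proof (rule continuous_on_bcontfun_of_le_dist[of 2])
  fix f g :: "'s \<Rightarrow>\<^sub>C real"
  show "osc \<delta> f \<le> osc \<delta> g + 2 * dist f g"
  proof (rule osc_least[OF assms])
    fix s t :: 's assume "dist s t < \<delta>"
    then show "\<bar>f s - f t\<bar> \<le> osc \<delta> g + 2 * dist f g"
      using osc_upper[of s t \<delta> g] bcontfun_le_add_dist[of f s g] bcontfun_le_add_dist[of f t g]
        bcontfun_le_add_dist[of g s f] bcontfun_le_add_dist[of g t f]
      by (simp add: dist_commute[of g f])
  qed
qed simp

lemma osc_mono:
  assumes "0 < \<delta>" "\<delta> \<le> \<delta>'"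
  shows "osc \<delta> f \<le> osc \<delta>' f"
  using assms by (intro osc_least osc_upper) auto

text \<open>Boundedness of c keeps the infimum finite also for paths z with negative values.
  Continuity in z on all of C(S) makes the infimum over uncountably many points measurable once z is
  replaced by the generator.\<close>

lemma INF_abs_mult:
  fixes z :: "'s::metric_space \<Rightarrow>\<^sub>C real" and c :: "'s \<Rightarrow> real"
  assumes B: "\<And>s. \<bar>c s\<bar> \<le> B"
  shows INF_abs_mult_lower: "(INF s. \<bar>c s\<bar> * z s) \<le> \<bar>c t\<bar> * z t"
    and continuous_on_INF_abs_mult: "continuous_on UNIV (\<lambda>z :: 's \<Rightarrow>\<^sub>C real. INF s. \<bar>c s\<bar> * z s)"
proof -
  have B0: "0 \<le> B" using B[of undefined] by linarith
  have lower: "(INF s. \<bar>c s\<bar> * z s) \<le> \<bar>c t\<bar> * z t" for z :: "'s \<Rightarrow>\<^sub>C real" and t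
  proof (rule cINF_lower)
    have "- (B * norm z) \<le> \<bar>c s\<bar> * z s" for s
    proof -
      have "\<bar>\<bar>c s\<bar> * z s\<bar> \<le> B * norm z"
        using B[of s] B0 norm_bounded[of z s] by (simp add: abs_mult mult_mono)
      then show ?thesis by linarith
    qed
    then show "bdd_below (range (\<lambda>s. \<bar>c s\<bar> * z s))"
      by (intro bdd_belowI[of _ "- (B * norm z)"]) auto
  qed simp
  show "(INF s. \<bar>c s\<bar> * z s) \<le> \<bar>c t\<bar> * z t" by (rule lower)
  show "continuous_on UNIV (\<lambda>z :: 's \<Rightarrow>\<^sub>C real. INF s. \<bar>c s\<bar> * z s)"
  proof (rule continuous_on_bcontfun_of_le_dist[OF B0])
    fix z z' :: "'s \<Rightarrow>\<^sub>C real"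
    have "(INF s. \<bar>c s\<bar> * z s) - B * dist z z' \<le> \<bar>c s\<bar> * z' s" for s
    proof -
      have "\<bar>c s\<bar> * z s \<le> \<bar>c s\<bar> * (z' s + dist z z')"
        by (intro mult_left_mono bcontfun_le_add_dist) simp
      also have "\<dots> \<le> \<bar>c s\<bar> * z' s + B * dist z z'"
        using B[of s] by (simp add: distrib_left mult_right_mono)
      finally show ?thesis
        using lower[of z s] by linarith
    qed
    then have "(INF s. \<bar>c s\<bar> * z s) - B * dist z z' \<le> (INF s. \<bar>c s\<bar> * z' s)"
      by (intro cINF_greatest) auto
    then show "(INF s. \<bar>c s\<bar> * z s) \<le> (INF s. \<bar>c s\<bar> * z' s) + B * dist z z'" by simp
  qed
qed

text \<open>By uniform continuity, a net finer than the modulus of h for e / 2 misses the infimum by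
  at most e / 2.\<close>

lemma Min_net_tendsto_INF:
  fixes h :: "'s::metric_space \<Rightarrow>\<^sub>C real"
  assumes cpt: "compact (UNIV :: 's set)" and T: "\<And>k. finite (T k)"
    and net: "\<And>k s. \<exists>t\<in>T k. dist s t < 1 / real (Suc k)"
  shows "(\<lambda>k. Min (h ` T k)) \<longlonglongrightarrow> (INF s. h s)"
proof (rule LIMSEQ_I)
  fix e :: real assume e: "e > 0"
  obtain d where d: "d > 0" "\<And>s t. dist s t < d \<Longrightarrow> \<bar>h s - h t\<bar> < e / 2"
    using bcontfun_uniformly_continuous[OF cpt, of "e / 2" h] e by auto
  obtain m where m: "1 / real (Suc m) < d"
    using nat_approx_posE[OF d(1)] by blast
  show "\<exists>m. \<forall>k\<ge>m. norm (Min (h ` T k) - (INF s. h s)) < e"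
  proof (intro exI[of _ m] allI impI)
    fix k assume "m \<le> k"
    then have "1 / real (Suc k) \<le> 1 / real (Suc m)"
      by (intro divide_left_mono) auto
    then have k: "1 / real (Suc k) < d"
      using m by linarith
    have ne: "T k \<noteq> {}" using net[of k undefined] by blast
    have "Min (h ` T k) - e / 2 \<le> h s" for s
    proof -
      obtain t where t: "t \<in> T k" "dist s t < 1 / real (Suc k)" using net by blast
      then have "Min (h ` T k) \<le> h t" using T by simp
      moreover have "\<bar>h s - h t\<bar> < e / 2" using d(2)[of s t] t(2) k by linarith
      ultimately show ?thesis by linarith
    qed
    then have "Min (h ` T k) - e / 2 \<le> (INF s. h s)"
      by (intro cINF_greatest) auto
    moreover have "(INF s. h s) \<le> Min (h ` T k)"
      using T ne by (subst Min_ge_iff) (auto intro!: cINF_lower)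
    ultimately show "norm (Min (h ` T k) - (INF s. h s)) < e"
      using e by simp
  qed
qed

lemma abs_min_zero_add_le:
  fixes f :: "'s::metric_space \<Rightarrow>\<^sub>C real"
  shows "\<bar>min 0 (f s + a)\<bar> \<le> norm f + \<bar>a\<bar>"
  using norm_bounded[of f s, unfolded real_norm_def] by linarith

context copula_attraction
begin

text \<open>The D-norm of the constant 1. It is a Lipschitz constant of the dual D-norm function
  with respect to the sup-norm.\<close>

definition sup_mean :: real where
  "sup_mean = (\<integral>\<zeta>. (SUP s. Z \<zeta> s) \<partial>N)"

lemma sup_mean_nonneg: "0 \<le> sup_mean"
  unfolding sup_mean_def
proof (rule Bochner_Integration.integral_nonneg_AE, rule AE_I2)
  fix \<zeta> assume "\<zeta> \<in> space N"
  then show "0 \<le> (SUP s. Z \<zeta> s)"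
    using Z_nonneg[of \<zeta> undefined] cSUP_upper[of undefined UNIV "Z \<zeta>"] by simp
qed

lemma INF_abs_mult_nonneg: "\<zeta> \<in> space N \<Longrightarrow> 0 \<le> (INF s. \<bar>c s\<bar> * Z \<zeta> s)"
  using Z_nonneg by (intro cINF_greatest) auto

lemma dual_integrable:
  assumes B: "\<And>s. \<bar>c s\<bar> \<le> B"
  shows "integrable N (\<lambda>\<zeta>. INF s. \<bar>c s\<bar> * Z \<zeta> s)"
proof (rule Bochner_Integration.integrable_bound)
  show "integrable N (\<lambda>\<zeta>. \<bar>c undefined\<bar> * Z \<zeta> undefined)"
    by (intro integrable_mult_right Z_integrable)
  show "(\<lambda>\<zeta>. INF s. \<bar>c s\<bar> * Z \<zeta> s) \<in> borel_measurable N"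
    by (rule measurable_compose[OF Z_measurable borel_measurable_continuous_onI[OF continuous_on_INF_abs_mult[OF B]]])
  show "AE \<zeta> in N. norm (INF s. \<bar>c s\<bar> * Z \<zeta> s) \<le> norm (\<bar>c undefined\<bar> * Z \<zeta> undefined)"
    using INF_abs_mult_nonneg INF_abs_mult_lower[of c B, OF B] Z_nonneg by (intro AE_I2) (simp add: abs_mult)
qed

text \<open>Since Z is nonnegative, each product grows by at most e times the supremum of Z, and
  hence so does the infimum.\<close>

lemma dual_le:
  assumes c: "\<And>s. \<bar>c s\<bar> \<le> B" and d: "\<And>s. \<bar>d s\<bar> \<le> B'" and cd: "\<And>s. \<bar>c s\<bar> \<le> \<bar>d s\<bar> + e" and e: "0 \<le> e"
  shows "dual_D_norm N Z c \<le> dual_D_norm N Z d + e * sup_mean"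
proof -
  have "dual_D_norm N Z c \<le> (\<integral>\<zeta>. (INF s. \<bar>d s\<bar> * Z \<zeta> s) + e * (SUP s. Z \<zeta> s) \<partial>N)"
    unfolding dual_D_norm_def
  proof (rule integral_mono)
    show "integrable N (\<lambda>\<zeta>. INF s. \<bar>c s\<bar> * Z \<zeta> s)" by (rule dual_integrable[OF c])
    show "integrable N (\<lambda>\<zeta>. (INF s. \<bar>d s\<bar> * Z \<zeta> s) + e * (SUP s. Z \<zeta> s))"
      by (intro Bochner_Integration.integrable_add integrable_mult_right Z_sup_integrable dual_integrable[OF d])
    fix \<zeta> assume \<zeta>: "\<zeta> \<in> space N"
    have "(INF s. \<bar>c s\<bar> * Z \<zeta> s) - e * (SUP s. Z \<zeta> s) \<le> \<bar>d s\<bar> * Z \<zeta> s" for s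
    proof -
      have "(INF s. \<bar>c s\<bar> * Z \<zeta> s) \<le> \<bar>c s\<bar> * Z \<zeta> s" by (rule INF_abs_mult_lower[OF c])
      also have "\<dots> \<le> (\<bar>d s\<bar> + e) * Z \<zeta> s"
        by (intro mult_right_mono cd Z_nonneg \<zeta>)
      also have "\<dots> \<le> \<bar>d s\<bar> * Z \<zeta> s + e * (SUP s. Z \<zeta> s)"
        using e cSUP_upper[of s UNIV "Z \<zeta>"] by (simp add: distrib_right mult_left_mono)
      finally show ?thesis by simp
    qed
    then have "(INF s. \<bar>c s\<bar> * Z \<zeta> s) - e * (SUP s. Z \<zeta> s) \<le> (INF s. \<bar>d s\<bar> * Z \<zeta> s)"
      by (intro cINF_greatest) auto
    then show "(INF s. \<bar>c s\<bar> * Z \<zeta> s) \<le> (INF s. \<bar>d s\<bar> * Z \<zeta> s) + e * (SUP s. Z \<zeta> s)" by simp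
  qed
  also have "\<dots> = dual_D_norm N Z d + e * sup_mean"
    unfolding dual_D_norm_def sup_mean_def
    by (subst Bochner_Integration.integral_add) (auto intro!: dual_integrable[OF d] Z_sup_integrable)
  finally show ?thesis .
qed

lemma dual_nonneg: "0 \<le> dual_D_norm N Z c"
  unfolding dual_D_norm_def using INF_abs_mult_nonneg
  by (intro Bochner_Integration.integral_nonneg_AE AE_I2)

lemma dual_continuous: "continuous_on UNIV (\<lambda>f :: 's \<Rightarrow>\<^sub>C real. dual_D_norm N Z f)"
proof (rule continuous_on_bcontfun_of_le_dist[OF sup_mean_nonneg])
  fix f g :: "'s \<Rightarrow>\<^sub>C real"
  have "\<bar>f s\<bar> \<le> \<bar>g s\<bar> + dist f g" for s
    using bcontfun_le_add_dist[of f s g] bcontfun_le_add_dist[of g s f] by (simp add: dist_commute)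
  then show "dual_D_norm N Z f \<le> dual_D_norm N Z g + sup_mean * dist f g"
    using dual_le[of f "norm f" g "norm g" "dist f g"] norm_bounded[of f] norm_bounded[of g]
    by (simp add: mult.commute)
qed

lemma dual_min_continuous:
  "continuous_on UNIV (\<lambda>f :: 's \<Rightarrow>\<^sub>C real. dual_D_norm N Z (\<lambda>s. min 0 (f s + a)))"
proof (rule continuous_on_bcontfun_of_le_dist[OF sup_mean_nonneg])
  fix f g :: "'s \<Rightarrow>\<^sub>C real"
  have b: "\<bar>min 0 (h s + a)\<bar> \<le> norm h + \<bar>a\<bar>" for h :: "'s \<Rightarrow>\<^sub>C real" and s
    by (rule abs_min_zero_add_le)
  have "\<bar>min 0 (f s + a)\<bar> \<le> \<bar>min 0 (g s + a)\<bar> + dist f g" for s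
    using bcontfun_le_add_dist[of f s g] bcontfun_le_add_dist[of g s f] zero_le_dist[of f g]
    unfolding dist_commute[of g f] by (simp add: min_def)
  then show "dual_D_norm N Z (\<lambda>s. min 0 (f s + a)) \<le> dual_D_norm N Z (\<lambda>s. min 0 (g s + a)) + sup_mean * dist f g"
    using dual_le[of "\<lambda>s. min 0 (f s + a)" "norm f + \<bar>a\<bar>" "\<lambda>s. min 0 (g s + a)" "norm g + \<bar>a\<bar>" "dist f g"] b by (simp add: mult.commute)
qed

lemma dual_le_exceed_lim:
  assumes T: "finite T" "T \<noteq> {}" and B: "\<And>s. \<bar>c s\<bar> \<le> B"
  shows "dual_D_norm N Z c \<le> exceed_lim T c"
  unfolding dual_D_norm_def exceed_lim_def
proof (rule integral_mono)
  show "integrable N (\<lambda>\<zeta>. INF s. \<bar>c s\<bar> * Z \<zeta> s)" by (rule dual_integrable[OF B])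
  show "integrable N (\<lambda>\<zeta>. Min ((\<lambda>t. \<bar>c t\<bar> * Z \<zeta> t) ` T))"
    using T by (induction rule: finite_ne_induct) (auto simp: Z_integrable)
  show "(INF s. \<bar>c s\<bar> * Z \<zeta> s) \<le> Min ((\<lambda>t. \<bar>c t\<bar> * Z \<zeta> t) ` T)" for \<zeta>
    using T INF_abs_mult_lower[of c B, OF B] by (subst Min_ge_iff) auto
qed

text \<open>One point dominates the minimum and E(Z_s) = 1. The bound is the same for all T
  containing s, as dominated convergence along nets requires.\<close>

lemma exceed_lim_le_point:
  assumes T: "finite T" "s \<in> T"
  shows "exceed_lim T c \<le> \<bar>c s\<bar>"
proof -
  have "exceed_lim T c \<le> (\<integral>\<zeta>. \<bar>c s\<bar> * Z \<zeta> s \<partial>N)"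
    unfolding exceed_lim_def
  proof (rule integral_mono)
    have "T \<noteq> {}" using T by blast
    with T(1) show "integrable N (\<lambda>\<zeta>. Min ((\<lambda>t. \<bar>c t\<bar> * Z \<zeta> t) ` T))"
      by (induction rule: finite_ne_induct) (auto simp: Z_integrable)
  qed (use T in \<open>auto simp: Z_integrable\<close>)
  then show ?thesis by (simp add: Z_expectation)
qed

text \<open>Limit paths are nonpositive only almost surely. Clipping leaves the integral unchanged
  and matches the form of \<open>exceed_lim\<close> along paths.\<close>

definition dual_mean :: real where
  "dual_mean = (\<integral>f. dual_D_norm N Z (\<lambda>s. min 0 (f s)) \<partial>nu_lim)"

lemma dual_mean_eq: "dual_mean = (\<integral>\<omega>. dual_D_norm N Z (\<eta> \<omega>) \<partial>Q)"
proof -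
  note [measurable] = borel_measurable_continuous_onI[OF dual_continuous]
    borel_measurable_continuous_onI[OF dual_min_continuous[of 0]]
  have "dual_mean = (\<integral>f. dual_D_norm N Z (apply_bcontfun f) \<partial>nu_lim)"
    unfolding dual_mean_def
  proof (rule integral_cong_AE)
    show "AE f in nu_lim. dual_D_norm N Z (\<lambda>s. min 0 (apply_bcontfun f s)) = dual_D_norm N Z (apply_bcontfun f)"
      using AE_nu_lim_nonpos by eventually_elim (simp add: min_absorb2)
  qed (use borel_measurable_continuous_onI[OF dual_min_continuous[of 0]] in simp_all)
  also have "\<dots> = (\<integral>\<omega>. dual_D_norm N Z (\<eta> \<omega>) \<partial>Q)"
    unfolding nu_lim_def by (intro integral_distr) simp_all
  finally show ?thesis .
qed

text \<open>\<open>undefined\<close> serves as a base point common to all nets, so that the values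
  there dominate the minima over every net at once.\<close>

lemma nets:
  obtains T :: "nat \<Rightarrow> 's set" where "\<And>k. finite (T k)" "\<And>k. undefined \<in> T k"
    "\<And>k s. \<exists>t\<in>T k. dist s t < 1 / real (Suc k)"
proof -
  have "\<exists>T :: 's set. finite T \<and> undefined \<in> T \<and> (\<forall>s. \<exists>t\<in>T. dist s t < 1 / real (Suc k))" for k
  proof -
    obtain T :: "'s set" where "finite T" "\<And>s. \<exists>t\<in>T. dist s t < 1 / real (Suc k)"
      using finite_net[OF cpt, of "1 / real (Suc k)"]
      by (metis of_nat_0_less_iff zero_less_Suc zero_less_divide_1_iff)
    then show ?thesis
      by (intro exI[of _ "insert undefined T"]) auto
  qed
  then show thesis using that by metis
qed

lemma exceed_lim_net_tendsto:
  fixes f :: "'s \<Rightarrow>\<^sub>C real"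
  assumes T: "\<And>k. finite (T k)" and u: "\<And>k. undefined \<in> T k"
    and net: "\<And>k s. \<exists>t\<in>T k. dist s t < 1 / real (Suc k)"
  shows "(\<lambda>k. exceed_lim (T k) (\<lambda>s. min 0 (f s))) \<longlonglongrightarrow> dual_D_norm N Z (\<lambda>s. min 0 (f s))"
  unfolding exceed_lim_def dual_D_norm_def
proof (rule integral_dominated_convergence)
  have B: "\<bar>min 0 (f s)\<bar> \<le> norm f" for s
    using abs_min_zero_add_le[of f s 0] by simp
  show "(\<lambda>\<zeta>. INF s. \<bar>min 0 (f s)\<bar> * Z \<zeta> s) \<in> borel_measurable N"
    using dual_integrable[OF B] by (rule borel_measurable_integrable)
  show "(\<lambda>\<zeta>. Min ((\<lambda>t. \<bar>min 0 (f t)\<bar> * Z \<zeta> t) ` T k)) \<in> borel_measurable N" for k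
    using T by (intro borel_measurable_Min) simp_all
  show "integrable N (\<lambda>\<zeta>. \<bar>min 0 (f undefined)\<bar> * Z \<zeta> undefined)"
    by (intro integrable_mult_right Z_integrable)
  show "AE \<zeta> in N. (\<lambda>k. Min ((\<lambda>t. \<bar>min 0 (f t)\<bar> * Z \<zeta> t) ` T k)) \<longlonglongrightarrow> (INF s. \<bar>min 0 (f s)\<bar> * Z \<zeta> s)"
  proof (rule AE_I2)
    fix \<zeta>
    have "(\<lambda>s. \<bar>min 0 (f s)\<bar> * Z \<zeta> s) \<in> bcontfun"
    proof (rule bcontfun_normI)
      show "continuous_on UNIV (\<lambda>s. \<bar>min 0 (f s)\<bar> * Z \<zeta> s)"
        by (intro continuous_intros) auto
      show "norm (\<bar>min 0 (f s)\<bar> * Z \<zeta> s) \<le> norm f * norm (Z \<zeta>)" for s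
        using norm_bounded[of "Z \<zeta>" s] unfolding real_norm_def abs_mult abs_abs
        by (intro mult_mono B) auto
    qed
    then obtain h where h: "(\<lambda>s. \<bar>min 0 (f s)\<bar> * Z \<zeta> s) = apply_bcontfun h"
      by (rule bcontfunE)
    show "(\<lambda>k. Min ((\<lambda>t. \<bar>min 0 (f t)\<bar> * Z \<zeta> t) ` T k)) \<longlonglongrightarrow> (INF s. \<bar>min 0 (f s)\<bar> * Z \<zeta> s)"
      unfolding h by (rule Min_net_tendsto_INF[OF cpt T net])
  qed
  show "AE \<zeta> in N. norm (Min ((\<lambda>t. \<bar>min 0 (f t)\<bar> * Z \<zeta> t) ` T k)) \<le> \<bar>min 0 (f undefined)\<bar> * Z \<zeta> undefined" for k
  proof (rule AE_I2)
    fix \<zeta> assume \<zeta>: "\<zeta> \<in> space N"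
    have "Min ((\<lambda>t. \<bar>min 0 (f t)\<bar> * Z \<zeta> t) ` T k) \<le> \<bar>min 0 (f undefined)\<bar> * Z \<zeta> undefined"
      using T u by (intro Min_le) auto
    moreover have "0 \<le> Min ((\<lambda>t. \<bar>min 0 (f t)\<bar> * Z \<zeta> t) ` T k)"
      using T[of k] u[of k] Z_nonneg[OF \<zeta>] by (subst Min_ge_iff) (auto intro!: mult_nonpos_nonneg)
    ultimately show "norm (Min ((\<lambda>t. \<bar>min 0 (f t)\<bar> * Z \<zeta> t) ` T k)) \<le> \<bar>min 0 (f undefined)\<bar> * Z \<zeta> undefined"
      by simp
  qed
qed

text \<open>Dominated convergence over f after the one over the generator: by
  \<open>exceed_lim_le_point\<close> the integrands are bounded through the value of f at the base
  point, which has an exponential tail.\<close>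

lemma exceed_lim_mean_tendsto:
  assumes T: "\<And>k. finite (T k)" and u: "\<And>k. undefined \<in> T k"
    and net: "\<And>k s. \<exists>t\<in>T k. dist s t < 1 / real (Suc k)"
  shows "(\<lambda>k. \<integral>f. exceed_lim (T k) (\<lambda>s. min 0 (f s)) \<partial>nu_lim) \<longlonglongrightarrow> dual_mean"
  unfolding dual_mean_def
proof (rule integral_dominated_convergence)
  have ne: "T k \<noteq> {}" for k using u[of k] by blast
  show "(\<lambda>f. dual_D_norm N Z (\<lambda>s. min 0 (apply_bcontfun f s))) \<in> borel_measurable nu_lim"
    using borel_measurable_continuous_onI[OF dual_min_continuous[of 0]] by simp
  show "(\<lambda>f. exceed_lim (T k) (\<lambda>s. min 0 (apply_bcontfun f s))) \<in> borel_measurable nu_lim" for k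
    using borel_measurable_continuous_onI[OF exceed_lim_continuous[OF T ne, of k 0]] by simp
  show "integrable nu_lim (\<lambda>f. max 0 (- f undefined - 0))"
    by (rule nu_lim_tail_integral) simp
  show "AE f in nu_lim. (\<lambda>k. exceed_lim (T k) (\<lambda>s. min 0 (apply_bcontfun f s)))
      \<longlonglongrightarrow> dual_D_norm N Z (\<lambda>s. min 0 (apply_bcontfun f s))"
    by (intro AE_I2 exceed_lim_net_tendsto T u net)
  show "AE f in nu_lim. norm (exceed_lim (T k) (\<lambda>s. min 0 (apply_bcontfun f s))) \<le> max 0 (- f undefined - 0)" for k
  proof (rule AE_I2)
    fix f :: "'s \<Rightarrow>\<^sub>C real"
    have "exceed_lim (T k) (\<lambda>s. min 0 (f s)) \<le> \<bar>min 0 (f undefined)\<bar>"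
      by (rule exceed_lim_le_point[OF T u])
    moreover have "\<bar>min 0 (f undefined)\<bar> = max 0 (- f undefined - 0)"
      by (simp add: min_def max_def)
    ultimately show "norm (exceed_lim (T k) (\<lambda>s. min 0 (f s))) \<le> max 0 (- f undefined - 0)"
      using exceed_lim_nonneg[OF T ne, of k "\<lambda>s. min 0 (f s)"] by simp
  qed
qed

lemma dual_min_integrable:
  assumes a: "0 \<le> a"
  shows "integrable nu_lim (\<lambda>f. dual_D_norm N Z (\<lambda>s. min 0 (f s + a)))"
proof (rule Bochner_Integration.integrable_bound)
  show "integrable nu_lim (\<lambda>f. exceed_lim {undefined} (\<lambda>t. min 0 (f t + a)))"
    by (intro exceed_lim_integrable a) auto
  show "(\<lambda>f. dual_D_norm N Z (\<lambda>s. min 0 (apply_bcontfun f s + a))) \<in> borel_measurable nu_lim"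
    using borel_measurable_continuous_onI[OF dual_min_continuous[of a]] by simp
  show "AE f in nu_lim. norm (dual_D_norm N Z (\<lambda>s. min 0 (apply_bcontfun f s + a)))
      \<le> norm (exceed_lim {undefined} (\<lambda>t. min 0 (apply_bcontfun f t + a)))"
  proof (rule AE_I2)
    fix f :: "'s \<Rightarrow>\<^sub>C real"
    have "dual_D_norm N Z (\<lambda>s. min 0 (f s + a)) \<le> exceed_lim {undefined} (\<lambda>t. min 0 (f t + a))"
      by (intro dual_le_exceed_lim[of _ _ "norm f + \<bar>a\<bar>"] abs_min_zero_add_le) simp_all
    then show "norm (dual_D_norm N Z (\<lambda>s. min 0 (f s + a))) \<le> norm (exceed_lim {undefined} (\<lambda>t. min 0 (f t + a)))"
      using dual_nonneg[of "\<lambda>s. min 0 (f s + a)"] by simp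
  qed
qed

text \<open>Raising f by a lowers its clipped absolute value by at most a, at the price
  \<open>a * sup_mean\<close>; an infimum over S is below the minimum over any T. As the bound holds
  for every T, the fineness of the net can be dictated by roughness alone.\<close>

lemma dual_mean_le_shift:
  assumes T: "finite T" "T \<noteq> {}" and a: "0 \<le> a"
  shows "dual_mean - a * sup_mean \<le> (\<integral>f. exceed_lim T (\<lambda>t. min 0 (f t + a)) \<partial>nu_lim)"
proof -
  have b: "\<bar>min 0 (f s + x)\<bar> \<le> norm f + \<bar>x\<bar>" for f :: "'s \<Rightarrow>\<^sub>C real" and s x
    by (rule abs_min_zero_add_le)
  have "dual_mean \<le> (\<integral>f. exceed_lim T (\<lambda>t. min 0 (f t + a)) + a * sup_mean \<partial>nu_lim)"
    unfolding dual_mean_def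
  proof (rule integral_mono)
    show "integrable nu_lim (\<lambda>f. dual_D_norm N Z (\<lambda>s. min 0 (apply_bcontfun f s)))"
      using dual_min_integrable[of 0] by simp
    show "integrable nu_lim (\<lambda>f. exceed_lim T (\<lambda>t. min 0 (f t + a)) + a * sup_mean)"
      by (intro Bochner_Integration.integrable_add exceed_lim_integrable T a) simp
    fix f :: "'s \<Rightarrow>\<^sub>C real"
    have "\<bar>min 0 (f s + 0)\<bar> \<le> \<bar>min 0 (f s + a)\<bar> + a" for s
      using a by (simp add: min_def)
    then have "dual_D_norm N Z (\<lambda>s. min 0 (f s + 0)) \<le> dual_D_norm N Z (\<lambda>s. min 0 (f s + a)) + a * sup_mean"
      by (intro dual_le[of _ "norm f + \<bar>0\<bar>" _ "norm f + \<bar>a\<bar>"] b a)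
    then have "dual_D_norm N Z (\<lambda>s. min 0 (f s)) \<le> dual_D_norm N Z (\<lambda>s. min 0 (f s + a)) + a * sup_mean"
      by simp
    also have "dual_D_norm N Z (\<lambda>s. min 0 (f s + a)) \<le> exceed_lim T (\<lambda>s. min 0 (f s + a))"
      by (rule dual_le_exceed_lim[OF T, of _ "norm f + \<bar>a\<bar>"]) (rule b)
    finally show "dual_D_norm N Z (\<lambda>s. min 0 (f s)) \<le> exceed_lim T (\<lambda>s. min 0 (f s + a)) + a * sup_mean"
      by simp
  qed
  also have "\<dots> = (\<integral>f. exceed_lim T (\<lambda>t. min 0 (f t + a)) \<partial>nu_lim) + a * sup_mean"
    using nu_lim.prob_space exceed_lim_integrable[OF T a]
    by (subst Bochner_Integration.integral_add) auto
  finally show ?thesis by simp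
qed

end

section \<open>Roughness and the lower bound\<close>

context copula_attraction
begin

text \<open>The limit process stays below - 2c with probability q = exp (- D-norm of the constant
  2c) > 0. The gap between - 2c and - c feeds \<open>nu_portmanteau\<close>, and half of q survives
  as \<open>\<kappa>\<close>.\<close>

lemma nu_below_bounded_away:
  assumes "c > 0"
  obtains \<kappa> where "\<kappa> > 0"
    "eventually (\<lambda>n. \<kappa> \<le> measure (nu n) {f :: 's \<Rightarrow>\<^sub>C real. \<forall>s\<in>UNIV. f s \<le> - c}) sequentially"
proof -
  let ?\<phi> = "\<lambda>f :: 's \<Rightarrow>\<^sub>C real. SUP s. f s"
  define q where "q = measure nu_lim {f :: 's \<Rightarrow>\<^sub>C real. \<forall>s. f s \<le> - 2 * c}"
  note [measurable] = borel_measurable_continuous_onI[OF continuous_on_SUP_bcontfun]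
  have "(\<lambda>_ :: 's. - 2 * c) \<in> fun_E_nonpos"
    using assms by (auto simp: fun_E_nonpos_def fun_E_def)
  then have "q = exp (- D_norm N Z (\<lambda>_. - 2 * c))"
    unfolding q_def by (subst nu_lim_eq_Q) (simp_all add: borel_bcontfun_le eta_le_prob)
  then have q: "q > 0" by simp
  have "q \<le> measure nu_lim {f :: 's \<Rightarrow>\<^sub>C real. ?\<phi> f \<le> - 2 * c}"
    unfolding q_def by (intro nu_lim.finite_measure_mono) (auto intro: cSUP_least)
  also have "{f :: 's \<Rightarrow>\<^sub>C real. ?\<phi> f \<le> - 2 * c} = space nu_lim - {f :: 's \<Rightarrow>\<^sub>C real. - 2 * c < ?\<phi> f}"
    by (auto simp: not_less)
  also have "measure nu_lim \<dots> = 1 - measure nu_lim {f :: 's \<Rightarrow>\<^sub>C real. - 2 * c < ?\<phi> f}"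
    by (intro nu_lim.prob_compl) simp
  finally have lim: "measure nu_lim {f :: 's \<Rightarrow>\<^sub>C real. - 2 * c < ?\<phi> f} \<le> 1 - q" by simp
  have "eventually (\<lambda>n. measure (nu n) {f :: 's \<Rightarrow>\<^sub>C real. - c \<le> ?\<phi> f} \<le> measure nu_lim {f :: 's \<Rightarrow>\<^sub>C real. - 2 * c < ?\<phi> f} + q / 2) sequentially"
    using assms q by (intro nu_portmanteau continuous_on_SUP_bcontfun) auto
  then have "eventually (\<lambda>n. q / 2 \<le> measure (nu n) {f :: 's \<Rightarrow>\<^sub>C real. \<forall>s\<in>UNIV. f s \<le> - c}) sequentially"
  proof eventually_elim
    case (elim n)
    interpret nu: prob_space "nu n" by (rule prob_space_nu)
    have "1 - measure (nu n) {f :: 's \<Rightarrow>\<^sub>C real. - c \<le> ?\<phi> f} = measure (nu n) (space (nu n) - {f :: 's \<Rightarrow>\<^sub>C real. - c \<le> ?\<phi> f})"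
      by (intro nu.prob_compl[symmetric]) simp
    also have "\<dots> \<le> measure (nu n) {f :: 's \<Rightarrow>\<^sub>C real. \<forall>s\<in>UNIV. f s \<le> - c}"
    proof (rule nu.finite_measure_mono)
      show "space (nu n) - {f :: 's \<Rightarrow>\<^sub>C real. - c \<le> ?\<phi> f} \<subseteq> {f :: 's \<Rightarrow>\<^sub>C real. \<forall>s\<in>UNIV. f s \<le> - c}"
      proof safe
        fix f :: "'s \<Rightarrow>\<^sub>C real" and s assume "\<not> - c \<le> ?\<phi> f"
        moreover have "f s \<le> ?\<phi> f" by (intro cSUP_upper) auto
        ultimately show "f s \<le> - c" by linarith
      qed
    qed (simp add: borel_bcontfun_le)
    finally show ?case using elim lim by linarith
  qed
  with q show thesis by (intro that[of "q / 2"]) auto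
qed

text \<open>The event that the modulus of continuity of n (u - 1), truncated at - c, exceeds e. The
  truncation ignores oscillations below - c, which the maximum does not reveal when it lies above
  that level.\<close>

definition rough :: "nat \<Rightarrow> real \<Rightarrow> real \<Rightarrow> real \<Rightarrow> ('s \<Rightarrow>\<^sub>C real) set" where
  "rough n c \<delta> e = {u :: 's \<Rightarrow>\<^sub>C real. \<exists>s t. dist s t < \<delta> \<and>
    e < \<bar>max (- c) (real n * (u s - 1)) - max (- c) (real n * (u t - 1))\<bar>}"

lemma rough_borel [measurable]: "rough n c \<delta> e \<in> sets borel"
proof -
  have "rough n c \<delta> e = (\<Union>p\<in>{p. dist (fst p) (snd p) < \<delta>}.
      {u :: 's \<Rightarrow>\<^sub>C real. e < \<bar>max (- c) (real n * (apply_bcontfun u (fst p) - 1)) - max (- c) (real n * (u (snd p) - 1))\<bar>})"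
    by (simp add: rough_def set_eq_iff)
  also have "open \<dots>"
    by (intro open_UN ballI open_Collect_less continuous_intros)
  finally show ?thesis by (rule borel_open)
qed

text \<open>
  If one copy is rough above the level \<open>- c\<close> while all others stay below it, then the maximum is rough.
\<close>

lemma rough_prob_le:
  assumes n: "n \<ge> 1" and e: "0 < e" and \<delta>: "0 < \<delta>"
  shows "real n * measure mu (rough n c \<delta> e) * measure (nu n) {f :: 's \<Rightarrow>\<^sub>C real. \<forall>s\<in>UNIV. f s \<le> - c}
    \<le> measure (nu n) {f :: 's \<Rightarrow>\<^sub>C real. e \<le> osc \<delta> f}"
proof -
  let ?B = "{u :: 's \<Rightarrow>\<^sub>C real. \<forall>s\<in>UNIV. real n * (u s - 1) \<le> - c}"
  note [measurable] = borel_measurable_continuous_onI[OF continuous_on_osc[OF \<delta>]]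
  have B: "?B \<in> sets borel"
  proof -
    have "?B = {u :: 's \<Rightarrow>\<^sub>C real. \<forall>s\<in>UNIV. apply_bcontfun u s \<le> 1 - c / real n}"
      using n by (auto simp: field_simps)
    then show ?thesis by (simp only: borel_bcontfun_ball_le)
  qed
  have "measure (nu n) {f :: 's \<Rightarrow>\<^sub>C real. \<forall>s\<in>UNIV. f s \<le> - c} = measure mu ?B ^ n"
    by (rule nu_le[OF n])
  \<comment> \<open>\<open>nu_le\<close> yields the n-th power, but only the n - 1 copies other than
    the rough one have to stay low; a factor of at most 1 is dropped.\<close>
  also have "\<dots> \<le> measure mu ?B ^ (n - 1)"
    by (intro power_decreasing) auto
  finally have "real n * measure mu (rough n c \<delta> e) * measure (nu n) {f :: 's \<Rightarrow>\<^sub>C real. \<forall>s\<in>UNIV. f s \<le> - c}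
      \<le> real n * measure mu (rough n c \<delta> e) * measure mu ?B ^ (n - 1)"
    by (intro mult_left_mono) auto
  also have "\<dots> = measure M (\<Union>i\<in>{1..n}. {\<omega> \<in> space M. Us i \<omega> \<in> rough n c \<delta> e \<and> (\<forall>j\<in>{1..n}-{i}. Us j \<omega> \<in> ?B)})"
  proof (rule prob_one_exceeds[OF n rough_borel B, symmetric])
    \<comment> \<open>A path below - c everywhere becomes constant under truncation, and e >
      0.\<close>
    show "rough n c \<delta> e \<inter> ?B = {}"
      using e by (auto simp: rough_def max_absorb1)
  qed
  also have "\<dots> \<le> measure M {\<omega> \<in> space M. e \<le> osc \<delta> (norm_max n (\<lambda>i. Us i \<omega>))}"
  proof (rule M.finite_measure_mono)
    show "{\<omega> \<in> space M. e \<le> osc \<delta> (norm_max n (\<lambda>i. Us i \<omega>))} \<in> sets M"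
      using n measurable_compose[OF norm_max_Us_measurable[OF n] borel_measurable_continuous_onI[OF continuous_on_osc[OF \<delta>]]]
      by simp
    show "(\<Union>i\<in>{1..n}. {\<omega> \<in> space M. Us i \<omega> \<in> rough n c \<delta> e \<and> (\<forall>j\<in>{1..n}-{i}. Us j \<omega> \<in> ?B)})
        \<subseteq> {\<omega> \<in> space M. e \<le> osc \<delta> (norm_max n (\<lambda>i. Us i \<omega>))}"
    proof safe
      fix i \<omega> assume i: "i \<in> {1..n}" and r: "Us i \<omega> \<in> rough n c \<delta> e" and o: "\<forall>j\<in>{1..n}-{i}. Us j \<omega> \<in> ?B"
      let ?x = "\<lambda>i. Us i \<omega>"
      let ?X = "norm_max n ?x"
      \<comment> \<open>With all other copies at most - c, the maximum and copy i agree after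
        truncation, so the roughness of copy i passes to the maximum.\<close>
      have eq: "max (- c) (?X s) = max (- c) (real n * (Us i \<omega> s - 1))" for s
      proof -
        have "?X s \<le> max (- c) (real n * (Us i \<omega> s - 1))"
          unfolding norm_max_le_iff[OF n]
        proof
          fix j assume "j \<in> {1..n}"
          then show "real n * (Us j \<omega> s - 1) \<le> max (- c) (real n * (Us i \<omega> s - 1))"
            using o by (cases "j = i") (auto simp: le_max_iff_disj)
        qed
        moreover have "real n * (Us i \<omega> s - 1) \<le> ?X s"
          using norm_max_le_iff[OF n, of ?x s "?X s"] i by blast
        ultimately show ?thesis by linarith
      qed
      obtain s t where st: "dist s t < \<delta>" "e < \<bar>max (- c) (?X s) - max (- c) (?X t)\<bar>"
        using r unfolding rough_def eq by blast
      have "\<bar>max (- c) (?X s) - max (- c) (?X t)\<bar> \<le> \<bar>?X s - ?X t\<bar>"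
        by linarith
      then show "e \<le> osc \<delta> ?X"
        using osc_upper[OF st(1), of ?X] st(2) by linarith
    qed
  qed
  also have "\<dots> = measure (nu n) {f :: 's \<Rightarrow>\<^sub>C real. e \<le> osc \<delta> f}"
    unfolding nu_def using n
    by (subst measure_distr) (auto intro!: arg_cong[of _ _ "measure M"])
  finally show ?thesis .
qed

lemma exceed_UNIV_borel: "{u :: 's \<Rightarrow>\<^sub>C real. \<forall>t\<in>UNIV. (f :: 's \<Rightarrow>\<^sub>C real) t < real n * (u t - 1)} \<in> sets borel"
proof -
  have [measurable]: "(\<lambda>u :: 's \<Rightarrow>\<^sub>C real. real n *\<^sub>R (u - const_bcontfun 1)) \<in> borel_measurable borel"
    by (intro borel_measurable_bcontfunI[OF cpt]) simp
  have "Measurable.pred borel (\<lambda>u :: 's \<Rightarrow>\<^sub>C real. \<forall>s. f s < (real n *\<^sub>R (u - const_bcontfun 1)) s)"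
    by (rule pred_bcontfun_less[OF cpt]) measurable
  then show ?thesis by (simp add: pred_def)
qed

section \<open>The averaged exceedance on the whole space, compared with finite nets\<close>

definition mean_exceed :: "nat \<Rightarrow> real" where
  "mean_exceed n = (\<integral>f. exceed n UNIV f \<partial>nu n)"

lemma exceed_UNIV_integrable:
  assumes n: "n \<ge> 1"
  shows "integrable (nu n) (\<lambda>f. exceed n UNIV f)"
proof -
  interpret nu: prob_space "nu n" by (rule prob_space_nu)
  have "(\<lambda>f. exceed n UNIV (apply_bcontfun f)) \<in> borel_measurable (nu n)"
    using complete_record_prob_Suc(2)[OF n] unfolding exceed_def by simp
  then show ?thesis
    by (intro nu.integrable_const_bound[of _ "real n"]) (auto simp: exceed_nonneg exceed_le_n)
qed

lemma mean_exceed_eq: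
  assumes n: "n \<ge> 1"
  shows "mean_exceed n = real n * complete_record_prob M Us (Suc n)"
  unfolding mean_exceed_def exceed_def complete_record_prob_Suc(1)[OF n] by simp

lemma exceed_integrable:
  assumes T: "finite T" and n: "n \<ge> 1"
  shows "integrable (nu n) (\<lambda>f. exceed n T (\<lambda>t. f t + a))"
proof -
  interpret nu: prob_space "nu n" by (rule prob_space_nu)
  show ?thesis
    using borel_measurable_continuous_onI[OF exceed_continuous[OF T n, of a]]
    by (intro nu.integrable_const_bound[of _ "real n"]) (auto simp: exceed_nonneg exceed_le_n)
qed

lemma mean_exceed_upper:
  assumes T: "finite T" and n: "n \<ge> 1"
  shows "mean_exceed n \<le> (\<integral>f. exceed n T (\<lambda>t. f t + 0) \<partial>nu n)"
  unfolding mean_exceed_def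
proof (rule integral_mono[OF exceed_UNIV_integrable[OF n] exceed_integrable[OF T n]])
  fix f :: "'s \<Rightarrow>\<^sub>C real"
  show "exceed n UNIV f \<le> exceed n T (\<lambda>t. f t + 0)"
    unfolding exceed_def using exceed_set_borel[OF T, of f n]
    by (intro mult_left_mono mu.finite_measure_mono) auto
qed

text \<open>Let f oscillate by less than e and stay above - c. A copy that exceeds f + 2e on the net
  and is not rough then exceeds f everywhere: going from a net point to s loses e for f and e for
  the truncated copy, and a truncated value above f s > - c is the true value. The remaining terms
  account for rough copies, atypical f and the tail at t0.\<close>

lemma mean_exceed_lower:
  assumes T: "finite T" "t0 \<in> T" and n: "n \<ge> 1" and net: "\<And>s. \<exists>t\<in>T. dist s t < \<delta>"
    and \<delta>: "\<delta> > 0" and e: "e > 0" and K: "0 \<le> K"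
  shows "(\<integral>f. exceed n T (\<lambda>t. f t + 2 * e) \<partial>nu n) \<le> mean_exceed n + real n * measure mu (rough n c \<delta> e)
    + K * (measure (nu n) {f :: 's \<Rightarrow>\<^sub>C real. e \<le> osc \<delta> f} + measure (nu n) {f :: 's \<Rightarrow>\<^sub>C real. c \<le> norm f}) + 2 * exp (- K)"
proof -
  interpret nu: prob_space "nu n" by (rule prob_space_nu)
  note [measurable] = borel_measurable_continuous_onI[OF continuous_on_osc[OF \<delta>]]
  let ?B = "{f :: 's \<Rightarrow>\<^sub>C real. e \<le> osc \<delta> f} \<union> {f :: 's \<Rightarrow>\<^sub>C real. c \<le> norm f}"
  let ?m = "real n * measure mu (rough n c \<delta> e)"
  have B: "?B \<in> sets borel" by measurable
  have bound: "exceed n T (\<lambda>t. f t + 2 * e)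
      \<le> exceed n UNIV f + ?m + K * indicator ?B f + max 0 (- f t0 - K)" for f :: "'s \<Rightarrow>\<^sub>C real"
  proof (cases "f \<in> ?B")
    case False
    then have f: "osc \<delta> f < e" "norm f < c" by auto
    have "measure mu {u :: 's \<Rightarrow>\<^sub>C real. \<forall>t\<in>T. f t + 2 * e < real n * (u t - 1)}
        \<le> measure mu ({u :: 's \<Rightarrow>\<^sub>C real. \<forall>t\<in>UNIV. f t < real n * (u t - 1)} \<union> rough n c \<delta> e)"
    proof (rule mu.finite_measure_mono)
      show "{u :: 's \<Rightarrow>\<^sub>C real. \<forall>t\<in>T. f t + 2 * e < real n * (u t - 1)}
          \<subseteq> {u :: 's \<Rightarrow>\<^sub>C real. \<forall>t\<in>UNIV. f t < real n * (u t - 1)} \<union> rough n c \<delta> e"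
      proof
        fix u :: "'s \<Rightarrow>\<^sub>C real"
        assume u: "u \<in> {u :: 's \<Rightarrow>\<^sub>C real. \<forall>t\<in>T. f t + 2 * e < real n * (u t - 1)}"
        have "f s < real n * (u s - 1)" if nr: "u \<notin> rough n c \<delta> e" for s
        proof -
          obtain t where t: "t \<in> T" "dist s t < \<delta>" using net by blast
          have "f t + 2 * e < real n * (u t - 1)" using u t(1) by blast
          moreover have "\<bar>f s - f t\<bar> < e" using osc_upper[OF t(2), of f] f(1) by linarith
          moreover have "- c < f s" using norm_bounded[of f s] f(2) by simp
          moreover have "\<bar>max (- c) (real n * (u s - 1)) - max (- c) (real n * (u t - 1))\<bar> \<le> e"
            using nr t(2) unfolding rough_def by fastforce
          ultimately show ?thesis by linarith
        qed
        then show "u \<in> {u :: 's \<Rightarrow>\<^sub>C real. \<forall>t\<in>UNIV. f t < real n * (u t - 1)} \<union> rough n c \<delta> e"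
          by blast
      qed
    qed (use exceed_UNIV_borel[of f n] in auto)
    also have "\<dots> \<le> measure mu {u :: 's \<Rightarrow>\<^sub>C real. \<forall>t\<in>UNIV. f t < real n * (u t - 1)} + measure mu (rough n c \<delta> e)"
      using exceed_UNIV_borel[of f n] by (intro measure_Un_le) auto
    finally have "exceed n T (\<lambda>t. f t + 2 * e) \<le> real n * (measure mu {u :: 's \<Rightarrow>\<^sub>C real. \<forall>t\<in>UNIV. f t < real n * (u t - 1)} + measure mu (rough n c \<delta> e))"
      unfolding exceed_def by (intro mult_left_mono) auto
    then have "exceed n T (\<lambda>t. f t + 2 * e) \<le> exceed n UNIV f + ?m"
      by (simp add: exceed_def distrib_left)
    moreover have "indicator ?B f = (0 :: real)" using False by simp
    ultimately show ?thesis by simp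
  next
    case True
    \<comment> \<open>For an atypical f the point t0 alone gives the bound K plus a tail. Only K is
      multiplied by the probability of such f; the tail is integrated over all f.\<close>
    have "exceed n T (\<lambda>t. f t + 2 * e) \<le> real n * measure mu {u :: 's \<Rightarrow>\<^sub>C real. f t0 + 2 * e < real n * (u t0 - 1)}"
      unfolding exceed_def using T by (intro mult_left_mono mu.finite_measure_mono) auto
    also have "\<dots> \<le> max 0 (- (f t0 + 2 * e))"
      by (rule mu_greater[OF n])
    also have "\<dots> \<le> K + max 0 (- f t0 - K)"
      using e K by linarith
    finally have "exceed n T (\<lambda>t. f t + 2 * e) \<le> K * indicator ?B f + max 0 (- f t0 - K)"
      using True by simp
    moreover have "0 \<le> exceed n UNIV f + ?m"
      using exceed_nonneg[of n UNIV f] by simp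
    ultimately show ?thesis by linarith
  qed
  have intB: "integrable (nu n) (\<lambda>f. K * indicator ?B f :: real)"
    using B by (intro integrable_mult_right nu.integrable_const_bound[of _ 1]) (auto simp: indicator_def)
  note ints = exceed_UNIV_integrable[OF n] intB nu_tail_integral(1)[OF n K, of t0]
  have "(\<integral>f. exceed n T (\<lambda>t. f t + 2 * e) \<partial>nu n)
      \<le> (\<integral>f. exceed n UNIV (apply_bcontfun f) + ?m + K * indicator ?B f + max 0 (- f t0 - K) \<partial>nu n)"
    by (intro integral_mono bound exceed_integrable[OF T(1) n] Bochner_Integration.integrable_add ints) simp
  also have "\<dots> = mean_exceed n + ?m + K * measure (nu n) ?B + (\<integral>f. max 0 (- f t0 - K) \<partial>nu n)"
    using B ints nu.prob_space[unfolded space_nu] by (simp add: mean_exceed_def)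
  also have "measure (nu n) ?B \<le> measure (nu n) {f :: 's \<Rightarrow>\<^sub>C real. e \<le> osc \<delta> f} + measure (nu n) {f :: 's \<Rightarrow>\<^sub>C real. c \<le> norm f}"
    by (intro measure_Un_le) auto
  also have "(\<integral>f. max 0 (- f t0 - K) \<partial>nu n) \<le> 2 * exp (- K)"
    by (rule nu_tail_integral(2)[OF n K])
  finally show ?thesis using K by (simp add: mult_left_mono)
qed

section \<open>Tightness of the norm and of the modulus of continuity\<close>

lemma nu_norm_tight:
  assumes "\<tau> > 0"
  obtains c where "c > 0" "eventually (\<lambda>n. measure (nu n) {f :: 's \<Rightarrow>\<^sub>C real. c \<le> norm f} \<le> \<tau>) sequentially"
proof -
  let ?A = "\<lambda>m :: nat. {f :: 's \<Rightarrow>\<^sub>C real. real m < norm f}"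
  have "(\<lambda>m. measure nu_lim (?A m)) \<longlonglongrightarrow> measure nu_lim (\<Inter>m. ?A m)"
    by (intro nu_lim.finite_Lim_measure_decseq) (auto simp: decseq_def)
  also have "(\<Inter>m. ?A m) = {}"
  proof safe
    fix f :: "'s \<Rightarrow>\<^sub>C real" assume f: "f \<in> (\<Inter>m. ?A m)"
    obtain m :: nat where "norm f < real m" using reals_Archimedean2 by blast
    moreover have "real m < norm f" using f by blast
    ultimately show "f \<in> {}" by simp
  qed
  finally have "eventually (\<lambda>m. measure nu_lim (?A m) < \<tau> / 2) sequentially"
    using assms by (intro order_tendstoD(2)) auto
  then obtain m where m: "measure nu_lim (?A m) < \<tau> / 2"
    using eventually_happens by force
  have "eventually (\<lambda>n. measure (nu n) {f :: 's \<Rightarrow>\<^sub>C real. real m + 1 \<le> norm f} \<le> measure nu_lim (?A m) + \<tau> / 2) sequentially"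
    using assms by (intro nu_portmanteau continuous_intros) auto
  then have "eventually (\<lambda>n. measure (nu n) {f :: 's \<Rightarrow>\<^sub>C real. real m + 1 \<le> norm f} \<le> \<tau>) sequentially"
    by eventually_elim (use m in linarith)
  then show thesis by (intro that[of "real m + 1"]) auto
qed

text \<open>Every path is uniformly continuous, so under the limit law the events of large
  oscillation decrease to the empty set. One mesh is fixed there and carried over to large n, with
  the gap from e / 2 to e used up by \<open>nu_portmanteau\<close>.\<close>

lemma nu_osc_tight:
  assumes "\<tau> > 0" "e > 0"
  obtains k where "eventually (\<lambda>n. measure (nu n) {f :: 's \<Rightarrow>\<^sub>C real. e \<le> osc (1 / real (Suc k)) f} \<le> \<tau>) sequentially"
proof -
  let ?A = "\<lambda>k :: nat. {f :: 's \<Rightarrow>\<^sub>C real. e / 2 < osc (1 / real (Suc k)) f}"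
  have [measurable]: "osc (1 / real (Suc k)) \<in> borel_measurable (borel :: ('s \<Rightarrow>\<^sub>C real) measure)" for k
    by (intro borel_measurable_continuous_onI continuous_on_osc) simp
  have "(\<lambda>k. measure nu_lim (?A k)) \<longlonglongrightarrow> measure nu_lim (\<Inter>k. ?A k)"
  proof (rule nu_lim.finite_Lim_measure_decseq)
    have "?A k \<in> sets borel" for k by measurable
    then show "range ?A \<subseteq> sets nu_lim" by (simp only: sets_nu_lim) blast
    show "decseq ?A"
      unfolding decseq_def
    proof (intro allI impI subsetI)
      fix k l and f :: "'s \<Rightarrow>\<^sub>C real" assume "k \<le> l" "f \<in> ?A l"
      moreover have "osc (1 / real (Suc l)) f \<le> osc (1 / real (Suc k)) f"
        using \<open>k \<le> l\<close> by (intro osc_mono divide_left_mono) auto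
      ultimately show "f \<in> ?A k" by simp
    qed
  qed
  also have "(\<Inter>k. ?A k) = {}"
  proof safe
    fix f :: "'s \<Rightarrow>\<^sub>C real" assume f: "f \<in> (\<Inter>k. ?A k)"
    obtain d where d: "d > 0" "\<And>s t. dist s t < d \<Longrightarrow> \<bar>f s - f t\<bar> < e / 2"
      using bcontfun_uniformly_continuous[OF cpt, of "e / 2" f] assms(2) by auto
    obtain k where "1 / real (Suc k) < d" using nat_approx_posE[OF d(1)] by blast
    then have "osc (1 / real (Suc k)) f \<le> e / 2"
      using d(2) by (intro osc_least) (auto intro: less_imp_le less_trans)
    then show "f \<in> {}" using f by (auto simp: not_le[symmetric])
  qed
  finally have "eventually (\<lambda>k. measure nu_lim (?A k) < \<tau> / 2) sequentially"
    using assms by (intro order_tendstoD(2)) auto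
  then obtain k where k: "measure nu_lim (?A k) < \<tau> / 2"
    using eventually_happens by force
  have "eventually (\<lambda>n. measure (nu n) {f :: 's \<Rightarrow>\<^sub>C real. e \<le> osc (1 / real (Suc k)) f} \<le> measure nu_lim (?A k) + \<tau> / 2) sequentially"
    using assms by (intro nu_portmanteau continuous_on_osc) auto
  then have "eventually (\<lambda>n. measure (nu n) {f :: 's \<Rightarrow>\<^sub>C real. e \<le> osc (1 / real (Suc k)) f} \<le> \<tau>) sequentially"
    by eventually_elim (use k in linarith)
  then show thesis by (rule that)
qed

section \<open>The two one-sided limits and the conclusion\<close>

lemma mean_exceed_limsup:
  assumes \<epsilon>: "\<epsilon> > 0"
  shows "eventually (\<lambda>n. mean_exceed n < dual_mean + \<epsilon>) sequentially"
proof -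
  obtain T :: "nat \<Rightarrow> 's set" where T: "\<And>k. finite (T k)" "\<And>k. undefined \<in> T k"
    "\<And>k s. \<exists>t\<in>T k. dist s t < 1 / real (Suc k)"
    using nets by metis
  have "eventually (\<lambda>k. (\<integral>f. exceed_lim (T k) (\<lambda>s. min 0 (f s)) \<partial>nu_lim) < dual_mean + \<epsilon>) sequentially"
    using \<epsilon> by (intro order_tendstoD(2)[OF exceed_lim_mean_tendsto[OF T]]) simp
  then obtain k where k: "(\<integral>f. exceed_lim (T k) (\<lambda>s. min 0 (f s)) \<partial>nu_lim) < dual_mean + \<epsilon>"
    using eventually_happens by force
  have "T k \<noteq> {}" using T(2)[of k] by blast
  then have "(\<lambda>n. \<integral>f. exceed n (T k) (\<lambda>t. f t + 0) \<partial>nu n) \<longlonglongrightarrow> (\<integral>f. exceed_lim (T k) (\<lambda>t. min 0 (f t + 0)) \<partial>nu_lim)"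
    using T(1) by (intro exceed_integral_tendsto) auto
  then have "eventually (\<lambda>n. (\<integral>f. exceed n (T k) (\<lambda>t. f t + 0) \<partial>nu n) < dual_mean + \<epsilon>) sequentially"
    using k by (intro order_tendstoD(2)) auto
  then show ?thesis
    using eventually_ge_at_top[of 1]
    by eventually_elim (rule le_less_trans[OF mean_exceed_upper[OF T(1)]])
qed

lemma mean_exceed_liminf:
  assumes \<epsilon>: "\<epsilon> > 0"
  shows "eventually (\<lambda>n. dual_mean - \<epsilon> < mean_exceed n) sequentially"
proof -
  \<comment> \<open>Chosen so that the price \<open>2 * e * sup_mean\<close> of the shift is at most
    \<open>\<epsilon> / 5\<close>; the summand 1 keeps the denominator positive.\<close>
  define e where "e = \<epsilon> / (10 * (sup_mean + 1))"
  have sm: "0 < sup_mean + 1" using sup_mean_nonneg by simp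
  have e: "e > 0" using \<epsilon> sm by (simp add: e_def)
  have "e * (10 * (sup_mean + 1)) = \<epsilon>"
    using sm unfolding e_def by (intro nonzero_eq_divide_eq[THEN iffD1]) auto
  then have "10 * (e * sup_mean) + 10 * e = \<epsilon>"
    by (simp add: algebra_simps)
  then have e2: "2 * e * sup_mean \<le> \<epsilon> / 5"
    using e unfolding mult.assoc by linarith
  have "((\<lambda>K :: real. 2 * exp (- K)) \<longlongrightarrow> 2 * 0) at_top"
    by (intro tendsto_intros filterlim_compose[OF exp_at_bot] filterlim_uminus_at_bot_at_top)
  then have "eventually (\<lambda>K :: real. 2 * exp (- K) < \<epsilon> / 5) at_top"
    using \<epsilon> by (intro order_tendstoD(2)) auto
  then obtain K :: real where K: "0 < K" "2 * exp (- K) < \<epsilon> / 5"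
    using eventually_happens[OF eventually_conj[OF _ eventually_gt_at_top[of 0]]] by (metis trivial_limit_at_top_linorder)
  obtain c where c: "c > 0" "eventually (\<lambda>n. measure (nu n) {f :: 's \<Rightarrow>\<^sub>C real. c \<le> norm f} \<le> \<epsilon> / (5 * K)) sequentially"
    using nu_norm_tight[of "\<epsilon> / (5 * K)"] \<epsilon> K(1) by auto
  obtain \<kappa> where \<kappa>: "\<kappa> > 0"
    "eventually (\<lambda>n. \<kappa> \<le> measure (nu n) {f :: 's \<Rightarrow>\<^sub>C real. \<forall>s\<in>UNIV. f s \<le> - c}) sequentially"
    using nu_below_bounded_away[OF c(1)] by blast
  \<comment> \<open>\<open>\<tau>\<close> is paid twice: K times for large oscillations of the
    maximum, and 1 / \<open>\<kappa>\<close> times for rough copies via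
    \<open>rough_prob_le\<close>. Together this is \<open>\<epsilon> / 5\<close>.\<close>
  define \<tau> where "\<tau> = \<epsilon> / (5 * (K + 1 / \<kappa>))"
  have K\<kappa>: "0 < K + 1 / \<kappa>" using K(1) \<kappa>(1) by (intro add_pos_pos) auto
  have \<tau>: "\<tau> > 0" "K * \<tau> + \<tau> / \<kappa> = \<epsilon> / 5"
  proof -
    show "\<tau> > 0" using \<epsilon> K\<kappa> by (simp add: \<tau>_def)
    have "\<tau> * (5 * (K + 1 / \<kappa>)) = \<epsilon>"
      using K\<kappa> unfolding \<tau>_def by (intro nonzero_eq_divide_eq[THEN iffD1]) auto
    then have "5 * (K * \<tau>) + 5 * (\<tau> / \<kappa>) = \<epsilon>"
      by (simp add: algebra_simps)
    then show "K * \<tau> + \<tau> / \<kappa> = \<epsilon> / 5" by linarith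
  qed
  obtain k where k: "eventually (\<lambda>n. measure (nu n) {f :: 's \<Rightarrow>\<^sub>C real. e \<le> osc (1 / real (Suc k)) f} \<le> \<tau>) sequentially"
    using nu_osc_tight[OF \<tau>(1) e] by blast
  define \<delta> where "\<delta> = 1 / real (Suc k)"
  have \<delta>: "\<delta> > 0" by (simp add: \<delta>_def)
  obtain T :: "'s set" where T: "finite T" "T \<noteq> {}" "\<And>s. \<exists>t\<in>T. dist s t < \<delta>"
    using finite_net[OF cpt \<delta>] by metis
  obtain t0 where t0: "t0 \<in> T" using T(2) by blast
  have "(\<lambda>n. \<integral>f. exceed n T (\<lambda>t. f t + 2 * e) \<partial>nu n) \<longlonglongrightarrow> (\<integral>f. exceed_lim T (\<lambda>t. min 0 (f t + 2 * e)) \<partial>nu_lim)"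
    using e by (intro exceed_integral_tendsto T) simp
  moreover have "dual_mean - 2 * \<epsilon> / 5 < (\<integral>f. exceed_lim T (\<lambda>t. min 0 (f t + 2 * e)) \<partial>nu_lim)"
    using dual_mean_le_shift[OF T(1,2), of "2 * e"] e e2 \<epsilon> by linarith
  ultimately have "eventually (\<lambda>n. dual_mean - 2 * \<epsilon> / 5 < (\<integral>f. exceed n T (\<lambda>t. f t + 2 * e) \<partial>nu n)) sequentially"
    by (rule order_tendstoD(1))
  then show ?thesis
    using c(2) \<kappa>(2) k[folded \<delta>_def] eventually_ge_at_top[of 1]
  proof eventually_elim
    case (elim n)
    have "real n * measure mu (rough n c \<delta> e) * \<kappa>
        \<le> real n * measure mu (rough n c \<delta> e) * measure (nu n) {f :: 's \<Rightarrow>\<^sub>C real. \<forall>s\<in>UNIV. f s \<le> - c}"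
      using elim(3) by (intro mult_left_mono) auto
    also have "\<dots> \<le> \<tau>"
      using rough_prob_le[OF elim(5) e \<delta>] elim(4) by (rule order_trans)
    finally have "real n * measure mu (rough n c \<delta> e) \<le> \<tau> / \<kappa>"
      using \<kappa>(1) by (simp add: field_simps)
    moreover have "K * measure (nu n) {f :: 's \<Rightarrow>\<^sub>C real. e \<le> osc \<delta> f} \<le> K * \<tau>"
      using elim(4) K(1) by (intro mult_left_mono) auto
    moreover have "K * measure (nu n) {f :: 's \<Rightarrow>\<^sub>C real. c \<le> norm f} \<le> \<epsilon> / 5"
    proof -
      have "K * measure (nu n) {f :: 's \<Rightarrow>\<^sub>C real. c \<le> norm f} \<le> K * (\<epsilon> / (5 * K))"
        using elim(2) K(1) by (intro mult_left_mono) auto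
      then show ?thesis using K(1) by simp
    qed
    \<comment> \<open>The five parts are: the shift, the convergence on the net, the two uses of
      \<open>\<tau>\<close>, the paths of norm at least c, and the tail 2 exp (- K).\<close>
    ultimately show ?case
      using mean_exceed_lower[OF T(1) t0 elim(5) T(3) \<delta> e less_imp_le[OF K(1)], of c] elim(1) K(2) \<tau>(2)
      unfolding distrib_left by linarith
  qed
qed

lemma mean_exceed_tendsto: "mean_exceed \<longlonglongrightarrow> dual_mean"
proof (rule tendstoI)
  fix \<epsilon> :: real assume \<epsilon>: "\<epsilon> > 0"
  show "eventually (\<lambda>n. dist (mean_exceed n) dual_mean < \<epsilon>) sequentially"
    using mean_exceed_limsup[OF \<epsilon>] mean_exceed_liminf[OF \<epsilon>]
    by eventually_elim (auto simp: dist_real_def abs_less_iff)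
qed

lemma record_prob_tendsto:
  "(\<lambda>n. real n * complete_record_prob M Us n) \<longlonglongrightarrow> (\<integral>\<omega>. dual_D_norm N Z (\<eta> \<omega>) \<partial>Q)"
proof -
  \<comment> \<open>\<open>mean_exceed n\<close> weights the record of copy n + 1 with n in place of
    n + 1; the factor 1 + 1/n corrects this.\<close>
  have "(\<lambda>n. (1 + inverse (real n)) * mean_exceed n) \<longlonglongrightarrow> (1 + 0) * dual_mean"
    by (intro tendsto_intros mean_exceed_tendsto lim_inverse_n)
  then have "(\<lambda>n. (1 + inverse (real n)) * mean_exceed n) \<longlonglongrightarrow> dual_mean" by simp
  then have "(\<lambda>n. real (Suc n) * complete_record_prob M Us (Suc n)) \<longlonglongrightarrow> dual_mean"
    by (rule Lim_transform_eventually)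
      (use eventually_ge_at_top[of 1] in eventually_elim, simp add: mean_exceed_eq field_simps)
  then show ?thesis
    unfolding dual_mean_eq by (rule filterlim_sequentially_Suc[THEN iffD1])
qed

end

theorem theorem3p1:
  fixes M :: "'w measure" and Us :: "nat \<Rightarrow> 'w \<Rightarrow> 's::metric_space \<Rightarrow>\<^sub>C real"
    and P :: "'u measure" and U :: "'u \<Rightarrow> 's \<Rightarrow>\<^sub>C real"
    and Q :: "'v measure" and \<eta> :: "'v \<Rightarrow> 's \<Rightarrow>\<^sub>C real"
    and N :: "'z measure" and Z :: "'z \<Rightarrow> 's \<Rightarrow>\<^sub>C real"
  assumes "compact (UNIV :: 's set)"
    and "copula_process P U"
    and "iid_copies M Us P U"
    and "standard_max_stable Q \<eta>"
    and "generator_of N Z Q \<eta>"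
    and "in_domain_of_attraction P U Q \<eta>"
  shows "(\<forall>n\<ge>1. sample_concurrence_prob M Us n = real n * complete_record_prob M Us n) \<and>
    (\<lambda>n. real n * complete_record_prob M Us n) \<longlonglongrightarrow> (\<integral>\<omega>. dual_D_norm N Z (\<eta> \<omega>) \<partial>Q)"
proof -
  interpret copula_attraction M Us P U Q \<eta> N Z
    using assms by unfold_locales
  show ?thesis
    using sample_concurrence_eq record_prob_tendsto by blast
qed

end
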